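(* Let $N$ be a normal subgroup of $G$ that is $A$-definable, and let $\kappa$ be any infinite cardinal. Suppose that $|H^1_{\mathrm{def}}(\mathcal G,G/N)|\le\kappa$ and $|H^1_{\mathrm{def}}(\mathcal G,N_\mu)|\le\kappa$ for all $\mu\in H^1_{\mathrm{def}}(\mathcal G,G)$. Then $|H^1_{\mathrm{def}}(\mathcal G,G)|\le\kappa$.
   Context: Setting. Fix a first-order structure $M$ and a subset $A$ of $M$ such that: (i) $M$ is atomic over $A$, i.e. for every finite tuple $a$ from $M$ the type $\mathrm{tp}(a/A)$ is isolated; (ii) for all finite tuples $a,b$ from $M$ with $\mathrm{tp}(a/A)=\mathrm{tp}(b/A)$ there is $\sigma\in\mathrm{Aut}(M/A)$ with $\sigma(a)=b$; (iii) the theory of $M$ eliminates imaginaries (so $G/N$ is identified with an $A$-definable group). Put $\mathcal G=\mathrm{Aut}(M/A)$. $G$ is an arbitrary group definable in $M$ with parameters from $A$; $\mathcal G$ acts on $G$ by group automorphisms. "Definable" means definable in $M$ with parameters from $M$; "$A$-definable" means definable with parameters from $A$. Tuples are finite. Definable cohomology. For an $A$-definable group $G$, a definable cocycle from $\mathcal G$ to $G$ is a map $\Phi:\mathcal G\to G$ with $\Phi(\sigma_1\sigma_2)=\Phi(\sigma_1)\cdot\sigma_1(\Phi(\sigma_2))$ for which there are a tuple $a$ from $M$ and an $A$-definable (partial) function $h(x,y)$ with $\Phi(\sigma)=h(a,\sigma(a))$ for all $\sigma\in\mathcal G$. $\Phi$ and $\Psi$ are cohomologous if there is $b\in G$ with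 $\Psi(\sigma)=b^{-1}\Phi(\sigma)\sigma(b)$ for all $\sigma$. $H^1_{\mathrm{def}}(\mathcal G,G)$ is the set of equivalence classes of definable cocycles. The $A$-form $N_\mu$. $\mathrm{Aut}_{\mathrm{def}}(N)$ is the group of $M$-definable group automorphisms of $N$, on which $\sigma\in\mathcal G$ acts by applying $\sigma$ to graphs (similarly $\sigma(g)$ is defined for any definable map $g$). A definable cocycle from $\mathcal G$ to $\mathrm{Aut}_{\mathrm{def}}(N)$ is a map $\Lambda$ with $\Lambda(\sigma_1\sigma_2)=\Lambda(\sigma_1)\cdot\sigma_1(\Lambda(\sigma_2))$ and $\Lambda(\sigma)(-)=h(a,\sigma(a),-)$ for some tuple $a$ and $A$-definable $h$. $\Lambda,\Lambda'$ are cohomologous if $\Lambda'(\sigma)=\phi^{-1}\Lambda(\sigma)\sigma(\phi)$ for some $\phi\in\mathrm{Aut}_{\mathrm{def}}(N)$ and all $\sigma$. $H^1_{\mathrm{def}}(\mathcal G,\mathrm{Aut}_{\mathrm{def}}(N))$ is the set of classes. An $A$-form of $N$ is an $A$-definable group $H$ admitting an $M$-definable group isomorphism $g:N\to H$. The map $H\mapsto[\sigma\mapsto g^{-1}\circ\sigma(g)]$ is a bijection between $A$-forms of $N$ up to $A$-definable isomorphism and $H^1_{\mathrm{def}}(\mathcal G,\mathrm{Aut}_{\mathrm{def}}(N))$. For $\mu\in H^1_{\mathrm{def}}(\mathcal G,G)$ and a definable cocycle $\Phi$ of class $\mu$, the map $\Lambda_\Phi(\sigma)(n)=\Phi(\sigma)\,n\,\Phi(\sigma)^{-1}$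 is a definable cocycle from $\mathcal G$ to $\mathrm{Aut}_{\mathrm{def}}(N)$ whose class depends only on $\mu$. $N_\mu$ is the $A$-form of $N$ (unique up to $A$-definable isomorphism) corresponding to this class. *)

theory Defs
  imports "HOL-Algebra.Coset" "HOL-Algebra.Bij"
begin

unbundle cardinal_syntax

section \<open>First-order structures\<close>

datatype 'f trm = Var nat | App 'f "'f trm list"

datatype ('f, 'r) fml =
    Eql "'f trm" "'f trm"
  | Rel 'r "'f trm list"
  | Neg "('f, 'r) fml"
  | Conj "('f, 'r) fml" "('f, 'r) fml"
  | Exi nat "('f, 'r) fml"

text \<open>
  The universe of a structure is the type \<open>'a\<close>.  The sets \<open>fsyms\<close> and \<open>rsyms\<close> list the symbols of the
  language with their arities (both may be empty); the interpretations matter only at those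
  symbols and arities.
\<close>

record ('f, 'r, 'a) fo_structure =
  fsyms :: "('f \<times> nat) set"
  rsyms :: "('r \<times> nat) set"
  fint :: "'f \<Rightarrow> 'a list \<Rightarrow> 'a"
  rint :: "'r \<Rightarrow> 'a list \<Rightarrow> bool"

primrec wf_trm :: "('f, 'r, 'a) fo_structure \<Rightarrow> 'f trm \<Rightarrow> bool" where
  "wf_trm M (Var i) \<longleftrightarrow> True"
| "wf_trm M (App f ts) \<longleftrightarrow> (f, length ts) \<in> fsyms M \<and> list_all (wf_trm M) ts"

primrec wf_fml :: "('f, 'r, 'a) fo_structure \<Rightarrow> ('f, 'r) fml \<Rightarrow> bool" where
  "wf_fml M (Eql s t) \<longleftrightarrow> wf_trm M s \<and> wf_trm M t"
| "wf_fml M (Rel r ts) \<longleftrightarrow> (r, length ts) \<in> rsyms M \<and> list_all (wf_trm M) ts"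
| "wf_fml M (Neg p) \<longleftrightarrow> wf_fml M p"
| "wf_fml M (Conj p q) \<longleftrightarrow> wf_fml M p \<and> wf_fml M q"
| "wf_fml M (Exi i p) \<longleftrightarrow> wf_fml M p"

primrec fv_trm :: "'f trm \<Rightarrow> nat set" where
  "fv_trm (Var i) = {i}"
| "fv_trm (App f ts) = \<Union> (set (map fv_trm ts))"

primrec fv :: "('f, 'r) fml \<Rightarrow> nat set" where
  "fv (Eql s t) = fv_trm s \<union> fv_trm t"
| "fv (Rel r ts) = \<Union> (set (map fv_trm ts))"
| "fv (Neg p) = fv p"
| "fv (Conj p q) = fv p \<union> fv q"
| "fv (Exi i p) = fv p - {i}"

primrec val :: "('f, 'r, 'a) fo_structure \<Rightarrow> (nat \<Rightarrow> 'a) \<Rightarrow> 'f trm \<Rightarrow> 'a" where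
  "val M v (Var i) = v i"
| "val M v (App f ts) = fint M f (map (val M v) ts)"

primrec sat :: "('f, 'r, 'a) fo_structure \<Rightarrow> (nat \<Rightarrow> 'a) \<Rightarrow> ('f, 'r) fml \<Rightarrow> bool" where
  "sat M v (Eql s t) \<longleftrightarrow> val M v s = val M v t"
| "sat M v (Rel r ts) \<longleftrightarrow> rint M r (map (val M v) ts)"
| "sat M v (Neg p) \<longleftrightarrow> \<not> sat M v p"
| "sat M v (Conj p q) \<longleftrightarrow> sat M v p \<and> sat M v q"
| "sat M v (Exi i p) \<longleftrightarrow> (\<exists>a. sat M (v(i := a)) p)"

text \<open>
  A formula in \<open>n\<close> variables with parameters from \<open>B\<close> is a pair of a formula \<open>p\<close> and a list \<open>cs\<close> of
  parameters: variables below \<open>n\<close> stand for the entries of the \<open>n\<close>-tuple, and the variables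
  from \<open>n\<close> to \<open>n + length cs - 1\<close> stand for the entries of \<open>cs\<close>.
\<close>

definition formulas_over ::
  "('f, 'r, 'a) fo_structure \<Rightarrow> 'a set \<Rightarrow> nat \<Rightarrow> (('f, 'r) fml \<times> 'a list) set" where
  "formulas_over M B n =
     {(p, cs). wf_fml M p \<and> set cs \<subseteq> B \<and> fv p \<subseteq> {..<n + length cs}}"

definition holds ::
  "('f, 'r, 'a) fo_structure \<Rightarrow> 'a list \<Rightarrow> ('f, 'r) fml \<times> 'a list \<Rightarrow> bool" where
  "holds M xs pc \<longleftrightarrow> sat M (\<lambda>i. (xs @ snd pc) ! i) (fst pc)"

definition definable ::
  "('f, 'r, 'a) fo_structure \<Rightarrow> 'a set \<Rightarrow> nat \<Rightarrow> 'a list set \<Rightarrow> bool" where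
  "definable M B n X \<longleftrightarrow>
     (\<exists>pc \<in> formulas_over M B n. X = {xs. length xs = n \<and> holds M xs pc})"

text \<open>A partial function on tuples is given by its domain \<open>D\<close> and its values on \<open>D\<close>.\<close>

definition definable_map ::
  "('f, 'r, 'a) fo_structure \<Rightarrow> 'a set \<Rightarrow> 'a list set \<Rightarrow> ('a list \<Rightarrow> 'a list) \<Rightarrow> bool" where
  "definable_map M B D f \<longleftrightarrow>
     (\<exists>m n. (\<forall>x\<in>D. length x = m \<and> length (f x) = n) \<and>
            definable M B (m + n) {x @ f x | x. x \<in> D})"

definition tp ::
  "('f, 'r, 'a) fo_structure \<Rightarrow> 'a set \<Rightarrow> 'a list \<Rightarrow> (('f, 'r) fml \<times> 'a list) set" where
  "tp M A a = {pc \<in> formulas_over M A (length a). holds M a pc}"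

definition isolated_tp :: "('f, 'r, 'a) fo_structure \<Rightarrow> 'a set \<Rightarrow> 'a list \<Rightarrow> bool" where
  "isolated_tp M A a \<longleftrightarrow>
     (\<exists>pc \<in> tp M A a. \<forall>qd \<in> tp M A a.
        \<forall>x. length x = length a \<longrightarrow> holds M x pc \<longrightarrow> holds M x qd)"

definition atomic_over :: "('f, 'r, 'a) fo_structure \<Rightarrow> 'a set \<Rightarrow> bool" where
  "atomic_over M A \<longleftrightarrow> (\<forall>a. isolated_tp M A a)"

definition Aut :: "('f, 'r, 'a) fo_structure \<Rightarrow> 'a set \<Rightarrow> ('a \<Rightarrow> 'a) set" where
  "Aut M A = {\<sigma>. bij \<sigma> \<and>
     (\<forall>(f, n) \<in> fsyms M. \<forall>xs. length xs = n \<longrightarrow> \<sigma> (fint M f xs) = fint M f (map \<sigma> xs)) \<and>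
     (\<forall>(r, n) \<in> rsyms M. \<forall>xs. length xs = n \<longrightarrow> rint M r xs = rint M r (map \<sigma> xs)) \<and>
     (\<forall>a\<in>A. \<sigma> a = a)}"

definition homogeneous_over :: "('f, 'r, 'a) fo_structure \<Rightarrow> 'a set \<Rightarrow> bool" where
  "homogeneous_over M A \<longleftrightarrow>
     (\<forall>a b. length a = length b \<longrightarrow> tp M A a = tp M A b \<longrightarrow> (\<exists>\<sigma> \<in> Aut M A. map \<sigma> a = b))"

text \<open>
  Every equivalence relation on \<open>n\<close>-tuples definable without parameters is the kernel of a map
  to \<open>k\<close>-tuples definable without parameters.  For each defining formula this is expressed by
  sentences of the language, so it is a property of the theory of \<open>M\<close>.
\<close>

definition eliminates_imaginaries :: "('f, 'r, 'a) fo_structure \<Rightarrow> bool" where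
  "eliminates_imaginaries M \<longleftrightarrow>
     (\<forall>n E. equiv {x. length x = n} E \<longrightarrow>
        definable M {} (n + n) {x @ y | x y. (x, y) \<in> E} \<longrightarrow>
        (\<exists>f. definable_map M {} {x. length x = n} f \<and>
             (\<forall>x y. length x = n \<longrightarrow> length y = n \<longrightarrow> (x, y) \<in> E \<longleftrightarrow> f x = f y)))"


section \<open>Definable groups and definable cohomology\<close>

definition definable_group ::
  "('f, 'r, 'a) fo_structure \<Rightarrow> 'a set \<Rightarrow> 'a list monoid \<Rightarrow> bool" where
  "definable_group M B G \<longleftrightarrow> group G \<and>
     (\<exists>n. definable M B n (carrier G) \<and>
          definable M B (n + n + n)
            {x @ y @ (x \<otimes>\<^bsub>G\<^esub> y) | x y. x \<in> carrier G \<and> y \<in> carrier G})"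

definition definable_cocycles ::
  "('f, 'r, 'a) fo_structure \<Rightarrow> 'a set \<Rightarrow> 'a list monoid \<Rightarrow> (('a \<Rightarrow> 'a) \<Rightarrow> 'a list) set" where
  "definable_cocycles M A G = {\<Phi> \<in> Aut M A \<rightarrow>\<^sub>E carrier G.
     (\<forall>\<sigma>\<in>Aut M A. \<forall>\<tau>\<in>Aut M A. \<Phi> (\<sigma> \<circ> \<tau>) = \<Phi> \<sigma> \<otimes>\<^bsub>G\<^esub> map \<sigma> (\<Phi> \<tau>)) \<and>
     (\<exists>a D h. definable_map M A D h \<and>
        (\<forall>\<sigma>\<in>Aut M A. a @ map \<sigma> a \<in> D \<and> \<Phi> \<sigma> = h (a @ map \<sigma> a)))}"

definition cohomologous ::
  "('f, 'r, 'a) fo_structure \<Rightarrow> 'a set \<Rightarrow> 'a list monoid \<Rightarrow> (('a \<Rightarrow> 'a) \<Rightarrow> 'a list) rel" where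
  "cohomologous M A G =
     {(\<Phi>, \<Psi>). \<Phi> \<in> definable_cocycles M A G \<and> \<Psi> \<in> definable_cocycles M A G \<and>
        (\<exists>b \<in> carrier G. \<forall>\<sigma>\<in>Aut M A. \<Psi> \<sigma> = inv\<^bsub>G\<^esub> b \<otimes>\<^bsub>G\<^esub> \<Phi> \<sigma> \<otimes>\<^bsub>G\<^esub> map \<sigma> b)}"

definition H1 ::
  "('f, 'r, 'a) fo_structure \<Rightarrow> 'a set \<Rightarrow> 'a list monoid \<Rightarrow> (('a \<Rightarrow> 'a) \<Rightarrow> 'a list) set set" where
  "H1 M A G = definable_cocycles M A G // cohomologous M A G"

text \<open>
  By elimination of imaginaries, \<open>G/N\<close> is an \<open>A\<close>-definable group: it is the target of an
  \<open>A\<close>-definable surjective homomorphism on \<open>G\<close> with kernel \<open>N\<close>, and this determines it up to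
  \<open>A\<close>-definable isomorphism.
\<close>

definition is_definable_quotient ::
  "('f, 'r, 'a) fo_structure \<Rightarrow> 'a set \<Rightarrow> 'a list monoid \<Rightarrow> 'a list set \<Rightarrow> 'a list monoid \<Rightarrow> bool"
where
  "is_definable_quotient M A G N Q \<longleftrightarrow> definable_group M A Q \<and>
     (\<exists>f. f \<in> hom G Q \<and> f ` carrier G = carrier Q \<and> kernel G Q f = N \<and>
          definable_map M A (carrier G) f)"

definition definable_quotient ::
  "('f, 'r, 'a) fo_structure \<Rightarrow> 'a set \<Rightarrow> 'a list monoid \<Rightarrow> 'a list set \<Rightarrow> 'a list monoid" where
  "definable_quotient M A G N = (SOME Q. is_definable_quotient M A G N Q)"


section \<open>Definable automorphisms and forms\<close>

definition definable_auts :: "('f, 'r, 'a) fo_structure \<Rightarrow> 'a list monoid \<Rightarrow> ('a list \<Rightarrow> 'a list) set" where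
  "definable_auts M N = {f \<in> auto N. definable_map M UNIV (carrier N) f}"

text \<open>
  The map on \<open>S\<close> whose graph is the image under \<open>\<sigma>\<close> of the graph of \<open>f\<close>, where \<open>S\<close> is the domain
  of \<open>f\<close> and is invariant under \<open>\<sigma>\<close>.
\<close>

definition map_act ::
  "'a list set \<Rightarrow> ('a \<Rightarrow> 'a) \<Rightarrow> ('a list \<Rightarrow> 'a list) \<Rightarrow> 'a list \<Rightarrow> 'a list" where
  "map_act S \<sigma> f = (\<lambda>x\<in>S. map \<sigma> (f (map (inv_into UNIV \<sigma>) x)))"

definition definable_aut_cocycles ::
  "('f, 'r, 'a) fo_structure \<Rightarrow> 'a set \<Rightarrow> 'a list monoid \<Rightarrow>
   (('a \<Rightarrow> 'a) \<Rightarrow> 'a list \<Rightarrow> 'a list) set" where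
  "definable_aut_cocycles M A N = {\<Lambda> \<in> Aut M A \<rightarrow>\<^sub>E definable_auts M N.
     (\<forall>\<sigma>\<in>Aut M A. \<forall>\<tau>\<in>Aut M A.
        \<Lambda> (\<sigma> \<circ> \<tau>) = \<Lambda> \<sigma> \<otimes>\<^bsub>AutoGroup N\<^esub> map_act (carrier N) \<sigma> (\<Lambda> \<tau>)) \<and>
     (\<exists>a D h. definable_map M A D h \<and>
        (\<forall>\<sigma>\<in>Aut M A. \<forall>x\<in>carrier N.
           a @ map \<sigma> a @ x \<in> D \<and> \<Lambda> \<sigma> x = h (a @ map \<sigma> a @ x)))}"

definition aut_cohomologous ::
  "('f, 'r, 'a) fo_structure \<Rightarrow> 'a set \<Rightarrow> 'a list monoid \<Rightarrow>
   (('a \<Rightarrow> 'a) \<Rightarrow> 'a list \<Rightarrow> 'a list) rel" where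
  "aut_cohomologous M A N =
     {(\<Lambda>, \<Lambda>'). \<Lambda> \<in> definable_aut_cocycles M A N \<and> \<Lambda>' \<in> definable_aut_cocycles M A N \<and>
        (\<exists>\<phi> \<in> definable_auts M N. \<forall>\<sigma>\<in>Aut M A.
           \<Lambda>' \<sigma> = inv\<^bsub>AutoGroup N\<^esub> \<phi> \<otimes>\<^bsub>AutoGroup N\<^esub> \<Lambda> \<sigma>
                    \<otimes>\<^bsub>AutoGroup N\<^esub> map_act (carrier N) \<sigma> \<phi>)}"

definition H1_aut ::
  "('f, 'r, 'a) fo_structure \<Rightarrow> 'a set \<Rightarrow> 'a list monoid \<Rightarrow>
   (('a \<Rightarrow> 'a) \<Rightarrow> 'a list \<Rightarrow> 'a list) set set" where
  "H1_aut M A N = definable_aut_cocycles M A N // aut_cohomologous M A N"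

definition definable_isos ::
  "('f, 'r, 'a) fo_structure \<Rightarrow> 'a list monoid \<Rightarrow> 'a list monoid \<Rightarrow> ('a list \<Rightarrow> 'a list) set" where
  "definable_isos M N H = {g \<in> iso N H. definable_map M UNIV (carrier N) g}"

definition is_form ::
  "('f, 'r, 'a) fo_structure \<Rightarrow> 'a set \<Rightarrow> 'a list monoid \<Rightarrow> 'a list monoid \<Rightarrow> bool" where
  "is_form M A N H \<longleftrightarrow> definable_group M A H \<and> definable_isos M N H \<noteq> {}"

definition form_cocycle ::
  "('f, 'r, 'a) fo_structure \<Rightarrow> 'a set \<Rightarrow> 'a list monoid \<Rightarrow> ('a list \<Rightarrow> 'a list) \<Rightarrow>
   ('a \<Rightarrow> 'a) \<Rightarrow> 'a list \<Rightarrow> 'a list" where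
  "form_cocycle M A N g =
     (\<lambda>\<sigma>\<in>Aut M A. \<lambda>x\<in>carrier N. inv_into (carrier N) g (map_act (carrier N) \<sigma> g x))"

definition conj_cocycle ::
  "('f, 'r, 'a) fo_structure \<Rightarrow> 'a set \<Rightarrow> 'a list monoid \<Rightarrow> 'a list set \<Rightarrow>
   (('a \<Rightarrow> 'a) \<Rightarrow> 'a list) \<Rightarrow> ('a \<Rightarrow> 'a) \<Rightarrow> 'a list \<Rightarrow> 'a list" where
  "conj_cocycle M A G N \<Phi> =
     (\<lambda>\<sigma>\<in>Aut M A. \<lambda>x\<in>N. \<Phi> \<sigma> \<otimes>\<^bsub>G\<^esub> x \<otimes>\<^bsub>G\<^esub> inv\<^bsub>G\<^esub> (\<Phi> \<sigma>))"

text \<open>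
  \<open>H\<close> is the form of \<open>N\<close> attached to \<open>\<mu>\<close> if its class is the class of the conjugation cocycle of a
  representative of \<open>\<mu>\<close>; neither class depends on the choices of \<open>g\<close> and \<open>\<Phi>\<close>.
\<close>

definition is_twisted_form ::
  "('f, 'r, 'a) fo_structure \<Rightarrow> 'a set \<Rightarrow> 'a list monoid \<Rightarrow> 'a list set \<Rightarrow>
   (('a \<Rightarrow> 'a) \<Rightarrow> 'a list) set \<Rightarrow> 'a list monoid \<Rightarrow> bool" where
  "is_twisted_form M A G N \<mu> H \<longleftrightarrow>
     is_form M A (G\<lparr>carrier := N\<rparr>) H \<and>
     (\<exists>g \<in> definable_isos M (G\<lparr>carrier := N\<rparr>) H. \<exists>\<Phi>\<in>\<mu>.
        \<exists>c \<in> H1_aut M A (G\<lparr>carrier := N\<rparr>).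
          form_cocycle M A (G\<lparr>carrier := N\<rparr>) g \<in> c \<and> conj_cocycle M A G N \<Phi> \<in> c)"

definition twisted_form ::
  "('f, 'r, 'a) fo_structure \<Rightarrow> 'a set \<Rightarrow> 'a list monoid \<Rightarrow> 'a list set \<Rightarrow>
   (('a \<Rightarrow> 'a) \<Rightarrow> 'a list) set \<Rightarrow> 'a list monoid" where
  "twisted_form M A G N \<mu> = (SOME H. is_twisted_form M A G N \<mu> H)"

end

theory Submission
  imports Defs "HOL-Algebra.Weak_Morphisms"
begin

text \<open>
  Write \<open>\<G>\<close> for \<open>Aut M A\<close>.  The quotient map \<open>p : G \<rightarrow> G/N\<close> commutes with \<open>\<G>\<close>, so it sends cocycles to
  cocycles and induces a map from the cohomology of \<open>G\<close> to that of \<open>G/N\<close>.  The target has at most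
  \<open>\<kappa>\<close> elements and \<open>\<kappa>\<close> is infinite, so it is enough to bound every nonempty fibre by \<open>\<kappa>\<close>.

  Take a class \<open>\<mu>\<close> in a fibre.  The form \<open>H = N\<^sub>\<mu>\<close> comes with an isomorphism \<open>g : N \<rightarrow> H\<close> and a cocycle
  \<open>\<Phi>\<close> of class \<open>\<mu>\<close> such that \<open>\<sigma>(g x) = g (\<Phi> \<sigma> \<cdot> \<sigma> x \<cdot> (\<Phi> \<sigma>)\<inverse>)\<close> for all \<open>x\<close> in \<open>N\<close>.  This identity says
  precisely that \<open>\<Psi> \<mapsto> (\<sigma> \<mapsto> g\<inverse> (\<Psi> \<sigma>) \<cdot> \<Phi> \<sigma>)\<close> turns cocycles in \<open>H\<close> into cocycles in \<open>G\<close>; the map respects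
  cohomology, and its values are the cocycles \<open>\<Theta>\<close> with \<open>\<Theta> \<sigma> \<in> N \<cdot> \<Phi> \<sigma>\<close>.  Every class in the fibre of \<open>\<mu>\<close>
  contains such a \<open>\<Theta>\<close>: the element of \<open>G/N\<close> that witnesses cohomology of the images lifts to \<open>G\<close>.
  So the cohomology of \<open>H\<close> maps onto the fibre, and the hypothesis on \<open>N\<^sub>\<mu>\<close> bounds it.

  Two things remain.  The first is definability.  With parameters from all of \<open>M\<close>, a partial
  definable function extends to a total one, and total definable functions compose without side
  conditions.  Definability over \<open>A\<close> is recovered from invariance under \<open>\<G>\<close>
  (\<open>invariant_definable\<close>), where atomicity and homogeneity enter.  In the same way a cocycle
  \<open>\<Phi> \<sigma> = h (a, \<sigma> a)\<close> with \<open>h\<close> definable over \<open>A\<close> is simply one of the form \<open>\<Phi> \<sigma> = f (\<sigma> a)\<close> with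
  \<open>f\<close> definable over \<open>M\<close> (\<open>cocycle_definability_iff\<close>).

  The second is the existence of \<open>G/N\<close> and of \<open>N\<^sub>\<mu>\<close>.  By elimination of imaginaries the members of
  a definable family of sets have codes in \<open>M\<close>, and an automorphism moves the code of a set to the
  code of its image (\<open>definable_family_codes\<close>).  The group \<open>G/N\<close> consists of the codes of the cosets
  of \<open>N\<close>.  The group \<open>N\<^sub>\<mu>\<close> consists of the codes of the curves \<open>{(\<sigma> a, (\<Phi> \<sigma>)\<inverse> n (\<Phi> \<sigma>)) | \<sigma> \<in> \<G>}\<close> for
  \<open>n\<close> in \<open>N\<close>, where \<open>\<Phi> \<sigma> = f (\<sigma> a)\<close>: the cocycle identity shows that \<open>\<sigma>\<close> carries the curve of \<open>n\<close> to
  the curve of \<open>\<Phi> \<sigma> \<cdot> \<sigma> n \<cdot> (\<Phi> \<sigma>)\<inverse>\<close>.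
\<close>


section \<open>Renaming variables\<close>

primrec rename_trm :: "(nat \<Rightarrow> nat) \<Rightarrow> 'f trm \<Rightarrow> 'f trm" where
  "rename_trm \<rho> (Var i) = Var (\<rho> i)"
| "rename_trm \<rho> (App f ts) = App f (map (rename_trm \<rho>) ts)"

text \<open>
  Variables are renamed along an arbitrary, possibly non-injective map.  The bound variable
  becomes an index that is not the image of any free variable, which rules out capture.
\<close>

primrec rename :: "('f, 'r) fml \<Rightarrow> (nat \<Rightarrow> nat) \<Rightarrow> ('f, 'r) fml" where
  "rename (Eql s t) \<rho> = Eql (rename_trm \<rho> s) (rename_trm \<rho> t)"
| "rename (Rel r ts) \<rho> = Rel r (map (rename_trm \<rho>) ts)"
| "rename (Neg p) \<rho> = Neg (rename p \<rho>)"
| "rename (Conj p q) \<rho> = Conj (rename p \<rho>) (rename q \<rho>)"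
| "rename (Exi i p) \<rho> =
     (let k = Suc (Max (insert 0 (\<rho> ` fv p))) in Exi k (rename p (\<rho>(i := k))))"

lemma finite_fv_trm: "finite (fv_trm t)"
  by (induction t) auto

lemma finite_fv: "finite (fv p)"
  by (induction p) (auto simp: finite_fv_trm)

lemma val_cong: "(\<And>i. i \<in> fv_trm t \<Longrightarrow> v i = w i) \<Longrightarrow> val M v t = val M w t"
proof (induction t)
  case (App f ts)
  then have "map (val M v) ts = map (val M w) ts" by (auto intro!: map_cong)
  then show ?case by (simp del: map_eq_conv)
qed simp

lemma sat_cong: "(\<And>i. i \<in> fv p \<Longrightarrow> v i = w i) \<Longrightarrow> sat M v p \<longleftrightarrow> sat M w p"
proof (induction p arbitrary: v w)
  case (Eql s t)
  then show ?case using val_cong[of s v w M] val_cong[of t v w M] by simp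
next
  case (Rel r ts)
  then have "map (val M v) ts = map (val M w) ts" by (auto intro!: map_cong val_cong)
  then show ?case by (simp del: map_eq_conv)
next
  case (Neg p)
  show ?case using Neg.IH[of v w] Neg.prems by simp
next
  case (Conj p q)
  show ?case using Conj.IH(1)[of v w] Conj.IH(2)[of v w] Conj.prems by simp
next
  case (Exi i p)
  have "sat M (v(i := a)) p \<longleftrightarrow> sat M (w(i := a)) p" for a
    using Exi.prems by (intro Exi.IH) auto
  then show ?case by simp
qed

lemma val_rename: "val M v (rename_trm \<rho> t) = val M (\<lambda>i. v (\<rho> i)) t"
proof (induction t)
  case (App f ts)
  then have "map (val M v) (map (rename_trm \<rho>) ts) = map (val M (\<lambda>i. v (\<rho> i))) ts"
    by auto
  then show ?case by (simp only: rename_trm.simps val.simps)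
qed simp

lemma fv_rename_trm: "fv_trm (rename_trm \<rho> t) = \<rho> ` fv_trm t"
  by (induction t) auto

lemma wf_rename_trm: "wf_trm M (rename_trm \<rho> t) = wf_trm M t"
  by (induction t) (auto simp: list_all_iff)

lemma wf_rename: "wf_fml M (rename p \<rho>) = wf_fml M p"
  by (induction p arbitrary: \<rho>) (auto simp: list_all_iff wf_rename_trm Let_def)

lemma fresh_index:
  assumes "finite S" "j \<in> S"
  shows "\<rho> j \<noteq> Suc (Max (insert 0 (\<rho> ` S)))"
proof -
  have "\<rho> j \<le> Max (insert 0 (\<rho> ` S))" using assms by (intro Max_ge) auto
  then show ?thesis by simp
qed

lemma fv_rename: "fv (rename p \<rho>) \<subseteq> \<rho> ` fv p"
proof (induction p arbitrary: \<rho>)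
  case (Exi i p)
  define k where "k = Suc (Max (insert 0 (\<rho> ` fv p)))"
  have "fv (rename p (\<rho>(i := k))) \<subseteq> (\<rho>(i := k)) ` fv p" by (rule Exi.IH)
  then show ?case by (auto simp: Let_def k_def split: if_splits)
next
  case (Conj p q)
  then show ?case by (simp add: image_Un) (meson le_supI1 le_supI2)
qed (auto simp: fv_rename_trm)

lemma sat_rename: "sat M v (rename p \<rho>) \<longleftrightarrow> sat M (\<lambda>i. v (\<rho> i)) p"
proof (induction p arbitrary: v \<rho>)
  case (Rel r ts)
  have "map (val M v) (map (rename_trm \<rho>) ts) = map (val M (\<lambda>i. v (\<rho> i))) ts"
    by (auto simp: val_rename)
  then show ?case by (simp only: rename.simps sat.simps)
next
  case (Exi i p)
  define k where "k = Suc (Max (insert 0 (\<rho> ` fv p)))"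
  have "sat M (v(k := a)) (rename p (\<rho>(i := k))) \<longleftrightarrow> sat M ((\<lambda>i. v (\<rho> i))(i := a)) p" for a
    unfolding Exi.IH
    using fresh_index[OF finite_fv, of _ p \<rho>] by (intro sat_cong) (auto simp: k_def)
  then show ?case
    unfolding rename.simps Let_def sat.simps k_def[symmetric] by (rule ex_cong1)
next
  case (Eql s t)
  show ?case by (simp only: rename.simps sat.simps val_rename)
next
  case (Neg p)
  show ?case by (simp only: rename.simps sat.simps Neg.IH)
next
  case (Conj p q)
  show ?case by (simp only: rename.simps sat.simps Conj.IH)
qed


section \<open>Automorphisms\<close>

lemma Aut_bij: "\<sigma> \<in> Aut M A \<Longrightarrow> bij \<sigma>"
  unfolding Aut_def mem_Collect_eq by (elim conjE)

lemma Aut_fixes: "\<sigma> \<in> Aut M A \<Longrightarrow> a \<in> A \<Longrightarrow> \<sigma> a = a"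
  unfolding Aut_def mem_Collect_eq by (elim conjE) (erule (1) bspec)

lemma Aut_fint:
  "\<sigma> \<in> Aut M A \<Longrightarrow> (f, length xs) \<in> fsyms M \<Longrightarrow> \<sigma> (fint M f xs) = fint M f (map \<sigma> xs)"
  unfolding Aut_def mem_Collect_eq
  by (elim conjE) (drule (1) bspec[of "fsyms M"], unfold prod.case, erule allE, erule mp, rule refl)

lemma Aut_rint:
  "\<sigma> \<in> Aut M A \<Longrightarrow> (r, length xs) \<in> rsyms M \<Longrightarrow> rint M r xs \<longleftrightarrow> rint M r (map \<sigma> xs)"
  unfolding Aut_def mem_Collect_eq
  by (elim conjE) (drule (1) bspec[of "rsyms M"], unfold prod.case, erule allE, erule mp, rule refl)

lemma AutI:
  assumes "bij \<sigma>" "\<And>a. a \<in> A \<Longrightarrow> \<sigma> a = a"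
    "\<And>f xs. (f, length xs) \<in> fsyms M \<Longrightarrow> \<sigma> (fint M f xs) = fint M f (map \<sigma> xs)"
    "\<And>r xs. (r, length xs) \<in> rsyms M \<Longrightarrow> rint M r xs \<longleftrightarrow> rint M r (map \<sigma> xs)"
  shows "\<sigma> \<in> Aut M A"
  unfolding Aut_def mem_Collect_eq using assms(1,2)
  by (intro conjI ballI allI impI case_prodI2) (assumption, rule assms(3), simp, rule assms(4), simp, simp)

lemma val_Aut:
  assumes "\<sigma> \<in> Aut M A" "wf_trm M t"
  shows "val M (\<lambda>i. \<sigma> (v i)) t = \<sigma> (val M v t)"
  using assms(2)
proof (induction t)
  case (App f ts)
  have "map (val M (\<lambda>i. \<sigma> (v i))) ts = map \<sigma> (map (val M v) ts)"
    using App by (auto simp: list_all_iff)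
  moreover have "\<sigma> (fint M f (map (val M v) ts)) = fint M f (map \<sigma> (map (val M v) ts))"
    using App.prems by (intro Aut_fint[OF assms(1)]) simp
  ultimately show ?case by (simp del: map_eq_conv map_map)
qed simp

lemma sat_Aut:
  assumes "\<sigma> \<in> Aut M A" "wf_fml M p"
  shows "sat M (\<lambda>i. \<sigma> (v i)) p \<longleftrightarrow> sat M v p"
  using assms(2)
proof (induction p arbitrary: v)
  case (Eql s t)
  have "inj \<sigma>" using Aut_bij[OF assms(1)] by (rule bij_is_inj)
  then show ?case using Eql val_Aut[OF assms(1)] by (auto dest: injD)
next
  case (Rel r ts)
  have "map (val M (\<lambda>i. \<sigma> (v i))) ts = map \<sigma> (map (val M v) ts)"
    using Rel val_Aut[OF assms(1)] by (auto simp: list_all_iff)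
  moreover have "rint M r (map (val M v) ts) \<longleftrightarrow> rint M r (map \<sigma> (map (val M v) ts))"
    using Rel.prems by (intro Aut_rint[OF assms(1)]) simp
  ultimately show ?case by (simp del: map_eq_conv map_map)
next
  case (Exi i p)
  have "surj \<sigma>" using Aut_bij[OF assms(1)] by (rule bij_is_surj)
  have upd: "(\<lambda>i. \<sigma> (v i))(i := \<sigma> a) = (\<lambda>j. \<sigma> ((v(i := a)) j))" for a by auto
  have "sat M ((\<lambda>i. \<sigma> (v i))(i := \<sigma> a)) p \<longleftrightarrow> sat M (v(i := a)) p" for a
    unfolding upd using Exi.prems by (intro Exi.IH) simp
  moreover have "\<exists>a. b = \<sigma> a" for b using \<open>surj \<sigma>\<close> by (auto simp: surj_def)
  ultimately have "(\<exists>b. sat M ((\<lambda>i. \<sigma> (v i))(i := b)) p) \<longleftrightarrow> (\<exists>a. sat M (v(i := a)) p)" by metis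
  then show ?case by (simp only: sat.simps)
next
  case (Neg p)
  then show ?case by (simp only: sat.simps wf_fml.simps)
next
  case (Conj p q)
  then show ?case by (simp only: sat.simps wf_fml.simps)
qed

lemma id_in_Aut: "id \<in> Aut M A"
  by (rule AutI) auto

lemma comp_in_Aut:
  assumes "\<sigma> \<in> Aut M A" "\<tau> \<in> Aut M A"
  shows "\<sigma> \<circ> \<tau> \<in> Aut M A"
proof (rule AutI)
  show "bij (\<sigma> \<circ> \<tau>)" using assms[THEN Aut_bij] by (intro bij_comp)
  show "(\<sigma> \<circ> \<tau>) a = a" if "a \<in> A" for a using assms[THEN Aut_fixes, OF that] by simp
  show "(\<sigma> \<circ> \<tau>) (fint M f xs) = fint M f (map (\<sigma> \<circ> \<tau>) xs)" if "(f, length xs) \<in> fsyms M" for f xs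
    using Aut_fint[OF assms(2) that] Aut_fint[OF assms(1), of f "map \<tau> xs"] that by simp
  show "rint M r xs \<longleftrightarrow> rint M r (map (\<sigma> \<circ> \<tau>) xs)" if "(r, length xs) \<in> rsyms M" for r xs
    using Aut_rint[OF assms(2) that] Aut_rint[OF assms(1), of r "map \<tau> xs"] that
    by (metis length_map map_map)
qed

lemma map_Aut_inv:
  assumes "\<sigma> \<in> Aut M A"
  shows "map \<sigma> (map (inv_into UNIV \<sigma>) x) = x" "map (inv_into UNIV \<sigma>) (map \<sigma> x) = x"
  using Aut_bij[OF assms] by (simp_all add: bij_is_surj surj_f_inv_f bij_is_inj map_idI)

lemma inv_in_Aut:
  assumes "\<sigma> \<in> Aut M A"
  shows "inv_into UNIV \<sigma> \<in> Aut M A"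
proof (rule AutI)
  have b: "bij \<sigma>" by (rule Aut_bij[OF assms])
  then show "bij (inv_into UNIV \<sigma>)" by (rule bij_imp_bij_inv)
  show "inv_into UNIV \<sigma> a = a" if "a \<in> A" for a
    using Aut_fixes[OF assms that] b by (metis bij_inv_eq_iff)
  show "inv_into UNIV \<sigma> (fint M f xs) = fint M f (map (inv_into UNIV \<sigma>) xs)"
    if "(f, length xs) \<in> fsyms M" for f xs
    using Aut_fint[OF assms, of f "map (inv_into UNIV \<sigma>) xs"] that b
    by (metis bij_inv_eq_iff length_map map_Aut_inv(1)[OF assms])
  show "rint M r xs \<longleftrightarrow> rint M r (map (inv_into UNIV \<sigma>) xs)"
    if "(r, length xs) \<in> rsyms M" for r xs
    using Aut_rint[OF assms, of r "map (inv_into UNIV \<sigma>) xs"] that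
    by (metis length_map map_Aut_inv(1)[OF assms])
qed

lemma Aut_mono: "B \<subseteq> A \<Longrightarrow> Aut M A \<subseteq> Aut M B"
  unfolding Aut_def by blast

section \<open>Definable sets\<close>

lemma definableE:
  assumes "definable M B n X"
  obtains p cs where "wf_fml M p" "set cs \<subseteq> B" "fv p \<subseteq> {..<n + length cs}"
    "X = {x. length x = n \<and> sat M ((!) (x @ cs)) p}"
  using assms unfolding definable_def formulas_over_def holds_def by fastforce

lemma definableI:
  assumes "wf_fml M p" "set cs \<subseteq> B" "fv p \<subseteq> {..<n + length cs}"
    "X = {x. length x = n \<and> sat M ((!) (x @ cs)) p}"
  shows "definable M B n X"
  unfolding definable_def formulas_over_def holds_def
  by (rule bexI[of _ "(p, cs)"]) (use assms in auto)

lemma definable_length: "definable M B n X \<Longrightarrow> x \<in> X \<Longrightarrow> length x = n"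
  by (auto elim!: definableE)

lemma definable_mono: "definable M B n X \<Longrightarrow> B \<subseteq> C \<Longrightarrow> definable M C n X"
  unfolding definable_def formulas_over_def by blast

text \<open>
  The automorphism fixes the parameters of a defining formula and preserves its truth.
\<close>

lemma definable_Aut:
  assumes "definable M B n X" "\<sigma> \<in> Aut M B"
  shows "map \<sigma> x \<in> X \<longleftrightarrow> x \<in> X"
proof -
  obtain p cs where p: "wf_fml M p" "set cs \<subseteq> B" "fv p \<subseteq> {..<n + length cs}"
    "X = {x. length x = n \<and> sat M ((!) (x @ cs)) p}"
    by (rule definableE[OF assms(1)])
  have "map \<sigma> cs = cs" using p(2) Aut_fixes[OF assms(2)] by (intro map_idI) blast
  then have eq: "map \<sigma> x @ cs = map \<sigma> (x @ cs)" by simp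
  have "sat M ((!) (map \<sigma> x @ cs)) p \<longleftrightarrow> sat M (\<lambda>i. \<sigma> ((x @ cs) ! i)) p" if "length x = n"
    unfolding eq
  proof (rule sat_cong)
    fix i assume "i \<in> fv p"
    then have "i < length (x @ cs)" using p(3) that by auto
    then show "map \<sigma> (x @ cs) ! i = \<sigma> ((x @ cs) ! i)" by (rule nth_map)
  qed
  then show ?thesis unfolding p(4) using sat_Aut[OF assms(2) p(1), of "(!) (x @ cs)"] by auto
qed

text \<open>
  Definability of a property of \<open>n\<close>-tuples.  Variables are blocks of coordinates, so that closure
  rules can follow the shape of a property; only its values on tuples of length \<open>n\<close> matter.
\<close>

definition definable_pred ::
  "('f, 'r, 'a) fo_structure \<Rightarrow> 'a set \<Rightarrow> nat \<Rightarrow> ('a list \<Rightarrow> bool) \<Rightarrow> bool" where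
  "definable_pred M B n P \<longleftrightarrow> definable M B n {x. length x = n \<and> P x}"

lemma definable_predI:
  assumes "wf_fml M p" "set cs \<subseteq> B" "fv p \<subseteq> {..<n + length cs}"
    "\<And>x. length x = n \<Longrightarrow> P x \<longleftrightarrow> sat M ((!) (x @ cs)) p"
  shows "definable_pred M B n P"
  unfolding definable_pred_def using assms by (intro definableI[of _ p cs]) auto

lemma definable_predE:
  assumes "definable_pred M B n P"
  obtains p cs where "wf_fml M p" "set cs \<subseteq> B" "fv p \<subseteq> {..<n + length cs}"
    "\<forall>x. length x = n \<longrightarrow> (P x \<longleftrightarrow> sat M ((!) (x @ cs)) p)"
  using assms unfolding definable_pred_def by (elim definableE) blast

lemma definable_pred_cong:
  assumes "\<And>x. length x = n \<Longrightarrow> P x \<longleftrightarrow> Q x"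
  shows "definable_pred M B n P \<longleftrightarrow> definable_pred M B n Q"
proof -
  have "{x. length x = n \<and> P x} = {x. length x = n \<and> Q x}" using assms by blast
  then show ?thesis unfolding definable_pred_def by (rule arg_cong)
qed

lemma definable_iff_pred:
  "definable M B n X \<longleftrightarrow> (\<forall>x\<in>X. length x = n) \<and> definable_pred M B n (\<lambda>x. x \<in> X)"
proof -
  have eq: "{x. length x = n \<and> x \<in> X} = X" if "\<forall>x\<in>X. length x = n" using that by auto
  show ?thesis
  proof
    assume "definable M B n X"
    then show "(\<forall>x\<in>X. length x = n) \<and> definable_pred M B n (\<lambda>x. x \<in> X)"
      using eq definable_length[of M B n X] by (simp add: definable_pred_def)
  next
    assume "(\<forall>x\<in>X. length x = n) \<and> definable_pred M B n (\<lambda>x. x \<in> X)"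
    then show "definable M B n X" using eq by (simp add: definable_pred_def)
  qed
qed

lemma definable_pred_True: "definable_pred M B n (\<lambda>x. True)"
  by (rule definable_predI[of _ "Exi 0 (Eql (Var 0) (Var 0))" "[]"]) auto

lemma definable_pred_Not:
  assumes "definable_pred M B n P"
  shows "definable_pred M B n (\<lambda>x. \<not> P x)"
proof -
  obtain p cs where p: "wf_fml M p" "set cs \<subseteq> B" "fv p \<subseteq> {..<n + length cs}"
    "\<forall>x. length x = n \<longrightarrow> (P x \<longleftrightarrow> sat M ((!) (x @ cs)) p)"
    by (rule definable_predE[OF assms])
  then show ?thesis by (intro definable_predI[of _ "Neg p" cs]) auto
qed

lemma definable_pred_conj:
  assumes "definable_pred M B n P" "definable_pred M B n Q"
  shows "definable_pred M B n (\<lambda>x. P x \<and> Q x)"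
proof -
  obtain p cs where p: "wf_fml M p" "set cs \<subseteq> B" "fv p \<subseteq> {..<n + length cs}"
    "\<forall>x. length x = n \<longrightarrow> (P x \<longleftrightarrow> sat M ((!) (x @ cs)) p)"
    by (rule definable_predE[OF assms(1)])
  obtain q ds where q: "wf_fml M q" "set ds \<subseteq> B" "fv q \<subseteq> {..<n + length ds}"
    "\<forall>x. length x = n \<longrightarrow> (Q x \<longleftrightarrow> sat M ((!) (x @ ds)) q)"
    by (rule definable_predE[OF assms(2)])
  define \<rho> where "\<rho> i = (if i < n then i else i + length cs)" for i
  have "sat M ((!) (x @ cs @ ds)) p \<longleftrightarrow> sat M ((!) (x @ cs)) p" if "length x = n" for x
    using p(3) that by (intro sat_cong) (auto simp: nth_append subset_iff)
  moreover have "sat M ((!) (x @ cs @ ds)) (rename q \<rho>) \<longleftrightarrow> sat M ((!) (x @ ds)) q"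
    if "length x = n" for x
    unfolding sat_rename using q(3) that
    by (intro sat_cong) (auto simp: nth_append subset_iff \<rho>_def)
  moreover have "fv (rename q \<rho>) \<subseteq> {..<n + length (cs @ ds)}"
    using fv_rename[of q \<rho>] q(3) by (fastforce simp: \<rho>_def)
  ultimately show ?thesis using p q
    by (intro definable_predI[of _ "Conj p (rename q \<rho>)" "cs @ ds"])
       (auto simp: wf_rename subset_iff)
qed

lemma definable_pred_disj:
  assumes "definable_pred M B n P" "definable_pred M B n Q"
  shows "definable_pred M B n (\<lambda>x. P x \<or> Q x)"
  using definable_pred_Not[OF definable_pred_conj[OF assms[THEN definable_pred_Not]]] by simp

lemma definable_pred_iff:
  assumes "definable_pred M B n P" "definable_pred M B n Q"
  shows "definable_pred M B n (\<lambda>x. P x \<longleftrightarrow> Q x)"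
proof -
  have "definable_pred M B n (\<lambda>x. P x \<and> Q x \<or> \<not> P x \<and> \<not> Q x)"
    by (intro definable_pred_disj definable_pred_conj definable_pred_Not assms)
  then show ?thesis by (rule definable_pred_cong[THEN iffD1, rotated]) blast
qed

lemma definable_pred_reindex:
  assumes "definable_pred M B m P" "length is = m" "set is \<subseteq> {..<n}"
  shows "definable_pred M B n (\<lambda>x. P (map ((!) x) is))"
proof -
  obtain p cs where p: "wf_fml M p" "set cs \<subseteq> B" "fv p \<subseteq> {..<m + length cs}"
    "\<forall>x. length x = m \<longrightarrow> (P x \<longleftrightarrow> sat M ((!) (x @ cs)) p)"
    by (rule definable_predE[OF assms(1)])
  define \<rho> where "\<rho> i = (if i < m then is ! i else i - m + n)" for i
  have lt: "is ! i < n" if "i < m" for i using assms(2,3) that nth_mem by (metis lessThan_iff subsetD)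
  have "sat M ((!) (x @ cs)) (rename p \<rho>) \<longleftrightarrow> sat M ((!) (map ((!) x) is @ cs)) p"
    if "length x = n" for x
    unfolding sat_rename using p(3) that assms(2) lt
    by (intro sat_cong) (auto simp: nth_append subset_iff \<rho>_def)
  moreover have "fv (rename p \<rho>) \<subseteq> {..<n + length cs}"
    using fv_rename[of p \<rho>] p(3) lt by (fastforce simp: \<rho>_def)
  ultimately show ?thesis using p assms(2)
    by (intro definable_predI[of _ "rename p \<rho>" cs]) (auto simp: wf_rename)
qed

lemma definable_pred_ex1:
  assumes "definable_pred M B (Suc n) P"
  shows "definable_pred M B n (\<lambda>x. \<exists>a. P (x @ [a]))"
proof -
  obtain p cs where p: "wf_fml M p" "set cs \<subseteq> B" "fv p \<subseteq> {..<Suc n + length cs}"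
    "\<forall>x. length x = Suc n \<longrightarrow> (P x \<longleftrightarrow> sat M ((!) (x @ cs)) p)"
    by (rule definable_predE[OF assms])
  define k where "k = n + length cs"
  define \<rho> where "\<rho> i = (if i < n then i else if i = n then k else i - 1)" for i
  have "sat M (((!) (x @ cs))(k := a)) (rename p \<rho>) \<longleftrightarrow> sat M ((!) ((x @ [a]) @ cs)) p"
    if "length x = n" for x a
    unfolding sat_rename using p(3) that
    by (intro sat_cong) (auto simp: nth_append nth_Cons' subset_iff \<rho>_def k_def)
  moreover have "fv (rename p \<rho>) - {k} \<subseteq> {..<n + length cs}"
    using fv_rename[of p \<rho>] p(3) by (fastforce simp: \<rho>_def k_def)
  ultimately show ?thesis using p
    by (intro definable_predI[of _ "Exi k (rename p \<rho>)" cs]) (auto simp: wf_rename)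
qed

lemma definable_pred_ex:
  assumes "definable_pred M B (n + k) P"
  shows "definable_pred M B n (\<lambda>x :: 'a list. \<exists>y. length y = k \<and> P (x @ y))"
  using assms
proof (induction k arbitrary: P)
  case (Suc k)
  have "definable_pred M B (n + k) (\<lambda>x. \<exists>a. P (x @ [a]))"
    using Suc.prems by (intro definable_pred_ex1) simp
  from Suc.IH[OF this] show ?case
  proof (rule definable_pred_cong[THEN iffD1, rotated])
    fix x :: "'a list"
    show "(\<exists>y. length y = k \<and> (\<exists>a. P ((x @ y) @ [a]))) \<longleftrightarrow> (\<exists>y. length y = Suc k \<and> P (x @ y))"
      by (fastforce simp: length_Suc_conv_rev)
  qed
qed simp

lemma definable_pred_all:
  assumes "definable_pred M B (n + k) P"
  shows "definable_pred M B n (\<lambda>x. \<forall>y. length y = k \<longrightarrow> P (x @ y))"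
  using definable_pred_Not[OF definable_pred_ex[OF definable_pred_Not[OF assms]]]
  by (rule definable_pred_cong[THEN iffD1, rotated]) blast

text \<open>
  Parameters become additional coordinates.  Once they are explicit they can be moved by an
  automorphism, or be allowed to vary over their orbit.
\<close>

lemma definable_with_parameters:
  assumes "definable M B n X"
  obtains Y cs where "set cs \<subseteq> B" "definable M {} (n + length cs) Y"
    "X = {x. length x = n \<and> x @ cs \<in> Y}"
proof -
  obtain p cs where p: "wf_fml M p" "set cs \<subseteq> B" "fv p \<subseteq> {..<n + length cs}"
    "X = {x. length x = n \<and> sat M ((!) (x @ cs)) p}"
    by (rule definableE[OF assms(1)])
  show thesis
  proof (rule that[OF p(2)])
    show "definable M {} (n + length cs) {x. length x = n + length cs \<and> sat M ((!) (x @ [])) p}"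
      using p by (intro definableI[of _ p "[]"]) auto
  qed (use p(4) in auto)
qed

lemma definable_fibre:
  assumes "definable M {} (n + length cs) Y" "set cs \<subseteq> B"
  shows "definable M B n {x. length x = n \<and> x @ cs \<in> Y}"
proof -
  obtain p ds where p: "wf_fml M p" "set ds \<subseteq> {}" "fv p \<subseteq> {..<n + length cs + length ds}"
    "Y = {x. length x = n + length cs \<and> sat M ((!) (x @ ds)) p}"
    by (rule definableE[OF assms(1)])
  then show ?thesis using assms by (intro definableI[of _ p cs]) auto
qed


section \<open>Coordinate maps\<close>

text \<open>
  Substitution of variables for variables.  The arities are arguments of the predicate, so
  that in backward proofs unification computes how a tuple is cut into blocks.
\<close>

definition coordinate_map :: "nat \<Rightarrow> nat \<Rightarrow> ('a list \<Rightarrow> 'a list) \<Rightarrow> bool" where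
  "coordinate_map n m t \<longleftrightarrow>
     (\<exists>is. length is = m \<and> set is \<subseteq> {..<n} \<and> (\<forall>x. length x = n \<longrightarrow> t x = map ((!) x) is))"

lemma coordinate_map_id: "coordinate_map n n (\<lambda>x. x)"
  unfolding coordinate_map_def by (rule exI[of _ "[0..<n]"]) (auto simp: map_nth)

lemma coordinate_map_take:
  "coordinate_map n (k + l) t \<Longrightarrow> coordinate_map n k (\<lambda>x. take k (t x))"
  unfolding coordinate_map_def
  by (elim exE, rule_tac x = "take k is" in exI) (auto simp: take_map dest: in_set_takeD)

lemma coordinate_map_drop:
  "coordinate_map n (k + l) t \<Longrightarrow> coordinate_map n l (\<lambda>x. drop k (t x))"
  unfolding coordinate_map_def
  by (elim exE, rule_tac x = "drop k is" in exI) (auto simp: drop_map dest: in_set_dropD)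

lemma coordinate_map_append:
  assumes "coordinate_map n k s" "coordinate_map n l t"
  shows "coordinate_map n (k + l) (\<lambda>x. s x @ t x)"
proof -
  obtain "is" js where "length is = k" "set is \<subseteq> {..<n}" "\<forall>x. length x = n \<longrightarrow> s x = map ((!) x) is"
    "length js = l" "set js \<subseteq> {..<n}" "\<forall>x. length x = n \<longrightarrow> t x = map ((!) x) js"
    using assms unfolding coordinate_map_def by blast
  then show ?thesis unfolding coordinate_map_def by (intro exI[of _ "is @ js"]) auto
qed

lemmas coordinate_map_intros =
  coordinate_map_id coordinate_map_append coordinate_map_take coordinate_map_drop

lemma coordinate_map_length: "coordinate_map n m t \<Longrightarrow> length x = n \<Longrightarrow> length (t x) = m"
  unfolding coordinate_map_def by auto

lemma definable_pred_coordinate: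
  assumes "definable_pred M B m P" "coordinate_map n m t"
  shows "definable_pred M B n (\<lambda>x. P (t x))"
proof -
  obtain "is" where "is": "length is = m" "set is \<subseteq> {..<n}" "\<forall>x. length x = n \<longrightarrow> t x = map ((!) x) is"
    using assms(2) unfolding coordinate_map_def by blast
  show ?thesis
    by (rule definable_pred_cong[THEN iffD1, OF _ definable_pred_reindex[OF assms(1) "is"(1,2)]])
       (use "is"(3) in simp)
qed

lemma definable_pred_mem:
  assumes "definable M B m X" "coordinate_map n m t"
  shows "definable_pred M B n (\<lambda>x. t x \<in> X)"
  by (rule definable_pred_coordinate[OF definable_iff_pred[THEN iffD1, THEN conjunct2] assms(2)])
     (rule assms(1))

lemma definable_pred_coordinate_eq:
  assumes "coordinate_map n m s" "coordinate_map n m t"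
  shows "definable_pred M B n (\<lambda>x. s x = t x)"
proof -
  obtain "is" js where h: "length is = m" "set is \<subseteq> {..<n}" "\<forall>x. length x = n \<longrightarrow> s x = map ((!) x) is"
    "length js = m" "set js \<subseteq> {..<n}" "\<forall>x. length x = n \<longrightarrow> t x = map ((!) x) js"
    using assms unfolding coordinate_map_def by blast
  have "length is = length js" using h by simp
  then have "set is \<subseteq> {..<n} \<longrightarrow> set js \<subseteq> {..<n} \<longrightarrow>
    definable_pred M B n (\<lambda>x. map ((!) x) is = map ((!) x) js)"
  proof (induction "is" js rule: list_induct2)
    case Nil
    show ?case using definable_pred_True by simp
  next
    case (Cons i "is" j js)
    have "definable_pred M B n (\<lambda>x. x ! i = x ! j)" if "i < n" "j < n"
      using that by (intro definable_predI[of _ "Eql (Var i) (Var j)" "[]"]) auto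
    then show ?case using Cons.IH by (auto intro!: definable_pred_conj)
  qed
  then show ?thesis
    by (rule definable_pred_cong[THEN iffD1, rotated, OF mp[OF mp]]) (use h in auto)
qed

lemma definable_pred_eq_const:
  assumes "set c \<subseteq> B"
  shows "definable_pred M B (length c) (\<lambda>x. x = c)"
proof -
  let ?m = "length c"
  have "definable_pred M {} (?m + ?m) (\<lambda>z. take ?m z = drop ?m z)"
    by (intro definable_pred_coordinate_eq) (rule coordinate_map_intros)+
  from definable_fibre[OF this[unfolded definable_pred_def] assms]
  have "definable M B ?m {x. length x = ?m \<and> x @ c \<in> {z. length z = ?m + ?m \<and> take ?m z = drop ?m z}}" .
  moreover have "{x. length x = ?m \<and> x @ c \<in> {z. length z = ?m + ?m \<and> take ?m z = drop ?m z}}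
      = {x. length x = ?m \<and> x = c}"
    by auto
  ultimately show ?thesis unfolding definable_pred_def by simp
qed


section \<open>Definable functions\<close>

text \<open>
  Functions are total on tuples of length \<open>n\<close> and all parameters are allowed.  Under these two
  conventions a composite of definable functions is definable without any condition on domains.
\<close>

definition definable_fun ::
  "('f, 'r, 'a) fo_structure \<Rightarrow> nat \<Rightarrow> nat \<Rightarrow> ('a list \<Rightarrow> 'a list) \<Rightarrow> bool" where
  "definable_fun M n m t \<longleftrightarrow> (\<forall>x. length x = n \<longrightarrow> length (t x) = m) \<and>
     definable_pred M UNIV (n + m) (\<lambda>z. t (take n z) = drop n z)"

lemma definable_fun_length: "definable_fun M n m t \<Longrightarrow> length x = n \<Longrightarrow> length (t x) = m"
  unfolding definable_fun_def by blast

lemma definable_fun_graph: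
  "definable_fun M n m t \<Longrightarrow> definable_pred M UNIV (n + m) (\<lambda>z. t (take n z) = drop n z)"
  unfolding definable_fun_def by blast

lemma definable_fun_graph_coordinate:
  assumes "definable_fun M n m t" "coordinate_map l n r" "coordinate_map l m s"
  shows "definable_pred M UNIV l (\<lambda>x. t (r x) = s x)"
proof -
  have "definable_pred M UNIV l (\<lambda>x. t (take n (r x @ s x)) = drop n (r x @ s x))"
    using definable_fun_graph[OF assms(1)] coordinate_map_append[OF assms(2,3)]
    by (rule definable_pred_coordinate)
  then show ?thesis
    by (rule definable_pred_cong[THEN iffD1, rotated])
       (use coordinate_map_length[OF assms(2)] in simp)
qed

lemma definable_fun_coordinate:
  assumes "coordinate_map n m t"
  shows "definable_fun M n m t"
  unfolding definable_fun_def
proof (intro conjI allI impI)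
  have "coordinate_map (n + m) m (\<lambda>z. t (take n z))"
  proof -
    obtain "is" where "is": "length is = m" "set is \<subseteq> {..<n}" "\<forall>x. length x = n \<longrightarrow> t x = map ((!) x) is"
      using assms unfolding coordinate_map_def by blast
    show ?thesis unfolding coordinate_map_def
      by (rule exI[of _ "is"]) (use "is" in \<open>auto simp: subset_iff\<close>)
  qed
  then show "definable_pred M UNIV (n + m) (\<lambda>z. t (take n z) = drop n z)"
    by (rule definable_pred_coordinate_eq) (rule coordinate_map_intros)+
qed (rule coordinate_map_length[OF assms])

lemma definable_fun_comp:
  assumes "definable_fun M m k s" "definable_fun M n m t"
  shows "definable_fun M n k (\<lambda>x. s (t x))"
  unfolding definable_fun_def
proof (intro conjI allI impI)
  show "length (s (t x)) = k" if "length x = n" for x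
    using that assms definable_fun_length by blast
  have "definable_pred M UNIV (n + k)
     (\<lambda>z. \<exists>y. length y = m \<and> (t (take n (take (n + k) (z @ y))) = drop (n + k) (z @ y) \<and>
                              s (drop (n + k) (z @ y)) = drop n (take (n + k) (z @ y))))"
    by (intro definable_pred_ex definable_pred_conj definable_fun_graph_coordinate[OF assms(1)]
          definable_fun_graph_coordinate[OF assms(2)]) (rule coordinate_map_intros)+
  then show "definable_pred M UNIV (n + k) (\<lambda>z. s (t (take n z)) = drop n z)"
    by (rule definable_pred_cong[THEN iffD1, rotated])
       (use definable_fun_length[OF assms(2)] in auto)
qed

lemma definable_fun_id: "definable_fun M n n (\<lambda>x. x)"
  by (intro definable_fun_coordinate) (rule coordinate_map_intros)+

lemma definable_fun_take:
  "definable_fun M n (k + l) t \<Longrightarrow> definable_fun M n k (\<lambda>x. take k (t x))"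
  by (erule definable_fun_comp[rotated], rule definable_fun_coordinate) (rule coordinate_map_intros)+

lemma definable_fun_drop:
  "definable_fun M n (k + l) t \<Longrightarrow> definable_fun M n l (\<lambda>x. drop k (t x))"
  by (erule definable_fun_comp[rotated], rule definable_fun_coordinate) (rule coordinate_map_intros)+

lemma definable_fun_append:
  fixes M :: "('f, 'r, 'a) fo_structure"
  assumes "definable_fun M n k s" "definable_fun M n l t"
  shows "definable_fun M n (k + l) (\<lambda>x. s x @ t x)"
  unfolding definable_fun_def
proof (intro conjI allI impI)
  show "length (s x @ t x) = k + l" if "length x = n" for x
    using that definable_fun_length[OF assms(1)] definable_fun_length[OF assms(2)] by simp
  have "definable_pred M UNIV (n + (k + l))
     (\<lambda>z. s (take n z) = take k (drop n z) \<and> t (take n z) = drop k (drop n z))"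
    by (intro definable_pred_conj definable_fun_graph_coordinate[OF assms(1)]
          definable_fun_graph_coordinate[OF assms(2)]) (rule coordinate_map_intros)+
  then show "definable_pred M UNIV (n + (k + l)) (\<lambda>z. s (take n z) @ t (take n z) = drop n z)"
  proof (rule definable_pred_cong[THEN iffD1, rotated])
    fix z :: "'a list" assume "length z = n + (k + l)"
    then have "length (s (take n z)) = k" using definable_fun_length[OF assms(1)] by simp
    then show "s (take n z) = take k (drop n z) \<and> t (take n z) = drop k (drop n z) \<longleftrightarrow>
        s (take n z) @ t (take n z) = drop n z"
      by (metis append_eq_conv_conj append_take_drop_id)
  qed
qed

lemma definable_fun_pred:
  assumes "definable_pred M UNIV m P" "definable_fun M n m t"
  shows "definable_pred M UNIV n (\<lambda>x. P (t x))"
proof -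
  have "definable_pred M UNIV n
     (\<lambda>x. \<exists>y. length y = m \<and> (t (take n (x @ y)) = drop n (x @ y) \<and> P (drop n (x @ y))))"
    by (intro definable_pred_ex definable_pred_conj definable_fun_graph_coordinate[OF assms(2)]
          definable_pred_coordinate[OF assms(1)]) (rule coordinate_map_intros)+
  then show ?thesis
    by (rule definable_pred_cong[THEN iffD1, rotated])
       (use definable_fun_length[OF assms(2)] in auto)
qed

lemma definable_fun_mem:
  assumes "definable M UNIV m X" "definable_fun M n m t"
  shows "definable_pred M UNIV n (\<lambda>x. t x \<in> X)"
  by (rule definable_fun_pred[OF definable_iff_pred[THEN iffD1, THEN conjunct2] assms(2)])
     (rule assms(1))

lemma definable_fun_eq:
  assumes "definable_fun M n m s" "definable_fun M n m t"
  shows "definable_pred M UNIV n (\<lambda>x. s x = t x)"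
proof -
  have "definable_pred M UNIV (m + m) (\<lambda>z. take m z = drop m z)"
    by (intro definable_pred_coordinate_eq) (rule coordinate_map_intros)+
  from definable_fun_pred[OF this definable_fun_append[OF assms]] show ?thesis
    by (rule definable_pred_cong[THEN iffD1, rotated])
       (use definable_fun_length[OF assms(1)] in simp)
qed

lemma definable_fun_const: "definable_fun M n (length c) (\<lambda>x. c)"
  unfolding definable_fun_def
proof (intro conjI allI impI)
  have "definable_pred M UNIV (n + length c) (\<lambda>z. drop n z = c)"
    by (rule definable_pred_coordinate[OF definable_pred_eq_const[OF subset_UNIV]])
       (rule coordinate_map_intros)+
  then show "definable_pred M UNIV (n + length c) (\<lambda>z. c = drop n z)"
    by (rule definable_pred_cong[THEN iffD1, rotated]) auto
qed simp

lemmas definable_fun_intros =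
  definable_fun_id definable_fun_append definable_fun_take definable_fun_drop

lemma definable_image:
  assumes "definable M UNIV n X" "definable_fun M n m F"
  shows "definable M UNIV m (F ` X)"
proof -
  have "definable_pred M UNIV m
     (\<lambda>y. \<exists>x. length x = n \<and> (F (drop m (y @ x)) = take m (y @ x) \<and> drop m (y @ x) \<in> X))"
    by (intro definable_pred_ex definable_pred_conj definable_fun_graph_coordinate[OF assms(2)]
          definable_pred_mem[OF assms(1)]) (rule coordinate_map_intros)+
  moreover have "{y. length y = m \<and>
      (\<exists>x. length x = n \<and> (F (drop m (y @ x)) = take m (y @ x) \<and> drop m (y @ x) \<in> X))} = F ` X"
    (is "?L = _")
  proof (intro subset_antisym subsetI)
    show "y \<in> F ` X" if "y \<in> ?L" for y using that by auto
    show "y \<in> ?L" if "y \<in> F ` X" for y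
    proof -
      from that obtain x where x: "x \<in> X" "y = F x" by blast
      have "length x = n" by (rule definable_length[OF assms(1) x(1)])
      then show ?thesis using x definable_fun_length[OF assms(2)] by auto
    qed
  qed
  ultimately show ?thesis unfolding definable_pred_def by simp
qed

text \<open>
  Outside its domain a partial function may be given any constant value, because a constant is
  definable with itself as parameter.
\<close>

lemma definable_map_total:
  fixes M :: "('f, 'r, 'a) fo_structure"
  assumes "definable_map M UNIV D f"
  obtains m k F where "definable M UNIV m D" "definable_fun M m k F" "\<forall>x\<in>D. F x = f x"
proof -
  obtain m k where len: "\<forall>x\<in>D. length x = m \<and> length (f x) = k"
    and gr: "definable M UNIV (m + k) {x @ f x | x. x \<in> D}"
    using assms unfolding definable_map_def by (elim exE conjE)
  let ?G = "{x @ f x | x. x \<in> D}"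
  have gr_iff: "x @ y \<in> ?G \<longleftrightarrow> x \<in> D \<and> y = f x" if "length x = m" for x y
    using len that by auto
  have "definable_pred M UNIV m (\<lambda>x. \<exists>y. length y = k \<and> (x @ y \<in> ?G))"
    by (intro definable_pred_ex definable_pred_mem[OF gr]) (rule coordinate_map_intros)+
  moreover have "{x. length x = m \<and> (\<exists>y. length y = k \<and> (x @ y \<in> ?G))} = D"
    using len gr_iff by auto
  ultimately have D: "definable M UNIV m D" unfolding definable_pred_def by simp
  define c :: "'a list" where "c = replicate k undefined"
  define F where "F x = (if x \<in> D then f x else c)" for x
  have "definable_fun M m k F"
    unfolding definable_fun_def
  proof (intro conjI allI impI)
    show "length (F x) = k" for x using len by (simp add: F_def c_def)
    have c: "definable_pred M UNIV k (\<lambda>x. x = c)"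
      using definable_pred_eq_const[OF subset_UNIV, of M c] by (simp add: c_def)
    have "definable_pred M UNIV (m + k) (\<lambda>z. z \<in> ?G \<or> \<not> take m z \<in> D \<and> drop m z = c)"
      by (intro definable_pred_disj definable_pred_conj definable_pred_Not
          definable_pred_mem[OF gr] definable_pred_mem[OF D] definable_pred_coordinate[OF c]) (rule coordinate_map_intros)+
    then show "definable_pred M UNIV (m + k) (\<lambda>z. F (take m z) = drop m z)"
    proof (rule definable_pred_cong[THEN iffD1, rotated])
      fix z :: "'a list" assume "length z = m + k"
      then show "(z \<in> ?G \<or> \<not> take m z \<in> D \<and> drop m z = c) \<longleftrightarrow> F (take m z) = drop m z"
        using gr_iff[of "take m z" "drop m z"] by (auto simp: F_def)
    qed
  qed
  then show thesis by (rule that[OF D]) (simp add: F_def)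
qed

lemma definable_mapI:
  assumes "definable M UNIV m D" "definable_fun M m k F" "\<And>x. x \<in> D \<Longrightarrow> F x = f x"
  shows "definable_map M UNIV D f"
  unfolding definable_map_def
proof (intro exI conjI ballI)
  show "length x = m" if "x \<in> D" for x using definable_length[OF assms(1) that] .
  show "length (f x) = k" if "x \<in> D" for x
    using definable_fun_length[OF assms(2) definable_length[OF assms(1) that]] assms(3)[OF that] by simp
  have "definable_fun M m (m + k) (\<lambda>x. x @ F x)"
    by (rule definable_fun_intros assms)+
  then have "definable M UNIV (m + k) ((\<lambda>x. x @ F x) ` D)" by (rule definable_image[OF assms(1)])
  also have "(\<lambda>x. x @ F x) ` D = (\<lambda>x. x @ f x) ` D"
    by (rule image_cong) (simp_all add: assms(3))
  also have "\<dots> = {x @ f x | x. x \<in> D}" by (rule Setcompr_eq_image[symmetric])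
  finally show "definable M UNIV (m + k) {x @ f x | x. x \<in> D}" .
qed

lemma definable_map_mono:
  assumes "definable_map M B D f" "B \<subseteq> C"
  shows "definable_map M C D f"
proof -
  obtain m k where "\<forall>x\<in>D. length x = m \<and> length (f x) = k"
    "definable M B (m + k) {x @ f x | x. x \<in> D}"
    using assms(1) unfolding definable_map_def by (elim exE conjE)
  then show ?thesis
    unfolding definable_map_def using definable_mono[OF _ assms(2)] by (intro exI conjI)
qed

lemma definable_map_Aut:
  assumes "definable_map M B D f" "\<sigma> \<in> Aut M B" "x \<in> D"
  shows "map \<sigma> x \<in> D" "f (map \<sigma> x) = map \<sigma> (f x)"
proof -
  obtain m k where len: "\<forall>x\<in>D. length x = m \<and> length (f x) = k"
    and gr: "definable M B (m + k) {x @ f x | x. x \<in> D}"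
    using assms(1) unfolding definable_map_def by (elim exE conjE)
  have "map \<sigma> (x @ f x) \<in> {x @ f x | x. x \<in> D}"
    unfolding definable_Aut[OF gr assms(2)] using assms(3) by blast
  then obtain y where y: "y \<in> D" "map \<sigma> x @ map \<sigma> (f x) = y @ f y" by auto
  moreover have "length (map \<sigma> x) = length y" using len y(1) assms(3) by simp
  ultimately have "map \<sigma> x = y" "map \<sigma> (f x) = f y" by auto
  then show "map \<sigma> x \<in> D" "f (map \<sigma> x) = map \<sigma> (f x)" using y(1) by auto
qed


lemma definable_map_inv_into:
  assumes "definable_map M UNIV D f" "inj_on f D"
  shows "definable_map M UNIV (f ` D) (inv_into D f)"
proof -
  obtain m k F where F: "definable M UNIV m D" "definable_fun M m k F" "\<forall>x\<in>D. F x = f x"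
    by (rule definable_map_total[OF assms(1)])
  have inv: "inv_into D f (f x) = x" if "x \<in> D" for x by (rule inv_into_f_f[OF assms(2) that])
  have "definable_fun M m (k + m) (\<lambda>x. F x @ x)"
    by (rule definable_fun_append[OF F(2) definable_fun_id])
  then have "definable M UNIV (k + m) ((\<lambda>x. F x @ x) ` D)" by (rule definable_image[OF F(1)])
  also have "(\<lambda>x. F x @ x) ` D = (\<lambda>x. f x @ inv_into D f (f x)) ` D"
    by (rule image_cong) (use F(3) inv in simp_all)
  also have "\<dots> = {y @ inv_into D f y | y. y \<in> f ` D}" by blast
  finally have gr: "definable M UNIV (k + m) {y @ inv_into D f y | y. y \<in> f ` D}" .
  have "length y = k \<and> length (inv_into D f y) = m" if "y \<in> f ` D" for y
  proof -
    from that obtain x where x: "x \<in> D" "y = f x" by blast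
    have "length x = m" by (rule definable_length[OF F(1) x(1)])
    moreover from this have "length (F x) = k" by (rule definable_fun_length[OF F(2)])
    ultimately show ?thesis using x F(3) inv by simp
  qed
  then show ?thesis unfolding definable_map_def using gr by blast
qed

lemma definable_map_comp:
  assumes "definable_map M UNIV E g" "definable_map M UNIV D f" "\<And>x. x \<in> D \<Longrightarrow> f x \<in> E"
  shows "definable_map M UNIV D (\<lambda>x. g (f x))"
proof (cases "D = {}")
  case True
  have "definable_pred M UNIV 0 (\<lambda>x. \<not> True)" by (rule definable_pred_Not[OF definable_pred_True])
  then show ?thesis unfolding definable_map_def definable_pred_def True by (intro exI[of _ 0]) simp
next
  case False
  then obtain x where x: "x \<in> D" by blast
  obtain m k F where F: "definable M UNIV m D" "definable_fun M m k F" "\<forall>x\<in>D. F x = f x"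
    by (rule definable_map_total[OF assms(2)])
  obtain p l G where G: "definable M UNIV p E" "definable_fun M p l G" "\<forall>x\<in>E. G x = g x"
    by (rule definable_map_total[OF assms(1)])
  have "length (F x) = k" using definable_fun_length[OF F(2) definable_length[OF F(1) x]] .
  moreover have "length (F x) = p" using definable_length[OF G(1) assms(3)[OF x]] F(3) x by simp
  ultimately have "definable_fun M m p F" using F(2) by simp
  from definable_fun_comp[OF G(2) this] show ?thesis
    by (rule definable_mapI[OF F(1)]) (use F(3) G(3) assms(3) in simp)
qed


section \<open>Atomic homogeneous structures\<close>

locale atomic_homogeneous =
  fixes M :: "('f, 'r, 'a) fo_structure" and A :: "'a set"
  assumes atomic: "atomic_over M A" and homogeneous: "homogeneous_over M A"
begin

text \<open>
  A formula that isolates the type of \<open>a\<close> over \<open>A\<close> is satisfied exactly by the tuples of the same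
  type, and by homogeneity these are the conjugates of \<open>a\<close>.
\<close>

lemma orbit_definable: "definable M A (length a) {map \<sigma> a | \<sigma>. \<sigma> \<in> Aut M A}"
proof -
  obtain pc where pc: "pc \<in> tp M A a"
    "\<And>qd x. qd \<in> tp M A a \<Longrightarrow> length x = length a \<Longrightarrow> holds M x pc \<Longrightarrow> holds M x qd"
    using atomic unfolding atomic_over_def isolated_tp_def by meson
  let ?X = "{x. length x = length a \<and> holds M x pc}"
  have X: "definable M A (length a) ?X"
    using pc(1) unfolding definable_def tp_def by blast
  have "a \<in> ?X" using pc(1) by (simp add: tp_def)
  have "x \<in> {map \<sigma> a | \<sigma>. \<sigma> \<in> Aut M A}" if x: "x \<in> ?X" for x
  proof -
    have "qd \<in> tp M A a" if "qd \<in> tp M A x" for qd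
    proof (rule ccontr)
      obtain q d where qd: "qd = (q, d)" by (cases qd)
      assume "qd \<notin> tp M A a"
      \<comment> \<open>A complete type contains the negation of every formula that it omits.\<close>
      then have "(Neg q, d) \<in> tp M A a"
        using that x by (auto simp: tp_def qd formulas_over_def holds_def)
      then have "holds M x (Neg q, d)" by (rule pc(2)) (use x in simp_all)
      moreover have "holds M x (q, d)" using that by (simp add: tp_def qd)
      ultimately show False by (simp add: holds_def)
    qed
    moreover have "qd \<in> tp M A x" if "qd \<in> tp M A a" for qd
      using that pc(2)[OF that] x by (simp add: tp_def)
    ultimately have "tp M A a = tp M A x" by blast
    moreover have "length a = length x" using x by simp
    ultimately obtain \<sigma> where "\<sigma> \<in> Aut M A" "map \<sigma> a = x"
      using homogeneous unfolding homogeneous_over_def by blast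
    then show ?thesis by blast
  qed
  moreover have "map \<sigma> a \<in> ?X" if "\<sigma> \<in> Aut M A" for \<sigma>
    using definable_Aut[OF X that] \<open>a \<in> ?X\<close> by blast
  ultimately have "?X = {map \<sigma> a | \<sigma>. \<sigma> \<in> Aut M A}" by blast
  then show ?thesis using X by simp
qed

text \<open>
  If \<open>\<phi>(x, c)\<close> defines \<open>X\<close>, then \<open>\<phi>(x, \<sigma> c)\<close> defines the image of \<open>X\<close> under \<open>\<sigma>\<close>, which is \<open>X\<close> again.
  Hence \<open>X\<close> is also defined by \<open>\<exists>z. \<phi>(x, z)\<close> with \<open>z\<close> restricted to the orbit of \<open>c\<close>.
\<close>

lemma invariant_definable:
  assumes "definable M UNIV n X" "\<And>\<sigma> x. \<sigma> \<in> Aut M A \<Longrightarrow> x \<in> X \<Longrightarrow> map \<sigma> x \<in> X"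
  shows "definable M A n X"
proof -
  obtain Y c where Y: "definable M {} (n + length c) Y" "X = {x. length x = n \<and> x @ c \<in> Y}"
    by (rule definable_with_parameters[OF assms(1)])
  let ?O = "{map \<sigma> c | \<sigma>. \<sigma> \<in> Aut M A}"
  have YA: "definable M A (n + length c) Y" by (rule definable_mono[OF Y(1)]) simp
  have "definable_pred M A n
      (\<lambda>x. \<exists>z. length z = length c \<and> (drop n (x @ z) \<in> ?O \<and> x @ z \<in> Y))"
    by (intro definable_pred_ex definable_pred_conj definable_pred_mem[OF orbit_definable]
        definable_pred_mem[OF YA]) (rule coordinate_map_intros)+
  moreover have "{x. length x = n \<and>
      (\<exists>z. length z = length c \<and> (drop n (x @ z) \<in> ?O \<and> x @ z \<in> Y))} = X"
  proof (intro subset_antisym subsetI)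
    fix x assume "x \<in> X"
    moreover have "c \<in> ?O" using id_in_Aut[of M A] by force
    ultimately show "x \<in> {x. length x = n \<and>
      (\<exists>z. length z = length c \<and> (drop n (x @ z) \<in> ?O \<and> x @ z \<in> Y))}"
      using Y(2) by auto
  next
    fix x assume "x \<in> {x. length x = n \<and>
      (\<exists>z. length z = length c \<and> (drop n (x @ z) \<in> ?O \<and> x @ z \<in> Y))}"
    then obtain \<sigma> where \<sigma>: "\<sigma> \<in> Aut M A" "length x = n" "x @ map \<sigma> c \<in> Y" by auto
    let ?\<tau> = "inv_into UNIV \<sigma>"
    have "?\<tau> \<in> Aut M {}" using inv_in_Aut[OF \<sigma>(1)] Aut_mono[of "{}" A M] by blast
    from definable_Aut[OF Y(1) this, of "x @ map \<sigma> c"]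
    have "map ?\<tau> x @ c \<in> Y" using \<sigma>(3) map_Aut_inv(2)[OF \<sigma>(1)] by simp
    then have "map ?\<tau> x \<in> X" using Y(2) \<sigma>(2) by simp
    from assms(2)[OF \<sigma>(1) this] show "x \<in> X" unfolding map_Aut_inv(1)[OF \<sigma>(1)] .
  qed
  ultimately show ?thesis unfolding definable_pred_def by simp
qed

lemma invariant_definable_map:
  assumes "definable_map M UNIV D f"
    "\<And>\<sigma> x. \<sigma> \<in> Aut M A \<Longrightarrow> x \<in> D \<Longrightarrow> map \<sigma> x \<in> D \<and> f (map \<sigma> x) = map \<sigma> (f x)"
  shows "definable_map M A D f"
proof -
  obtain m k where len: "\<forall>x\<in>D. length x = m \<and> length (f x) = k"
    and gr: "definable M UNIV (m + k) {x @ f x | x. x \<in> D}"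
    using assms(1) unfolding definable_map_def by (elim exE conjE)
  have "definable M A (m + k) {x @ f x | x. x \<in> D}"
    by (rule invariant_definable[OF gr]) (use assms(2) in \<open>fastforce\<close>)
  then show ?thesis using len unfolding definable_map_def by blast
qed

text \<open>
  Let \<open>c\<close> be the parameters in a definition of \<open>f\<close>.  Appending them to \<open>a\<close> allows the first half
  of the pair \<open>(a', \<sigma> a')\<close> to supply the parameters and the second half to supply the argument
  \<open>\<sigma> a\<close>, so that no parameters outside \<open>A\<close> are left.
\<close>

lemma uniform_in_orbit:
  assumes S: "definable M A m S" and f: "definable_fun M (length a + m) k f"
  shows "\<exists>a' D h. definable_map M A D h \<and>
    (\<forall>\<sigma>\<in>Aut M A. \<forall>x\<in>S. a' @ map \<sigma> a' @ x \<in> D \<and> f (map \<sigma> a @ x) = h (a' @ map \<sigma> a' @ x))"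
proof -
  let ?l = "length a"
  let ?\<Gamma> = "{z. length z = ?l + m + k \<and> f (take (?l + m) z) = drop (?l + m) z}"
  obtain Y c where Y: "definable M {} (?l + m + k + length c) Y"
      "?\<Gamma> = {x. length x = ?l + m + k \<and> x @ c \<in> Y}"
    by (rule definable_with_parameters[OF definable_fun_graph[OF f, unfolded definable_pred_def]])
  let ?r = "length c"
  let ?a = "c @ a"
  let ?O = "{map \<sigma> ?a | \<sigma>. \<sigma> \<in> Aut M A}"
  let ?q = "?r + ?l"
  let ?D = "{w. length w = ?q + (?q + m) \<and> take ?q w \<in> ?O \<and> take ?q (drop ?q w) \<in> ?O \<and>
                drop ?q (drop ?q w) \<in> S}"
  let ?val = "\<lambda>w y. (drop ?r (take ?q (drop ?q w)) @ drop ?q (drop ?q w)) @ y @ take ?r (take ?q w)"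
  \<comment> \<open>An argument \<open>w\<close> consists of two conjugates of \<open>c @ a\<close> and an element of \<open>S\<close>.  In \<open>?val\<close> the
      first conjugate contributes its copy of \<open>c\<close>, the second its copy of \<open>a\<close>.\<close>
  define h where "h w = (THE y. length y = k \<and> ?val w y \<in> Y)" for w
  have Y_iff: "length y = k \<and> (v @ x) @ y @ map \<tau> c \<in> Y \<longleftrightarrow>
      y = map \<tau> (f (map (inv_into UNIV \<tau>) (v @ x)))"
    if \<tau>: "\<tau> \<in> Aut M A" and len: "length v = ?l" "length x = m" for \<tau> v x y
  proof -
    let ?\<rho> = "inv_into UNIV \<tau>"
    have \<rho>: "?\<rho> \<in> Aut M {}" using inv_in_Aut[OF \<tau>] Aut_mono[of "{}" A M] by blast
    have "(v @ x) @ y @ map \<tau> c \<in> Y \<longleftrightarrow> (map ?\<rho> (v @ x) @ map ?\<rho> y) @ c \<in> Y"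
      using definable_Aut[OF Y(1) \<rho>, of "(v @ x) @ y @ map \<tau> c"] map_Aut_inv(2)[OF \<tau>] by simp
    moreover have "(map ?\<rho> (v @ x) @ map ?\<rho> y) @ c \<in> Y \<longleftrightarrow>
        map ?\<rho> (v @ x) @ map ?\<rho> y \<in> ?\<Gamma>" if "length y = k"
      unfolding Y(2) using len that by simp
    moreover have "map ?\<rho> (v @ x) @ map ?\<rho> y \<in> ?\<Gamma> \<longleftrightarrow> map ?\<rho> y = f (map ?\<rho> (v @ x))"
      if "length y = k" using len that by auto
    moreover have "map ?\<rho> y = f (map ?\<rho> (v @ x)) \<longleftrightarrow> y = map \<tau> (f (map ?\<rho> (v @ x)))"
      using map_Aut_inv[OF \<tau>] by metis
    moreover have "length (map \<tau> (f (map ?\<rho> (v @ x)))) = k"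
      using definable_fun_length[OF f] len by simp
    ultimately show ?thesis by blast
  qed
  have ex1: "\<exists>!y. length y = k \<and> ?val w y \<in> Y" if w: "w \<in> ?D" for w
  proof -
    have "take ?q w \<in> ?O" using w by blast
    then obtain \<tau> where \<tau>: "\<tau> \<in> Aut M A" "take ?q w = map \<tau> ?a" by blast
    then have "take ?r (take ?q w) = map \<tau> c" by simp
    moreover have "length (drop ?r (take ?q (drop ?q w))) = ?l" "length (drop ?q (drop ?q w)) = m"
      using w by auto
    ultimately show ?thesis using Y_iff[OF \<tau>(1)] by metis
  qed
  have h_iff: "h w = y \<longleftrightarrow> length y = k \<and> ?val w y \<in> Y" if "w \<in> ?D" for w y
  proof
    show "length y = k \<and> ?val w y \<in> Y" if "h w = y"
      using theI'[OF ex1[OF \<open>w \<in> ?D\<close>]] unfolding that[symmetric] h_def .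
    show "h w = y" if "length y = k \<and> ?val w y \<in> Y"
      unfolding h_def by (rule the1_equality[OF ex1[OF \<open>w \<in> ?D\<close>] that])
  qed
  have "definable_map M A ?D h"
    unfolding definable_map_def
  proof (intro exI conjI ballI)
    show "length w = ?q + (?q + m)" if "w \<in> ?D" for w using that by simp
    show "length (h w) = k" if "w \<in> ?D" for w using h_iff[OF that] by blast
    let ?n = "?q + (?q + m)"
    have O: "definable M A ?q ?O" using orbit_definable[of ?a] by simp
    have YA: "definable M A ((?l + m) + (k + ?r)) Y"
      by (rule definable_mono[of _ "{}"]) (use Y(1) in \<open>simp_all add: add.assoc\<close>)
    have "definable_pred M A (?n + k) (\<lambda>z. take ?q (take ?n z) \<in> ?O \<and>
        take ?q (drop ?q (take ?n z)) \<in> ?O \<and> drop ?q (drop ?q (take ?n z)) \<in> S \<and>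
        ?val (take ?n z) (drop ?n z) \<in> Y)"
      by (intro definable_pred_conj definable_pred_mem[OF O] definable_pred_mem[OF S]
          definable_pred_mem[OF YA]) (rule coordinate_map_intros)+
    moreover have "{z. length z = ?n + k \<and> (take ?q (take ?n z) \<in> ?O \<and>
        take ?q (drop ?q (take ?n z)) \<in> ?O \<and> drop ?q (drop ?q (take ?n z)) \<in> S \<and>
        ?val (take ?n z) (drop ?n z) \<in> Y)} = {w @ h w | w. w \<in> ?D}" (is "?L = ?R")
    proof (intro subset_antisym subsetI)
      fix z assume z: "z \<in> ?L"
      then have D: "take ?n z \<in> ?D" by auto
      moreover have "h (take ?n z) = drop ?n z" unfolding h_iff[OF D] using z by auto
      ultimately show "z \<in> ?R" by (metis (mono_tags, lifting) append_take_drop_id mem_Collect_eq)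
    next
      fix z assume "z \<in> ?R"
      then obtain w where w: "w \<in> ?D" "z = w @ h w" by blast
      then have "take ?n z = w" "drop ?n z = h w" by auto
      moreover have "length (h w) = k \<and> ?val w (h w) \<in> Y" using h_iff[OF w(1)] by blast
      ultimately show "z \<in> ?L" using w by auto
    qed
    ultimately show "definable M A (?n + k) {w @ h w | w. w \<in> ?D}"
      unfolding definable_pred_def by simp
  qed
  moreover have "?a @ map \<sigma> ?a @ x \<in> ?D \<and> f (map \<sigma> a @ x) = h (?a @ map \<sigma> ?a @ x)"
    if \<sigma>: "\<sigma> \<in> Aut M A" and x: "x \<in> S" for \<sigma> x
  proof -
    have lx: "length x = m" using definable_length[OF S x] .
    have a: "?a \<in> ?O" using id_in_Aut[of M A] by force
    then have D: "?a @ map \<sigma> ?a @ x \<in> ?D" using \<sigma> x lx by auto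
    have "length (f (map \<sigma> a @ x)) = k \<and> (map \<sigma> a @ x) @ f (map \<sigma> a @ x) @ map id c \<in> Y"
      using Y_iff[OF id_in_Aut, of "map \<sigma> a" x] lx by (simp add: inv_id)
    then have "h (?a @ map \<sigma> ?a @ x) = f (map \<sigma> a @ x)" unfolding h_iff[OF D] by simp
    then show ?thesis using D by simp
  qed
  ultimately show ?thesis by blast
qed

text \<open>
  The right-hand side involves neither a domain nor definability over \<open>A\<close>.  From left to right,
  \<open>f\<close> is \<open>h\<close> with first argument \<open>a\<close>; the converse is \<open>uniform_in_orbit\<close> for an empty tuple of
  further arguments.
\<close>

lemma cocycle_definability_iff:
  "(\<exists>a D h. definable_map M A D h \<and> (\<forall>\<sigma>\<in>Aut M A. a @ map \<sigma> a \<in> D \<and> \<Phi> \<sigma> = h (a @ map \<sigma> a)))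
   \<longleftrightarrow> (\<exists>a k f. definable_fun M (length a) k f \<and> (\<forall>\<sigma>\<in>Aut M A. \<Phi> \<sigma> = f (map \<sigma> a)))"
  (is "?L \<longleftrightarrow> ?R")
proof
  assume ?L
  then obtain a D h where h: "definable_map M A D h"
    "\<forall>\<sigma>\<in>Aut M A. a @ map \<sigma> a \<in> D \<and> \<Phi> \<sigma> = h (a @ map \<sigma> a)" by blast
  obtain m k F where F: "definable M UNIV m D" "definable_fun M m k F" "\<forall>x\<in>D. F x = h x"
    using definable_map_total[OF definable_map_mono[OF h(1) subset_UNIV]] .
  have "a @ map id a \<in> D" using h(2) id_in_Aut by blast
  then have m: "m = length a + length a" using definable_length[OF F(1)] by fastforce
  have "definable_fun M (length a) k (\<lambda>z. F (a @ z))"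
    by (rule definable_fun_comp[OF F(2)], unfold m)
       (rule definable_fun_append definable_fun_const definable_fun_id)+
  moreover have "\<forall>\<sigma>\<in>Aut M A. \<Phi> \<sigma> = F (a @ map \<sigma> a)" using h(2) F(3) by simp
  ultimately show ?R by blast
next
  assume ?R
  then obtain a k f where f: "definable_fun M (length a + 0) k f" "\<forall>\<sigma>\<in>Aut M A. \<Phi> \<sigma> = f (map \<sigma> a)"
    by auto
  have "definable M A 0 {[]}"
    using definable_pred_True[of M A 0] unfolding definable_pred_def by (rule back_subst) auto
  from uniform_in_orbit[OF this f(1)] f(2) show ?L by simp
qed

end


section \<open>Coding definable families\<close>

text \<open>
  Let \<open>c\<close> be the parameters in a definition of \<open>P\<close>.  Elimination of imaginaries is applied to the
  relation that identifies \<open>(x, z)\<close> with \<open>(x', z')\<close> if \<open>x\<close> with parameters \<open>z\<close> and \<open>x'\<close> with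
  parameters \<open>z'\<close> define the same set.  This relation is always an equivalence relation, and as
  \<open>z\<close> and \<open>z'\<close> may differ it also describes what happens to a code under an automorphism that
  moves \<open>c\<close>.
\<close>

lemma definable_family_codes:
  fixes M :: "('f, 'r, 'a) fo_structure"
  assumes EI: "eliminates_imaginaries M" and P: "definable_pred M UNIV (p + q) P"
  obtains k F where "definable_fun M p k F"
    "\<And>\<sigma> x x'. \<sigma> \<in> Aut M {} \<Longrightarrow> length x = p \<Longrightarrow> length x' = p \<Longrightarrow>
       map \<sigma> (F x) = F x' \<longleftrightarrow> (\<forall>w. length w = q \<longrightarrow> P (x @ w) \<longleftrightarrow> P (x' @ map \<sigma> w))"
proof -
  obtain Y c where Y: "definable M {} (p + q + length c) Y"
    "{z. length z = p + q \<and> P z} = {z. length z = p + q \<and> z @ c \<in> Y}"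
    by (rule definable_with_parameters[OF P[unfolded definable_pred_def]])
  have PY: "P (x @ w) \<longleftrightarrow> x @ w @ c \<in> Y" if "length x = p" "length w = q" for x w
  proof -
    have "x @ w \<in> {z. length z = p + q \<and> P z} \<longleftrightarrow> x @ w \<in> {z. length z = p + q \<and> z @ c \<in> Y}"
      unfolding Y(2) ..
    then show ?thesis using that by simp
  qed
  let ?n = "p + length c"
  let ?mem = "\<lambda>u w. take p u @ w @ drop p u \<in> Y"
  let ?same = "\<lambda>u v. \<forall>w. length w = q \<longrightarrow> (?mem u w \<longleftrightarrow> ?mem v w)"
  define E where "E = {(u, v). length u = ?n \<and> length v = ?n \<and> ?same u v}"
  have "equiv {x. length x = ?n} E"
    by (rule equivI) (auto simp: E_def refl_on_def sym_def trans_def)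
  moreover have "definable M {} (?n + ?n) {u @ v | u v. (u, v) \<in> E}"
  proof -
    let ?N = "?n + ?n"
    have Y': "definable M {} (p + (q + length c)) Y" using Y(1) by (simp add: add.assoc)
    have "definable_pred M {} ?N (\<lambda>z. \<forall>w. length w = q \<longrightarrow>
       (take p (take ?n (take ?N (z @ w))) @ drop ?N (z @ w) @ drop p (take ?n (take ?N (z @ w))) \<in> Y \<longleftrightarrow>
        take p (drop ?n (take ?N (z @ w))) @ drop ?N (z @ w) @ drop p (drop ?n (take ?N (z @ w))) \<in> Y))"
      by (intro definable_pred_all definable_pred_iff definable_pred_mem[OF Y']) (rule coordinate_map_intros)+
    then have "definable_pred M {} ?N (\<lambda>z. ?same (take ?n z) (drop ?n z))"
      by (rule definable_pred_cong[THEN iffD1, rotated]) simp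
    moreover have "{z. length z = ?N \<and> ?same (take ?n z) (drop ?n z)} = {u @ v | u v. (u, v) \<in> E}"
      (is "?L = ?R")
    proof (intro subset_antisym subsetI)
      fix z assume z: "z \<in> ?L"
      then have "(take ?n z, drop ?n z) \<in> E" by (simp add: E_def)
      then show "z \<in> ?R" by (metis (mono_tags, lifting) append_take_drop_id mem_Collect_eq)
    next
      fix z assume "z \<in> ?R"
      then obtain u v where "z = u @ v" "(u, v) \<in> E" by blast
      then show "z \<in> ?L" by (auto simp: E_def)
    qed
    ultimately show ?thesis unfolding definable_pred_def by simp
  qed
  ultimately have "\<exists>f. definable_map M {} {x. length x = ?n} f \<and>
      (\<forall>u v. length u = ?n \<longrightarrow> length v = ?n \<longrightarrow> (u, v) \<in> E \<longleftrightarrow> f u = f v)"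
    by (rule EI[unfolded eliminates_imaginaries_def, THEN spec[of _ ?n], THEN spec[of _ E], THEN mp, THEN mp])
  then obtain f where f: "definable_map M {} {x. length x = ?n} f"
    "\<forall>u v. length u = ?n \<longrightarrow> length v = ?n \<longrightarrow> (u, v) \<in> E \<longleftrightarrow> f u = f v"
    by (elim exE conjE)
  obtain m k F where F: "definable M UNIV m {x. length x = ?n}" "definable_fun M m k F"
    "\<forall>x\<in>{x. length x = ?n}. F x = f x"
    using definable_map_total[OF definable_map_mono[OF f(1) subset_UNIV]] .
  have m: "m = ?n" using definable_length[OF F(1), of "replicate ?n undefined"] by simp
  show thesis
  proof (rule that)
    show "definable_fun M p k (\<lambda>x. F (x @ c))"
      by (rule definable_fun_comp[OF F(2)], unfold m)
         (rule definable_fun_append definable_fun_const definable_fun_id)+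
    fix \<sigma> :: "'a \<Rightarrow> 'a" and x x' :: "'a list"
    assume \<sigma>: "\<sigma> \<in> Aut M {}" and len: "length x = p" "length x' = p"
    have "map \<sigma> (F (x @ c)) = f (map \<sigma> (x @ c))"
      using definable_map_Aut(2)[OF f(1) \<sigma>, of "x @ c"] F(3) len by simp
    moreover have "F (x' @ c) = f (x' @ c)" using F(3) len by simp
    ultimately have "map \<sigma> (F (x @ c)) = F (x' @ c) \<longleftrightarrow> ?same (map \<sigma> (x @ c)) (x' @ c)"
      using f(2)[THEN spec[of _ "map \<sigma> (x @ c)"], THEN spec[of _ "x' @ c"]] len by (simp add: E_def)
    also have "\<dots> \<longleftrightarrow> (\<forall>w. length w = q \<longrightarrow> ?mem (map \<sigma> (x @ c)) (map \<sigma> w) \<longleftrightarrow> ?mem (x' @ c) (map \<sigma> w))"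
      using map_Aut_inv(1)[OF \<sigma>] by (metis length_map)
    also have "\<dots> \<longleftrightarrow> (\<forall>w. length w = q \<longrightarrow> P (x @ w) \<longleftrightarrow> P (x' @ map \<sigma> w))"
    proof -
      have "?mem (map \<sigma> (x @ c)) (map \<sigma> w) \<longleftrightarrow> P (x @ w)" if "length w = q" for w
        using definable_Aut[OF Y(1) \<sigma>, of "x @ w @ c"] PY[OF len(1) that] len by simp
      moreover have "?mem (x' @ c) (map \<sigma> w) \<longleftrightarrow> P (x' @ map \<sigma> w)" if "length w = q" for w
        using PY[OF len(2), of "map \<sigma> w"] len that by simp
      ultimately show ?thesis by simp
    qed
    finally show "map \<sigma> (F (x @ c)) = F (x' @ c) \<longleftrightarrow>
        (\<forall>w. length w = q \<longrightarrow> P (x @ w) \<longleftrightarrow> P (x' @ map \<sigma> w))" .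
  qed
qed


section \<open>Definable groups\<close>

lemma definable_groupE:
  assumes "definable_group M B G"
  obtains n where "group G" "definable M B n (carrier G)"
    "definable M B (n + n + n)
       {x @ y @ (x \<otimes>\<^bsub>G\<^esub> y) | x y. x \<in> carrier G \<and> y \<in> carrier G}"
  using assms unfolding definable_group_def by (elim conjE exE)

lemma definable_group_mono:
  assumes "definable_group M B G" "B \<subseteq> C"
  shows "definable_group M C G"
  by (rule definable_groupE[OF assms(1)], unfold definable_group_def)
     (intro conjI exI definable_mono[OF _ assms(2)])

lemma definable_group_Aut:
  assumes "definable_group M B G" "\<sigma> \<in> Aut M B"
  shows "map \<sigma> x \<in> carrier G \<longleftrightarrow> x \<in> carrier G" and "group_hom G G (map \<sigma>)"
proof -
  obtain n where n: "group G" "definable M B n (carrier G)"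
    "definable M B (n + n + n) {x @ y @ (x \<otimes>\<^bsub>G\<^esub> y) | x y. x \<in> carrier G \<and> y \<in> carrier G}"
    by (rule definable_groupE[OF assms(1)])
  have c: "map \<sigma> x \<in> carrier G \<longleftrightarrow> x \<in> carrier G" for x by (rule definable_Aut[OF n(2) assms(2)])
  then show "map \<sigma> x \<in> carrier G \<longleftrightarrow> x \<in> carrier G" .
  have "map \<sigma> (x \<otimes>\<^bsub>G\<^esub> y) = map \<sigma> x \<otimes>\<^bsub>G\<^esub> map \<sigma> y" if "x \<in> carrier G" "y \<in> carrier G" for x y
  proof -
    have "map \<sigma> (x @ y @ (x \<otimes>\<^bsub>G\<^esub> y)) \<in> {x @ y @ (x \<otimes>\<^bsub>G\<^esub> y) | x y. x \<in> carrier G \<and> y \<in> carrier G}"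
      unfolding definable_Aut[OF n(3) assms(2)] using that by blast
    then obtain x' y' where *: "map \<sigma> (x @ y @ (x \<otimes>\<^bsub>G\<^esub> y)) = x' @ y' @ (x' \<otimes>\<^bsub>G\<^esub> y')"
      "x' \<in> carrier G" "y' \<in> carrier G" by blast
    have "length x = n" "length y = n" "length x' = n" "length y' = n"
      using definable_length[OF n(2)] that *(2,3) by blast+
    then show ?thesis using *(1) by simp
  qed
  then have "map \<sigma> \<in> hom G G" using c by (intro homI) auto
  then show "group_hom G G (map \<sigma>)" using n(1) by (intro group_hom.intro group_hom_axioms.intro)
qed

text \<open>
  The group operations as total definable functions.  Every definable function built from
  cocycles and group operations below is a composite of these.
\<close>

lemma definable_group_funs:
  assumes "definable_group M UNIV G"
  obtains n mu iv where "definable M UNIV n (carrier G)"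
    "definable_fun M (n + n) n mu" "\<forall>x\<in>carrier G. \<forall>y\<in>carrier G. mu (x @ y) = x \<otimes>\<^bsub>G\<^esub> y"
    "definable_fun M n n iv" "\<forall>x\<in>carrier G. iv x = inv\<^bsub>G\<^esub> x"
proof -
  obtain n where n: "group G" "definable M UNIV n (carrier G)"
    "definable M UNIV (n + n + n) {x @ y @ (x \<otimes>\<^bsub>G\<^esub> y) | x y. x \<in> carrier G \<and> y \<in> carrier G}"
    by (rule definable_groupE[OF assms])
  interpret group G by (rule n(1))
  note len = definable_length[OF n(2)]
  let ?P = "{x @ y | x y. x \<in> carrier G \<and> y \<in> carrier G}"
  let ?m = "\<lambda>z. take n z \<otimes>\<^bsub>G\<^esub> drop n z"
  have mult: "x @ y @ (x \<otimes>\<^bsub>G\<^esub> y) = (x @ y) @ ?m (x @ y)" if "x \<in> carrier G" for x y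
    using len[OF that] by simp
  have "{z @ ?m z | z. z \<in> ?P} = {x @ y @ (x \<otimes>\<^bsub>G\<^esub> y) | x y. x \<in> carrier G \<and> y \<in> carrier G}"
  proof (intro subset_antisym subsetI)
    fix w assume "w \<in> {z @ ?m z | z. z \<in> ?P}"
    then obtain x y where "w = (x @ y) @ ?m (x @ y)" "x \<in> carrier G" "y \<in> carrier G" by blast
    then show "w \<in> {x @ y @ (x \<otimes>\<^bsub>G\<^esub> y) | x y. x \<in> carrier G \<and> y \<in> carrier G}"
      using mult[of x y] by fastforce
  next
    fix w assume "w \<in> {x @ y @ (x \<otimes>\<^bsub>G\<^esub> y) | x y. x \<in> carrier G \<and> y \<in> carrier G}"
    then obtain x y where "w = x @ y @ (x \<otimes>\<^bsub>G\<^esub> y)" "x \<in> carrier G" "y \<in> carrier G" by blast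
    then show "w \<in> {z @ ?m z | z. z \<in> ?P}" using mult[of x y] by fastforce
  qed
  moreover have "length z = n + n \<and> length (?m z) = n" if "z \<in> ?P" for z
  proof -
    from that obtain x y where "z = x @ y" "x \<in> carrier G" "y \<in> carrier G" by blast
    then show ?thesis using len[of x] len[of y] len[of "x \<otimes>\<^bsub>G\<^esub> y"] by simp
  qed
  ultimately have "definable_map M UNIV ?P ?m"
    unfolding definable_map_def using n(3) by (intro exI conjI ballI) (blast, blast, simp)
  then obtain p k mu where mu: "definable M UNIV p ?P" "definable_fun M p k mu" "\<forall>z\<in>?P. mu z = ?m z"
    by (rule definable_map_total)
  have l1: "length \<one>\<^bsub>G\<^esub> = n" by (rule len[OF one_closed])
  have 11: "\<one>\<^bsub>G\<^esub> @ \<one>\<^bsub>G\<^esub> \<in> ?P" by blast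
  have p: "p = n + n" using definable_length[OF mu(1) 11] l1 by simp
  have k: "k = n"
    using definable_fun_length[OF mu(2) definable_length[OF mu(1) 11]] bspec[OF mu(3) 11] l1 by simp
  have mu_eq: "mu (x @ y) = x \<otimes>\<^bsub>G\<^esub> y" if "x \<in> carrier G" "y \<in> carrier G" for x y
  proof -
    have "x @ y \<in> ?P" using that by blast
    then show ?thesis using mu(3) len[OF that(1)] by simp
  qed
  have one: "definable_fun M (n + n) n (\<lambda>z. \<one>\<^bsub>G\<^esub>)" using definable_fun_const[of M "n + n" "\<one>\<^bsub>G\<^esub>"] by (simp add: l1)
  have "definable_pred M UNIV (n + n)
     (\<lambda>z. take n z \<in> carrier G \<and> drop n z \<in> carrier G \<and> mu z = \<one>\<^bsub>G\<^esub>)"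
    by (intro definable_pred_conj definable_pred_mem[OF n(2)]
          definable_fun_eq[OF mu(2)[unfolded p k] one]) (rule coordinate_map_intros)+
  moreover have "{z. length z = n + n \<and> (take n z \<in> carrier G \<and> drop n z \<in> carrier G \<and> mu z = \<one>\<^bsub>G\<^esub>)}
      = {x @ inv\<^bsub>G\<^esub> x | x. x \<in> carrier G}" (is "?L = ?R")
  proof (intro subset_antisym subsetI)
    fix z assume z: "z \<in> ?L"
    then have "take n z \<otimes>\<^bsub>G\<^esub> drop n z = mu (take n z @ drop n z)"
      by (intro mu_eq[symmetric]) auto
    then have "take n z \<otimes>\<^bsub>G\<^esub> drop n z = \<one>\<^bsub>G\<^esub>" using z by simp
    then have "inv\<^bsub>G\<^esub> (drop n z) = take n z" using z by (intro inv_equality) auto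
    moreover have "inv\<^bsub>G\<^esub> (inv\<^bsub>G\<^esub> (drop n z)) = drop n z" using z by (intro inv_inv) auto
    ultimately have "drop n z = inv\<^bsub>G\<^esub> (take n z)" by simp
    then show "z \<in> ?R" using z append_take_drop_id[of n z] by (intro CollectI exI[of _ "take n z"]) auto
  next
    fix z assume "z \<in> ?R"
    then obtain x where "z = x @ inv\<^bsub>G\<^esub> x" "x \<in> carrier G" by blast
    then show "z \<in> ?L" using len[of x] len[of "inv\<^bsub>G\<^esub> x"] mu_eq[of x "inv\<^bsub>G\<^esub> x"] by simp
  qed
  ultimately have "definable_map M UNIV (carrier G) (m_inv G)"
    unfolding definable_map_def definable_pred_def using len by (intro exI[of _ n] conjI ballI) auto
  then obtain q l iv where iv: "definable M UNIV q (carrier G)" "definable_fun M q l iv"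
      "\<forall>x\<in>carrier G. iv x = inv\<^bsub>G\<^esub> x"
    by (rule definable_map_total)
  have "q = n" using definable_length[OF iv(1) one_closed] l1 by simp
  moreover from this have "l = n"
    using definable_fun_length[OF iv(2), of "\<one>\<^bsub>G\<^esub>"] iv(3) l1 by (metis inv_one one_closed)
  ultimately show thesis using that[OF n(2) mu(2)[unfolded p k] _ _ iv(3)] mu_eq iv(2) by simp
qed

context atomic_homogeneous
begin

text \<open>
  The carrier and the multiplication of the image group are images under definable functions,
  hence definable over \<open>M\<close>.  They are invariant because \<open>\<sigma>\<close> acts on the values of \<open>F\<close> through an
  endomorphism of the source.
\<close>

lemma image_group_definable:
  assumes K: "definable_group M UNIV K"
    and Kn: "definable M UNIV n (carrier K)" and F: "definable_fun M n k F"
    and w: "weak_group_morphism F H K"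
    and s: "\<And>\<sigma>. \<sigma> \<in> Aut M A \<Longrightarrow> s \<sigma> \<in> hom K K"
    and F_s: "\<And>\<sigma> x. \<sigma> \<in> Aut M A \<Longrightarrow> x \<in> carrier K \<Longrightarrow> map \<sigma> (F x) = F (s \<sigma> x)"
  shows "definable_group M A (image_group F K)"
proof -
  let ?Q = "image_group F K"
  obtain m mu iv where mu: "definable M UNIV m (carrier K)" "definable_fun M (m + m) m mu"
    "\<forall>x\<in>carrier K. \<forall>y\<in>carrier K. mu (x @ y) = x \<otimes>\<^bsub>K\<^esub> y"
    by (rule definable_group_funs[OF K])
  have "group K" using K unfolding definable_group_def by blast
  then interpret K: group K .
  have len: "length x = n" if "x \<in> carrier K" for x by (rule definable_length[OF Kn that])
  have m: "m = n" using definable_length[OF mu(1) K.one_closed] len[OF K.one_closed] by simp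
  interpret F: group_hom K ?Q F by (rule K.weak_group_morphism_group_hom[OF w])
  have closed: "s \<sigma> x \<in> carrier K" if "\<sigma> \<in> Aut M A" "x \<in> carrier K" for \<sigma> x
    using s[OF that(1)] that(2) by (rule hom_in_carrier)
  have smult: "s \<sigma> (x \<otimes>\<^bsub>K\<^esub> y) = s \<sigma> x \<otimes>\<^bsub>K\<^esub> s \<sigma> y"
    if "\<sigma> \<in> Aut M A" "x \<in> carrier K" "y \<in> carrier K" for \<sigma> x y
    using s[OF that(1)] that(2,3) by (rule hom_mult)
  have c: "carrier ?Q = F ` carrier K" by (simp add: image_group_carrier)
  have "definable M A k (carrier ?Q)"
    unfolding c
  proof (rule invariant_definable[OF definable_image[OF Kn F]])
    show "map \<sigma> u \<in> F ` carrier K" if \<sigma>: "\<sigma> \<in> Aut M A" and u: "u \<in> F ` carrier K" for \<sigma> u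
    proof -
      obtain x where "x \<in> carrier K" "u = F x" using u by blast
      then show ?thesis using F_s[OF \<sigma>] closed[OF \<sigma>] by blast
    qed
  qed
  moreover
  let ?P = "{z. length z = n + n \<and> (take n z \<in> carrier K \<and> drop n z \<in> carrier K)}"
  let ?T = "\<lambda>z. (F (take n z) @ F (drop n z)) @ F (mu z)"
  let ?\<Gamma> = "{u @ v @ (u \<otimes>\<^bsub>?Q\<^esub> v) | u v. u \<in> carrier ?Q \<and> v \<in> carrier ?Q}"
  have P: "definable M UNIV (n + n) ?P"
    unfolding definable_pred_def[symmetric]
    by (intro definable_pred_conj definable_pred_mem[OF Kn]) (rule coordinate_map_intros)+
  have T: "definable_fun M (n + n) (k + k + k) ?T"
    by (intro definable_fun_append definable_fun_comp[OF F] mu(2)[unfolded m])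
       (rule definable_fun_intros)+
  have T_eq: "?T (x @ y) = F x @ F y @ (F x \<otimes>\<^bsub>?Q\<^esub> F y)" if "x \<in> carrier K" "y \<in> carrier K" for x y
    using len[OF that(1)] mu(3) that by simp
  have "?T ` ?P = ?\<Gamma>"
  proof (intro subset_antisym subsetI)
    fix w assume "w \<in> ?T ` ?P"
    then obtain z where z: "z \<in> ?P" "w = ?T z" by blast
    then have "w = ?T (take n z @ drop n z)" by simp
    then have "w = F (take n z) @ F (drop n z) @ (F (take n z) \<otimes>\<^bsub>?Q\<^esub> F (drop n z))"
      using z(1) by (subst (asm) T_eq) auto
    then show "w \<in> ?\<Gamma>" unfolding c using z(1) by blast
  next
    fix w assume "w \<in> ?\<Gamma>"
    then obtain x y where xy: "x \<in> carrier K" "y \<in> carrier K" "w = F x @ F y @ (F x \<otimes>\<^bsub>?Q\<^esub> F y)"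
      unfolding c by blast
    then have "w = ?T (x @ y)" using T_eq by simp
    moreover have "x @ y \<in> ?P" using xy(1,2) len by simp
    ultimately show "w \<in> ?T ` ?P" by blast
  qed
  then have "definable M UNIV (k + k + k) ?\<Gamma>" using definable_image[OF P T] by simp
  then have "definable M A (k + k + k) ?\<Gamma>"
  proof (rule invariant_definable)
    show "map \<sigma> w \<in> ?\<Gamma>" if \<sigma>: "\<sigma> \<in> Aut M A" and w: "w \<in> ?\<Gamma>" for \<sigma> w
    proof -
      obtain x y where xy: "x \<in> carrier K" "y \<in> carrier K" "w = F x @ F y @ (F x \<otimes>\<^bsub>?Q\<^esub> F y)"
        using w unfolding c by blast
      have "map \<sigma> (F x \<otimes>\<^bsub>?Q\<^esub> F y) = F (s \<sigma> (x \<otimes>\<^bsub>K\<^esub> y))"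
        using F_s[OF \<sigma> K.m_closed[OF xy(1,2)]] xy(1,2) by simp
      also have "\<dots> = F (s \<sigma> x) \<otimes>\<^bsub>?Q\<^esub> F (s \<sigma> y)"
        using smult[OF \<sigma> xy(1,2)] closed[OF \<sigma>] xy(1,2) by simp
      finally have "map \<sigma> w = F (s \<sigma> x) @ F (s \<sigma> y) @ (F (s \<sigma> x) \<otimes>\<^bsub>?Q\<^esub> F (s \<sigma> y))"
        using xy F_s[OF \<sigma>] by simp
      then show ?thesis unfolding c using closed[OF \<sigma>] xy(1,2) by blast
    qed
  qed
  ultimately show ?thesis
    unfolding definable_group_def using K.image_group_is_group[OF w] by blast
qed

end


section \<open>Definable cocycles\<close>

context atomic_homogeneous
begin

lemma definable_cocycles_iff:
  "\<Phi> \<in> definable_cocycles M A G \<longleftrightarrow> \<Phi> \<in> Aut M A \<rightarrow>\<^sub>E carrier G \<and>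
     (\<forall>\<sigma>\<in>Aut M A. \<forall>\<tau>\<in>Aut M A. \<Phi> (\<sigma> \<circ> \<tau>) = \<Phi> \<sigma> \<otimes>\<^bsub>G\<^esub> map \<sigma> (\<Phi> \<tau>)) \<and>
     (\<exists>a k f. definable_fun M (length a) k f \<and> (\<forall>\<sigma>\<in>Aut M A. \<Phi> \<sigma> = f (map \<sigma> a)))"
  unfolding definable_cocycles_def mem_Collect_eq cocycle_definability_iff ..

lemma cocycle_closed:
  "\<Phi> \<in> definable_cocycles M A G \<Longrightarrow> \<sigma> \<in> Aut M A \<Longrightarrow> \<Phi> \<sigma> \<in> carrier G"
  unfolding definable_cocycles_iff by blast

lemma cocycle_comp:
  "\<Phi> \<in> definable_cocycles M A G \<Longrightarrow> \<sigma> \<in> Aut M A \<Longrightarrow> \<tau> \<in> Aut M A \<Longrightarrow>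
   \<Phi> (\<sigma> \<circ> \<tau>) = \<Phi> \<sigma> \<otimes>\<^bsub>G\<^esub> map \<sigma> (\<Phi> \<tau>)"
  unfolding definable_cocycles_iff by blast

lemma cocycle_fun:
  assumes "\<Phi> \<in> definable_cocycles M A G" "definable M B n (carrier G)"
  obtains a f where "definable_fun M (length a) n f" "\<forall>\<sigma>\<in>Aut M A. \<Phi> \<sigma> = f (map \<sigma> a)"
proof -
  have "\<exists>a k f. definable_fun M (length a) k f \<and> (\<forall>\<sigma>\<in>Aut M A. \<Phi> \<sigma> = f (map \<sigma> a))"
    using assms(1) unfolding definable_cocycles_iff by (elim conjE)
  then obtain a k f where f: "definable_fun M (length a) k f" "\<forall>\<sigma>\<in>Aut M A. \<Phi> \<sigma> = f (map \<sigma> a)"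
    by (elim exE conjE)
  have "\<Phi> id \<in> carrier G" using cocycle_closed[OF assms(1) id_in_Aut] .
  moreover have "\<Phi> id = f (map id a)" using f(2) id_in_Aut by blast
  ultimately have "k = n"
    using definable_length[OF assms(2)] definable_fun_length[OF f(1), of "map id a"] by simp
  then show thesis using that f by blast
qed

lemma cocycle_id:
  assumes "group G" "\<Phi> \<in> definable_cocycles M A G"
  shows "\<Phi> id = \<one>\<^bsub>G\<^esub>"
proof -
  interpret group G by (rule assms(1))
  have "\<Phi> id = \<Phi> id \<otimes>\<^bsub>G\<^esub> \<Phi> id" using cocycle_comp[OF assms(2) id_in_Aut id_in_Aut] by simp
  then show ?thesis using cocycle_closed[OF assms(2) id_in_Aut] r_cancel_one' by metis
qed

lemma cohomologous_equiv:
  assumes "definable_group M A G"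
  shows "equiv (definable_cocycles M A G) (cohomologous M A G)"
proof -
  have "group G" using assms unfolding definable_group_def by blast
  then interpret group G .
  have hom: "group_hom G G (map \<sigma>)" if "\<sigma> \<in> Aut M A" for \<sigma>
    by (rule definable_group_Aut(2)[OF assms that])
  show ?thesis
  proof (rule equivI)
    show "cohomologous M A G \<subseteq> definable_cocycles M A G \<times> definable_cocycles M A G"
      unfolding cohomologous_def by blast
    show "refl_on (definable_cocycles M A G) (cohomologous M A G)"
    proof (rule refl_onI)
      fix \<Phi> assume \<Phi>: "\<Phi> \<in> definable_cocycles M A G"
      have "\<Phi> \<sigma> = inv\<^bsub>G\<^esub> \<one>\<^bsub>G\<^esub> \<otimes>\<^bsub>G\<^esub> \<Phi> \<sigma> \<otimes>\<^bsub>G\<^esub> map \<sigma> \<one>\<^bsub>G\<^esub>" if "\<sigma> \<in> Aut M A" for \<sigma>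
        using cocycle_closed[OF \<Phi> that] group_hom.hom_one[OF hom[OF that]] by simp
      then show "(\<Phi>, \<Phi>) \<in> cohomologous M A G" unfolding cohomologous_def using \<Phi> by blast
    qed
    show "sym (cohomologous M A G)"
    proof (rule symI)
      fix \<Phi> \<Psi> assume "(\<Phi>, \<Psi>) \<in> cohomologous M A G"
      then obtain b where *: "\<Phi> \<in> definable_cocycles M A G" "\<Psi> \<in> definable_cocycles M A G"
        "b \<in> carrier G" "\<forall>\<sigma>\<in>Aut M A. \<Psi> \<sigma> = inv\<^bsub>G\<^esub> b \<otimes>\<^bsub>G\<^esub> \<Phi> \<sigma> \<otimes>\<^bsub>G\<^esub> map \<sigma> b"
        unfolding cohomologous_def by blast
      have "\<Phi> \<sigma> = inv\<^bsub>G\<^esub> (inv\<^bsub>G\<^esub> b) \<otimes>\<^bsub>G\<^esub> \<Psi> \<sigma> \<otimes>\<^bsub>G\<^esub> map \<sigma> (inv\<^bsub>G\<^esub> b)" if "\<sigma> \<in> Aut M A" for \<sigma>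
      proof -
        interpret s: group_hom G G "map \<sigma>" by (rule hom[OF that])
        show ?thesis using *(4) that cocycle_closed[OF *(1) that] *(3)
          by (simp add: m_assoc s.hom_inv) (simp add: m_assoc[symmetric])
      qed
      then show "(\<Psi>, \<Phi>) \<in> cohomologous M A G" unfolding cohomologous_def using * by blast
    qed
    show "trans (cohomologous M A G)"
    proof (rule transI)
      fix \<Phi> \<Psi> \<Theta> assume "(\<Phi>, \<Psi>) \<in> cohomologous M A G" "(\<Psi>, \<Theta>) \<in> cohomologous M A G"
      then obtain b d where *: "\<Phi> \<in> definable_cocycles M A G" "\<Theta> \<in> definable_cocycles M A G"
        "b \<in> carrier G" "\<forall>\<sigma>\<in>Aut M A. \<Psi> \<sigma> = inv\<^bsub>G\<^esub> b \<otimes>\<^bsub>G\<^esub> \<Phi> \<sigma> \<otimes>\<^bsub>G\<^esub> map \<sigma> b"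
        "d \<in> carrier G" "\<forall>\<sigma>\<in>Aut M A. \<Theta> \<sigma> = inv\<^bsub>G\<^esub> d \<otimes>\<^bsub>G\<^esub> \<Psi> \<sigma> \<otimes>\<^bsub>G\<^esub> map \<sigma> d"
        unfolding cohomologous_def by blast
      have "\<Theta> \<sigma> = inv\<^bsub>G\<^esub> (b \<otimes>\<^bsub>G\<^esub> d) \<otimes>\<^bsub>G\<^esub> \<Phi> \<sigma> \<otimes>\<^bsub>G\<^esub> map \<sigma> (b \<otimes>\<^bsub>G\<^esub> d)" if "\<sigma> \<in> Aut M A" for \<sigma>
      proof -
        interpret s: group_hom G G "map \<sigma>" by (rule hom[OF that])
        show ?thesis using *(4,6) that cocycle_closed[OF *(1) that] *(3,5)
          by (simp add: m_assoc inv_mult_group)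
      qed
      then show "(\<Phi>, \<Theta>) \<in> cohomologous M A G" unfolding cohomologous_def
        using * m_closed[OF *(3) *(5)] by blast
    qed
  qed
qed

end


section \<open>The quotient group\<close>

locale definable_normal_subgroup = atomic_homogeneous M A + normal N G
  for M :: "('f, 'r, 'a) fo_structure" and A :: "'a set"
    and N :: "'a list set" and G :: "'a list monoid" (structure) +
  assumes group_definable: "definable_group M A G"
    and subgroup_definable: "\<exists>n. definable M A n N"
begin

lemma act_hom: "\<sigma> \<in> Aut M A \<Longrightarrow> group_hom G G (map \<sigma>)"
  by (rule definable_group_Aut(2)[OF group_definable])

lemma act_mem: "\<sigma> \<in> Aut M A \<Longrightarrow> map \<sigma> x \<in> carrier G \<longleftrightarrow> x \<in> carrier G"
  by (rule definable_group_Aut(1)[OF group_definable])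

lemma act_mem_N: "\<sigma> \<in> Aut M A \<Longrightarrow> map \<sigma> x \<in> N \<longleftrightarrow> x \<in> N"
  using subgroup_definable definable_Aut by (elim exE) (rule definable_Aut)

lemma group_definable_UNIV: "definable_group M UNIV G"
  by (rule definable_group_mono[OF group_definable subset_UNIV])

lemma subgroup_definable_arity:
  assumes "definable M B n (carrier G)"
  shows "definable M A n N"
proof -
  obtain m where m: "definable M A m N" using subgroup_definable by blast
  have "m = n"
    using definable_length[OF m subgroup.one_closed[OF subgroup_axioms]] definable_length[OF assms one_closed]
    by simp
  then show ?thesis using m by simp
qed

text \<open>
  \<open>F x\<close> is the code of the coset \<open>N #> x\<close>, and \<open>\<sigma>\<close> maps this coset to \<open>N #> \<sigma> x\<close>.
\<close>

lemma definable_quotient_exists: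
  assumes EI: "eliminates_imaginaries M"
  shows "\<exists>Q. is_definable_quotient M A G N Q"
proof -
  obtain n mu iv where n: "definable M UNIV n (carrier G)"
    and mu: "definable_fun M (n + n) n mu" "\<forall>x\<in>carrier G. \<forall>y\<in>carrier G. mu (x @ y) = x \<otimes> y"
    and iv: "definable_fun M n n iv" "\<forall>x\<in>carrier G. iv x = inv x"
    by (rule definable_group_funs[OF group_definable_UNIV])
  have N: "definable M UNIV n N" by (rule definable_mono[OF subgroup_definable_arity[OF n]]) simp
  \<comment> \<open>The fibre of \<open>?P\<close> over \<open>x\<close> is the coset of \<open>x\<close>.\<close>
  let ?P = "\<lambda>z. drop n z \<in> carrier G \<and> mu (take n z @ iv (drop n z)) \<in> N"
  have "definable_pred M UNIV (n + n) ?P"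
    by (intro definable_pred_conj definable_pred_mem[OF n] definable_fun_mem[OF N]
          definable_fun_comp[OF mu(1)] definable_fun_append definable_fun_comp[OF iv(1)])
       (rule coordinate_map_intros definable_fun_intros)+
  then obtain k F where F: "definable_fun M n k F"
    "\<And>\<sigma> x x'. \<sigma> \<in> Aut M {} \<Longrightarrow> length x = n \<Longrightarrow> length x' = n \<Longrightarrow>
       map \<sigma> (F x) = F x' \<longleftrightarrow> (\<forall>w. length w = n \<longrightarrow> ?P (x @ w) \<longleftrightarrow> ?P (x' @ map \<sigma> w))"
    by (rule definable_family_codes[OF EI]) blast
  have P: "?P (x @ w) \<longleftrightarrow> w \<in> carrier G \<and> x \<otimes> inv w \<in> N" if "x \<in> carrier G" for x w
    using that definable_length[OF n that] mu(2) iv(2) by auto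
  have F_act: "map \<sigma> (F x) = F x' \<longleftrightarrow> map \<sigma> x \<otimes> inv x' \<in> N"
    if \<sigma>: "\<sigma> \<in> Aut M A" and x: "x \<in> carrier G" "x' \<in> carrier G" for \<sigma> x x'
  proof -
    interpret s: group_hom G G "map \<sigma>" by (rule act_hom[OF \<sigma>])
    have "\<sigma> \<in> Aut M {}" using \<sigma> Aut_mono[of "{}" A M] by blast
    then have iff: "map \<sigma> (F x) = F x' \<longleftrightarrow> (\<forall>w. length w = n \<longrightarrow> ?P (x @ w) \<longleftrightarrow> ?P (x' @ map \<sigma> w))"
      using definable_length[OF n] x by (intro F(2))
    have P\<sigma>: "?P (x' @ map \<sigma> w) \<longleftrightarrow> w \<in> carrier G \<and> x' \<otimes> inv (map \<sigma> w) \<in> N" for w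
      using P[OF x(2)] act_mem[OF \<sigma>] by simp
    have Px: "?P (x @ w) \<longleftrightarrow> w \<in> carrier G \<and> map \<sigma> x \<otimes> inv (map \<sigma> w) \<in> N" for w
    proof -
      have "x \<otimes> inv w \<in> N \<longleftrightarrow> map \<sigma> x \<otimes> inv (map \<sigma> w) \<in> N" if "w \<in> carrier G"
        using act_mem_N[OF \<sigma>, of "x \<otimes> inv w"] that x by simp
      then show ?thesis using P[OF x(1)] by blast
    qed
    show ?thesis
    proof
      assume "map \<sigma> (F x) = F x'"
      moreover have "length x = n" by (rule definable_length[OF n x(1)])
      moreover have "?P (x @ x)" unfolding P[OF x(1)] using x by simp
      ultimately have "x' \<otimes> inv (map \<sigma> x) \<in> N" unfolding iff P\<sigma> by blast
      then have "inv (x' \<otimes> inv (map \<sigma> x)) \<in> N" by (rule m_inv_closed)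
      then show "map \<sigma> x \<otimes> inv x' \<in> N" using x by (simp add: inv_mult_group)
    next
      assume N: "map \<sigma> x \<otimes> inv x' \<in> N"
      have "map \<sigma> x \<otimes> inv (map \<sigma> w) \<in> N \<longleftrightarrow> x' \<otimes> inv (map \<sigma> w) \<in> N" if w: "w \<in> carrier G" for w
      proof -
        have eq: "map \<sigma> x \<otimes> inv (map \<sigma> w) = (map \<sigma> x \<otimes> inv x') \<otimes> (x' \<otimes> inv (map \<sigma> w))"
          using x w by (simp add: m_assoc) (simp add: m_assoc[symmetric])
        have "x' \<otimes> inv (map \<sigma> w) = inv (map \<sigma> x \<otimes> inv x') \<otimes> (map \<sigma> x \<otimes> inv (map \<sigma> w))"
          using x w by (simp add: m_assoc inv_mult_group) (simp add: m_assoc[symmetric])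
        then show ?thesis
          using eq N subgroup.m_closed[OF subgroup_axioms] m_inv_closed by metis
      qed
      then show "map \<sigma> (F x) = F x'" unfolding iff P\<sigma> Px by blast
    qed
  qed
  have w: "weak_group_morphism F N G"
  proof (rule weak_group_morphismsI)
    show "N \<lhd> G" by (rule normal_axioms)
    show "F a = F b \<longleftrightarrow> a \<otimes> inv b \<in> N" if "a \<in> carrier G" "b \<in> carrier G" for a b
      using F_act[OF id_in_Aut that] by simp
  qed
  have F_map: "map \<sigma> (F x) = F (map \<sigma> x)" if "\<sigma> \<in> Aut M A" "x \<in> carrier G" for \<sigma> x
  proof -
    have "map \<sigma> x \<in> carrier G" using act_mem that by simp
    then show ?thesis using F_act[OF that(1,2)] by simp
  qed
  let ?Q = "image_group F G"
  have "definable_group M A ?Q"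
    by (rule image_group_definable[OF group_definable_UNIV n F(1) w, of map])
       (use F_map act_hom in \<open>simp_all add: group_hom.homh\<close>)
  moreover have "F \<in> hom G ?Q" by (rule weak_group_morphism_is_hom[OF w])
  moreover have "kernel G ?Q F = N" by (rule weak_group_morphism_ker[OF w])
  moreover have "definable_map M A (carrier G) F"
    by (rule invariant_definable_map[OF definable_mapI[OF n F(1)]]) (use F_map act_mem in auto)
  moreover have "F ` carrier G = carrier ?Q" by (simp add: image_group_carrier)
  ultimately show ?thesis unfolding is_definable_quotient_def by blast
qed

end


section \<open>Twisted forms\<close>

context definable_normal_subgroup
begin

text \<open>
  In this context \<open>N\<close> is a mere set, whereas forms and their cocycles refer to a group.
\<close>

abbreviation group_N :: "'a list monoid" where "group_N \<equiv> G\<lparr>carrier := N\<rparr>"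

lemma group_N_definable: "definable_group M A group_N"
proof -
  obtain n where n: "definable M A n (carrier G)"
    "definable M A (n + n + n) {x @ y @ (x \<otimes> y) | x y. x \<in> carrier G \<and> y \<in> carrier G}"
    by (rule definable_groupE[OF group_definable])
  let ?\<Gamma> = "{x @ y @ (x \<otimes> y) | x y. x \<in> carrier G \<and> y \<in> carrier G}"
  have N: "definable M A n N" by (rule subgroup_definable_arity[OF n(1)])
  have "definable_pred M A (n + n + n)
      (\<lambda>z. take n (take (n + n) z) \<in> N \<and> drop n (take (n + n) z) \<in> N \<and> z \<in> ?\<Gamma>)"
    by (intro definable_pred_conj definable_pred_mem[OF N] definable_pred_mem[OF n(2)])
       (rule coordinate_map_intros)+
  moreover have "{z. length z = n + n + n \<and>
      (take n (take (n + n) z) \<in> N \<and> drop n (take (n + n) z) \<in> N \<and> z \<in> ?\<Gamma>)} =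
      {x @ y @ (x \<otimes> y) | x y. x \<in> N \<and> y \<in> N}" (is "?L = ?R")
  proof (intro subset_antisym subsetI)
    fix z assume z: "z \<in> ?L"
    then obtain x y where xy: "z = x @ y @ (x \<otimes> y)" "x \<in> carrier G" "y \<in> carrier G" by blast
    then have "length x = n" "length y = n" using definable_length[OF n(1)] by blast+
    then have "x \<in> N" "y \<in> N" using z xy(1) by simp_all
    then show "z \<in> ?R" using xy(1) by blast
  next
    fix z assume "z \<in> ?R"
    then obtain x y where xy: "z = x @ y @ (x \<otimes> y)" "x \<in> N" "y \<in> N" by blast
    then have G: "x \<in> carrier G" "y \<in> carrier G" by auto
    then have "length x = n" "length y = n" "length (x \<otimes> y) = n"
      using definable_length[OF n(1)] by auto
    moreover have "z \<in> ?\<Gamma>" using xy(1) G by blast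
    ultimately show "z \<in> ?L" using xy by simp
  qed
  ultimately have "definable M A (n + n + n) {x @ y @ (x \<otimes> y) | x y. x \<in> N \<and> y \<in> N}"
    unfolding definable_pred_def by simp
  moreover have "group group_N" by (rule subgroup_is_group[OF group_axioms])
  ultimately show ?thesis unfolding definable_group_def using N by (intro conjI exI[of _ n]) simp_all
qed

lemma AutoGroup_mult:
  "\<phi> \<in> Bij N \<Longrightarrow> \<psi> \<in> Bij N \<Longrightarrow> \<phi> \<otimes>\<^bsub>AutoGroup group_N\<^esub> \<psi> = compose N \<phi> \<psi>"
  by (simp add: AutoGroup_def BijGroup_def)

lemma auto_Bij: "\<phi> \<in> definable_auts M group_N \<Longrightarrow> \<phi> \<in> Bij N"
  by (simp add: definable_auts_def auto_def)

lemma map_act_eq: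
  assumes "\<sigma> \<in> Aut M A" "x \<in> N"
  shows "map_act N \<sigma> \<phi> (map \<sigma> x) = map \<sigma> (\<phi> x)"
  using assms act_mem_N[OF assms(1)] map_Aut_inv(2)[OF assms(1), of x]
  by (simp add: map_act_def del: map_map)

lemma act_bij: "\<sigma> \<in> Aut M A \<Longrightarrow> bij_betw (map \<sigma>) N N"
  by (rule bij_betw_byWitness[where f' = "map (inv_into UNIV \<sigma>)"])
     (auto simp del: map_map simp: map_Aut_inv act_mem_N inv_in_Aut)

lemma act_surj:
  assumes "\<sigma> \<in> Aut M A" "y \<in> N"
  obtains x where "x \<in> N" "y = map \<sigma> x"
  using act_bij[OF assms(1)] assms(2) unfolding bij_betw_def by blast

lemma map_act_Bij:
  assumes "\<sigma> \<in> Aut M A" "\<phi> \<in> Bij N"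
  shows "map_act N \<sigma> \<phi> \<in> Bij N"
proof -
  have "bij_betw \<phi> N N" using assms(2) by (simp add: Bij_def)
  then have "bij_betw (map \<sigma> \<circ> (\<phi> \<circ> map (inv_into UNIV \<sigma>))) N N"
    using act_bij[OF assms(1)] act_bij[OF inv_in_Aut[OF assms(1)]] by (intro bij_betw_trans)
  moreover have "map_act N \<sigma> \<phi> = restrict (map \<sigma> \<circ> (\<phi> \<circ> map (inv_into UNIV \<sigma>))) N"
    by (auto simp: map_act_def)
  ultimately show ?thesis
    unfolding Bij_def by (simp add: bij_betw_restrict_eq)
qed

lemma conj_cocycle_apply:
  "\<sigma> \<in> Aut M A \<Longrightarrow> x \<in> N \<Longrightarrow> conj_cocycle M A G N \<Phi> \<sigma> x = \<Phi> \<sigma> \<otimes> x \<otimes> inv (\<Phi> \<sigma>)"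
  by (simp add: conj_cocycle_def)

lemma conj_auto:
  assumes "g \<in> carrier G"
  shows "(\<lambda>x\<in>N. g \<otimes> x \<otimes> inv g) \<in> definable_auts M group_N"
proof -
  let ?c = "\<lambda>x\<in>N. g \<otimes> x \<otimes> inv g"
  have "?c \<in> hom group_N group_N"
  proof (rule homI)
    show "?c x \<in> carrier group_N" if "x \<in> carrier group_N" for x
      using that assms inv_op_closed2 by simp
    show "?c (x \<otimes>\<^bsub>group_N\<^esub> y) = ?c x \<otimes>\<^bsub>group_N\<^esub> ?c y"
      if "x \<in> carrier group_N" "y \<in> carrier group_N" for x y
    proof -
      have "g \<otimes> (x \<otimes> y) \<otimes> inv g = (g \<otimes> x \<otimes> inv g) \<otimes> (g \<otimes> y \<otimes> inv g)"
        using that assms by (simp add: m_assoc) (simp add: m_assoc[symmetric])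
      then show ?thesis using that subgroup.m_closed[OF subgroup_axioms] by simp
    qed
  qed
  moreover have "bij_betw ?c N N"
  proof (rule bij_betw_byWitness[where f' = "\<lambda>x. inv g \<otimes> x \<otimes> g"])
    show "\<forall>x\<in>N. inv g \<otimes> ?c x \<otimes> g = x"
      using assms by (simp add: m_assoc) (simp add: m_assoc[symmetric])
    show "\<forall>x\<in>N. ?c (inv g \<otimes> x \<otimes> g) = x"
      using assms inv_op_closed1 by (simp add: m_assoc) (simp add: m_assoc[symmetric])
    show "?c ` N \<subseteq> N" using assms inv_op_closed2 by auto
    show "(\<lambda>x. inv g \<otimes> x \<otimes> g) ` N \<subseteq> N" using assms inv_op_closed1 by auto
  qed
  moreover have "definable_map M UNIV N ?c"
  proof -
    obtain n mu iv where n: "definable M UNIV n (carrier G)"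
      and mu: "definable_fun M (n + n) n mu" "\<forall>x\<in>carrier G. \<forall>y\<in>carrier G. mu (x @ y) = x \<otimes> y"
      by (rule definable_group_funs[OF group_definable_UNIV])
    have N: "definable M UNIV n N" by (rule definable_mono[OF subgroup_definable_arity[OF n]]) simp
    have const: "definable_fun M n n (\<lambda>x. b)" if "b \<in> carrier G" for b
      using definable_fun_const[of M n b] definable_length[OF n that] by simp
    show ?thesis
    proof (rule definable_mapI[OF N])
      show "definable_fun M n n (\<lambda>x. mu (mu (g @ x) @ inv g))"
        by (intro definable_fun_comp[OF mu(1)] definable_fun_append const definable_fun_id)
           (use assms in auto)
      show "mu (mu (g @ x) @ inv g) = ?c x" if "x \<in> N" for x
        using that mu(2) assms by simp
    qed
  qed
  ultimately show ?thesis by (simp add: definable_auts_def auto_def Bij_def)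
qed

lemma conj_cocycle_definable:
  assumes \<Phi>: "\<Phi> \<in> definable_cocycles M A G"
  shows "conj_cocycle M A G N \<Phi> \<in> definable_aut_cocycles M A group_N"
proof -
  let ?\<Lambda> = "conj_cocycle M A G N \<Phi>"
  note \<Phi>_closed = cocycle_closed[OF \<Phi>]
  have auts: "?\<Lambda> \<sigma> \<in> definable_auts M group_N" if "\<sigma> \<in> Aut M A" for \<sigma>
    using conj_auto[OF \<Phi>_closed[OF that]] that by (simp add: conj_cocycle_def)
  then have "?\<Lambda> \<in> Aut M A \<rightarrow>\<^sub>E definable_auts M group_N"
    by (auto simp: conj_cocycle_def)
  moreover have "?\<Lambda> (\<sigma> \<circ> \<tau>) = ?\<Lambda> \<sigma> \<otimes>\<^bsub>AutoGroup group_N\<^esub> map_act (carrier group_N) \<sigma> (?\<Lambda> \<tau>)"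
    if \<sigma>: "\<sigma> \<in> Aut M A" and \<tau>: "\<tau> \<in> Aut M A" for \<sigma> \<tau>
  proof -
    interpret s: group_hom G G "map \<sigma>" by (rule act_hom[OF \<sigma>])
    have B: "?\<Lambda> \<sigma> \<in> Bij N" "map_act N \<sigma> (?\<Lambda> \<tau>) \<in> Bij N"
      using auto_Bij[OF auts[OF \<sigma>]] map_act_Bij[OF \<sigma> auto_Bij[OF auts[OF \<tau>]]] by blast+
    have "?\<Lambda> (\<sigma> \<circ> \<tau>) y = compose N (?\<Lambda> \<sigma>) (map_act N \<sigma> (?\<Lambda> \<tau>)) y" if y: "y \<in> N" for y
    proof -
      obtain x where x: "x \<in> N" "y = map \<sigma> x" by (rule act_surj[OF \<sigma> y])
      let ?z = "\<Phi> \<tau> \<otimes> x \<otimes> inv (\<Phi> \<tau>)"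
      have z: "?z \<in> N" using inv_op_closed2 \<Phi>_closed[OF \<tau>] x(1) by blast
      have "compose N (?\<Lambda> \<sigma>) (map_act N \<sigma> (?\<Lambda> \<tau>)) y = ?\<Lambda> \<sigma> (map \<sigma> ?z)"
        using y x map_act_eq[OF \<sigma> x(1)] conj_cocycle_apply[OF \<tau> x(1)] by (simp add: compose_eq)
      also have "\<dots> = \<Phi> \<sigma> \<otimes> map \<sigma> ?z \<otimes> inv (\<Phi> \<sigma>)"
        using conj_cocycle_apply[OF \<sigma>] act_mem_N[OF \<sigma>] z by blast
      also have "\<dots> = \<Phi> (\<sigma> \<circ> \<tau>) \<otimes> y \<otimes> inv (\<Phi> (\<sigma> \<circ> \<tau>))"
        using \<Phi>_closed[OF \<sigma>] \<Phi>_closed[OF \<tau>] x cocycle_comp[OF \<Phi> \<sigma> \<tau>]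
        by (simp add: m_assoc inv_mult_group)
      also have "\<dots> = ?\<Lambda> (\<sigma> \<circ> \<tau>) y"
        using conj_cocycle_apply[OF comp_in_Aut[OF \<sigma> \<tau>] y] by simp
      finally show ?thesis by simp
    qed
    moreover have "?\<Lambda> (\<sigma> \<circ> \<tau>) \<in> extensional N"
      using comp_in_Aut[OF \<sigma> \<tau>] by (simp add: conj_cocycle_def)
    ultimately have "?\<Lambda> (\<sigma> \<circ> \<tau>) = compose N (?\<Lambda> \<sigma>) (map_act N \<sigma> (?\<Lambda> \<tau>))"
      by (intro extensionalityI[of _ N]) auto
    then show ?thesis using AutoGroup_mult[OF B] by simp
  qed
  moreover have "\<exists>a D h. definable_map M A D h \<and> (\<forall>\<sigma>\<in>Aut M A. \<forall>x\<in>carrier group_N.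
        a @ map \<sigma> a @ x \<in> D \<and> ?\<Lambda> \<sigma> x = h (a @ map \<sigma> a @ x))"
  proof -
    obtain n mu iv where n: "definable M UNIV n (carrier G)"
      and mu: "definable_fun M (n + n) n mu" "\<forall>x\<in>carrier G. \<forall>y\<in>carrier G. mu (x @ y) = x \<otimes> y"
      and iv: "definable_fun M n n iv" "\<forall>x\<in>carrier G. iv x = inv x"
      by (rule definable_group_funs[OF group_definable_UNIV])
    obtain a f where f: "definable_fun M (length a) n f" "\<forall>\<sigma>\<in>Aut M A. \<Phi> \<sigma> = f (map \<sigma> a)"
      by (rule cocycle_fun[OF \<Phi> n])
    let ?l = "length a"
    let ?F = "\<lambda>z. mu (mu (f (take ?l z) @ drop ?l z) @ iv (f (take ?l z)))"
    have "definable_fun M (?l + n) n ?F"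
      by (intro definable_fun_comp[OF mu(1)] definable_fun_append definable_fun_comp[OF iv(1)]
            definable_fun_comp[OF f(1)]) (rule definable_fun_intros)+
    from uniform_in_orbit[OF subgroup_definable_arity[OF n] this]
    obtain a' D h where h: "definable_map M A D h" "\<forall>\<sigma>\<in>Aut M A. \<forall>x\<in>N.
        a' @ map \<sigma> a' @ x \<in> D \<and> ?F (map \<sigma> a @ x) = h (a' @ map \<sigma> a' @ x)"
      by blast
    have "?F (map \<sigma> a @ x) = ?\<Lambda> \<sigma> x" if "\<sigma> \<in> Aut M A" "x \<in> N" for \<sigma> x
      using conj_cocycle_apply[OF that] that f(2) mu(2) iv(2) \<Phi>_closed[OF that(1)] by simp
    then show ?thesis using h by (intro exI[of _ a'] exI[of _ D] exI[of _ h]) simp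
  qed
  ultimately show ?thesis unfolding definable_aut_cocycles_def by blast
qed

lemma aut_cohomologous_refl:
  assumes "\<Lambda> \<in> definable_aut_cocycles M A group_N"
  shows "(\<Lambda>, \<Lambda>) \<in> aut_cohomologous M A group_N"
proof -
  interpret K: group group_N by (rule subgroup_is_group[OF group_axioms])
  interpret Auto: group "AutoGroup group_N" by (rule K.AutoGroup)
  let ?one = "\<lambda>x\<in>N. x"
  have one: "?one = \<one>\<^bsub>AutoGroup group_N\<^esub>" by (simp add: AutoGroup_def BijGroup_def)
  have "(\<lambda>x\<in>N. \<one> \<otimes> x \<otimes> inv \<one>) = ?one" by (rule restrict_ext) simp
  then have "?one \<in> definable_auts M group_N" using conj_auto[OF one_closed] by simp
  moreover have "\<Lambda> \<sigma> = inv\<^bsub>AutoGroup group_N\<^esub> ?one \<otimes>\<^bsub>AutoGroup group_N\<^esub> \<Lambda> \<sigma>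
      \<otimes>\<^bsub>AutoGroup group_N\<^esub> map_act (carrier group_N) \<sigma> ?one" if \<sigma>: "\<sigma> \<in> Aut M A" for \<sigma>
  proof -
    have "map_act N \<sigma> ?one = ?one"
      unfolding map_act_def
      by (rule restrict_ext)
         (use map_Aut_inv(1)[OF \<sigma>] act_mem_N[OF inv_in_Aut[OF \<sigma>]] in \<open>simp del: map_map\<close>)
    moreover have "\<Lambda> \<sigma> \<in> carrier (AutoGroup group_N)"
      using assms \<sigma> unfolding definable_aut_cocycles_def definable_auts_def AutoGroup_def by auto
    ultimately show ?thesis unfolding one by simp
  qed
  ultimately show ?thesis unfolding aut_cohomologous_def using assms by blast
qed

text \<open>
  \<open>F n\<close> is the code of the curve \<open>{(\<tau> a, (\<Phi> \<tau>)\<inverse> n (\<Phi> \<tau>)) | \<tau>}\<close>.  Its point over \<open>a\<close> itself is \<open>n\<close>,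
  so \<open>F\<close> is injective, and the action of \<open>\<sigma>\<close> on curves shows that the cocycle of \<open>F\<close> equals
  conjugation by \<open>\<Phi>\<close>, not merely up to cohomology.
\<close>

lemma twisted_form_exists:
  assumes EI: "eliminates_imaginaries M" and \<Phi>: "\<Phi> \<in> definable_cocycles M A G" "\<Phi> \<in> \<mu>"
  shows "\<exists>H. is_twisted_form M A G N \<mu> H"
proof -
  note \<Phi>_closed = cocycle_closed[OF \<Phi>(1)]
  obtain n mu iv where n: "definable M UNIV n (carrier G)"
    and mu: "definable_fun M (n + n) n mu" "\<forall>x\<in>carrier G. \<forall>y\<in>carrier G. mu (x @ y) = x \<otimes> y"
    and iv: "definable_fun M n n iv" "\<forall>x\<in>carrier G. iv x = inv x"
    by (rule definable_group_funs[OF group_definable_UNIV])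
  have N: "definable M UNIV n N" by (rule definable_mono[OF subgroup_definable_arity[OF n]]) simp
  obtain a f where f: "definable_fun M (length a) n f" "\<forall>\<sigma>\<in>Aut M A. \<Phi> \<sigma> = f (map \<sigma> a)"
    by (rule cocycle_fun[OF \<Phi>(1) n])
  let ?l = "length a"
  let ?O = "{map \<sigma> a | \<sigma>. \<sigma> \<in> Aut M A}"
  have O: "definable M UNIV ?l ?O" by (rule definable_mono[OF orbit_definable]) simp
  \<comment> \<open>The fibre of \<open>?P\<close> over \<open>x\<close> is the curve of \<open>x\<close>; its points are pairs of a conjugate \<open>?b\<close> of
      \<open>a\<close> and an \<open>n\<close>-tuple.\<close>
  let ?b = "\<lambda>z. take ?l (drop n z)"
  let ?P = "\<lambda>z. ?b z \<in> ?O \<and> mu (mu (iv (f (?b z)) @ take n z) @ f (?b z)) = drop ?l (drop n z)"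
  have "definable_pred M UNIV (n + (?l + n)) ?P"
    by (intro definable_pred_conj definable_pred_mem[OF O] definable_fun_eq[where m = n]
          definable_fun_comp[OF mu(1)] definable_fun_append definable_fun_comp[OF iv(1)]
          definable_fun_comp[OF f(1)]) (rule coordinate_map_intros definable_fun_intros)+
  then obtain k F where F: "definable_fun M n k F"
    "\<And>\<sigma> x x'. \<sigma> \<in> Aut M {} \<Longrightarrow> length x = n \<Longrightarrow> length x' = n \<Longrightarrow>
       map \<sigma> (F x) = F x' \<longleftrightarrow> (\<forall>w. length w = ?l + n \<longrightarrow> ?P (x @ w) \<longleftrightarrow> ?P (x' @ map \<sigma> w))"
    by (rule definable_family_codes[OF EI]) blast
  have P: "?P (x @ map \<tau> a @ y) \<longleftrightarrow> y = inv (\<Phi> \<tau>) \<otimes> x \<otimes> \<Phi> \<tau>"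
    if \<tau>: "\<tau> \<in> Aut M A" and x: "x \<in> N" for \<tau> x y
  proof -
    have "length x = n" by (rule definable_length[OF N x])
    then show ?thesis using \<tau> x f(2) mu(2) iv(2) \<Phi>_closed[OF \<tau>] by auto
  qed
  let ?s = "\<lambda>\<sigma> x. \<Phi> \<sigma> \<otimes> map \<sigma> x \<otimes> inv (\<Phi> \<sigma>)"
  have s_closed: "?s \<sigma> x \<in> N" if "\<sigma> \<in> Aut M A" "x \<in> N" for \<sigma> x
    using inv_op_closed2 \<Phi>_closed[OF that(1)] act_mem_N that by blast
  have F_s: "map \<sigma> (F x) = F (?s \<sigma> x)" if \<sigma>: "\<sigma> \<in> Aut M A" and x: "x \<in> N" for \<sigma> x
  proof -
    interpret s: group_hom G G "map \<sigma>" by (rule act_hom[OF \<sigma>])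
    have \<sigma>0: "\<sigma> \<in> Aut M {}" using \<sigma> Aut_mono[of "{}" A M] by blast
    have lx: "length x = n" and ls: "length (?s \<sigma> x) = n"
      using definable_length[OF N x] definable_length[OF N s_closed[OF \<sigma> x]] by blast+
    have "?P (x @ w) \<longleftrightarrow> ?P (?s \<sigma> x @ map \<sigma> w)" if w: "length w = ?l + n" for w
    proof (cases "take ?l w \<in> ?O")
      case True
      then obtain \<tau> where \<tau>: "\<tau> \<in> Aut M A" "take ?l w = map \<tau> a" by blast
      define y where "y = drop ?l w"
      have w_eq: "w = map \<tau> a @ y" using \<tau>(2) append_take_drop_id[of ?l w] by (simp add: y_def)
      have eq: "inv (\<Phi> (\<sigma> \<circ> \<tau>)) \<otimes> ?s \<sigma> x \<otimes> \<Phi> (\<sigma> \<circ> \<tau>) = map \<sigma> (inv (\<Phi> \<tau>) \<otimes> x \<otimes> \<Phi> \<tau>)"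
        unfolding cocycle_comp[OF \<Phi>(1) \<sigma> \<tau>(1)]
        using \<Phi>_closed[OF \<sigma>] \<Phi>_closed[OF \<tau>(1)] x
        by (simp add: m_assoc inv_mult_group) (simp add: m_assoc[symmetric])
      have "map \<sigma> w = map (\<sigma> \<circ> \<tau>) a @ map \<sigma> y" by (simp add: w_eq)
      then have "?P (?s \<sigma> x @ map \<sigma> w) \<longleftrightarrow> map \<sigma> y = map \<sigma> (inv (\<Phi> \<tau>) \<otimes> x \<otimes> \<Phi> \<tau>)"
        using P[OF comp_in_Aut[OF \<sigma> \<tau>(1)] s_closed[OF \<sigma> x], of "map \<sigma> y"] unfolding eq by simp
      also have "\<dots> \<longleftrightarrow> y = inv (\<Phi> \<tau>) \<otimes> x \<otimes> \<Phi> \<tau>"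
        using map_Aut_inv(2)[OF \<sigma>] by metis
      also have "\<dots> \<longleftrightarrow> ?P (x @ w)" unfolding w_eq using P[OF \<tau>(1) x, of y] by simp
      finally show ?thesis by simp
    next
      case False
      have "map \<sigma> (take ?l w) \<notin> ?O"
        using False definable_Aut[OF orbit_definable \<sigma>, of "take ?l w" a] by blast
      moreover have "?b (?s \<sigma> x @ map \<sigma> w) = map \<sigma> (take ?l w)" using ls by (simp add: take_map)
      ultimately have "\<not> ?P (?s \<sigma> x @ map \<sigma> w)" by metis
      moreover have "?b (x @ w) = take ?l w" using lx by simp
      then have "\<not> ?P (x @ w)" using False by metis
      ultimately show ?thesis by blast
    qed
    then show ?thesis using F(2)[OF \<sigma>0 lx ls] by blast
  qed
  have F_inj: "inj_on F N"
  proof (rule inj_onI)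
    fix x x' assume x: "x \<in> N" and x': "x' \<in> N" and eq: "F x = F x'"
    have lx: "length x = n" "length x' = n" using definable_length[OF N] x x' by blast+
    have one: "\<Phi> id = \<one>" by (rule cocycle_id[OF group_axioms \<Phi>(1)])
    have Px: "?P (x @ map id a @ x)" unfolding P[OF id_in_Aut x] one using x by simp
    have "map id (F x) = F x'" using eq by simp
    then have all: "\<forall>w. length w = ?l + n \<longrightarrow> ?P (x @ w) \<longleftrightarrow> ?P (x' @ map id w)"
      unfolding F(2)[OF id_in_Aut lx] .
    have e: "map id (map id a @ x) = map id a @ x" by simp
    have "?P (x @ map id a @ x) \<longleftrightarrow> ?P (x' @ map id (map id a @ x))"
      by (rule all[THEN spec, THEN mp]) (simp add: lx)
    then have "?P (x' @ map id a @ x)" using Px unfolding e by (rule iffD1)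
    then show "x = x'" unfolding P[OF id_in_Aut x'] one using x' by simp
  qed
  let ?H = "image_group F group_N"
  interpret K: group group_N by (rule subgroup_is_group[OF group_axioms])
  have w: "weak_group_morphism F {\<one>\<^bsub>group_N\<^esub>} group_N"
  proof (rule weak_group_morphismsI)
    show "{\<one>\<^bsub>group_N\<^esub>} \<lhd> group_N" by (rule K.one_is_normal)
    show "F x = F y \<longleftrightarrow> x \<otimes>\<^bsub>group_N\<^esub> inv\<^bsub>group_N\<^esub> y \<in> {\<one>\<^bsub>group_N\<^esub>}"
      if x: "x \<in> carrier group_N" and y: "y \<in> carrier group_N" for x y
    proof -
      have "F x = F y \<longleftrightarrow> x = y" using inj_on_eq_iff[OF F_inj] x y by simp
      moreover have "x \<otimes>\<^bsub>group_N\<^esub> inv\<^bsub>group_N\<^esub> y = \<one>\<^bsub>group_N\<^esub> \<longleftrightarrow> x = y"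
        using K.r_inv[OF y] K.inv_equality[OF _ K.inv_closed[OF y] x] K.inv_inv[OF y] by metis
      ultimately show ?thesis by simp
    qed
  qed
  have dK: "definable_group M UNIV group_N"
    by (rule definable_group_mono[OF group_N_definable]) simp
  have "definable_group M A ?H"
  proof (rule image_group_definable[OF dK _ F(1) w, of ?s])
    show "definable M UNIV n (carrier group_N)" using N by simp
    show "map \<sigma> (F x) = F (?s \<sigma> x)" if "\<sigma> \<in> Aut M A" "x \<in> carrier group_N" for \<sigma> x
      using F_s that by simp
    show "?s \<sigma> \<in> hom group_N group_N" if \<sigma>: "\<sigma> \<in> Aut M A" for \<sigma>
    proof (rule homI)
      interpret s: group_hom G G "map \<sigma>" by (rule act_hom[OF \<sigma>])
      show "?s \<sigma> x \<in> carrier group_N" if "x \<in> carrier group_N" for x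
        using s_closed[OF \<sigma>] that by simp
      show "?s \<sigma> (x \<otimes>\<^bsub>group_N\<^esub> y) = ?s \<sigma> x \<otimes>\<^bsub>group_N\<^esub> ?s \<sigma> y"
        if "x \<in> carrier group_N" "y \<in> carrier group_N" for x y
        using that \<Phi>_closed[OF \<sigma>] by (simp add: m_assoc) (simp add: m_assoc[symmetric])
    qed
  qed
  moreover have F_iso: "F \<in> definable_isos M group_N ?H"
  proof -
    have "F \<in> hom group_N ?H" by (rule K.weak_group_morphism_is_hom[OF w])
    moreover have "bij_betw F N (carrier ?H)"
      using F_inj by (simp add: bij_betw_def image_group_carrier)
    moreover have "definable_map M UNIV N F" by (rule definable_mapI[OF N F(1)]) simp
    ultimately show ?thesis by (simp add: definable_isos_def iso_def)
  qed
  moreover have "form_cocycle M A group_N F = conj_cocycle M A G N \<Phi>"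
  proof -
    have "inv_into N F (map_act N \<sigma> F y) = \<Phi> \<sigma> \<otimes> y \<otimes> inv (\<Phi> \<sigma>)"
      if \<sigma>: "\<sigma> \<in> Aut M A" and y: "y \<in> N" for \<sigma> y
    proof -
      obtain x where x: "x \<in> N" "y = map \<sigma> x" by (rule act_surj[OF \<sigma> y])
      have "map_act N \<sigma> F y = F (?s \<sigma> x)" using map_act_eq[OF \<sigma> x(1)] F_s[OF \<sigma> x(1)] x(2) by simp
      then show ?thesis using inv_into_f_f[OF F_inj s_closed[OF \<sigma> x(1)]] x(2) by simp
    qed
    then show ?thesis
      unfolding form_cocycle_def conj_cocycle_def by (auto simp: fun_eq_iff restrict_def)
  qed
  moreover
  let ?\<Lambda> = "conj_cocycle M A G N \<Phi>"
  let ?c = "aut_cohomologous M A group_N `` {?\<Lambda>}"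
  have "?c \<in> H1_aut M A group_N"
    unfolding H1_aut_def by (rule quotientI[OF conj_cocycle_definable[OF \<Phi>(1)]])
  moreover have "?\<Lambda> \<in> ?c" using aut_cohomologous_refl[OF conj_cocycle_definable[OF \<Phi>(1)]] by blast
  ultimately have form: "is_form M A group_N ?H"
    and tw: "\<exists>c\<in>H1_aut M A group_N. form_cocycle M A group_N F \<in> c \<and> ?\<Lambda> \<in> c"
    unfolding is_form_def by auto
  have "\<exists>g\<in>definable_isos M group_N ?H. \<exists>\<Phi>\<in>\<mu>. \<exists>c\<in>H1_aut M A group_N.
      form_cocycle M A group_N g \<in> c \<and> conj_cocycle M A G N \<Phi> \<in> c"
    by (rule bexI[OF _ F_iso], rule bexI[OF _ \<Phi>(2)], rule tw)
  then have "is_twisted_form M A G N \<mu> ?H" unfolding is_twisted_form_def by (rule conjI[OF form])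
  then show ?thesis by blast
qed

text \<open>
  The cocycle of a given isomorphism \<open>g\<close> and conjugation by \<open>\<Phi>\<close> are cohomologous to a common
  cocycle \<open>\<Lambda>\<close>, by automorphisms \<open>\<phi>\<close> and \<open>\<psi>\<close>.  Composing \<open>g\<close> with \<open>\<phi>\<inverse> \<circ> \<psi>\<close> yields an isomorphism
  whose cocycle is conjugation by \<open>\<Phi>\<close> on the nose.
\<close>

lemma twisted_form_iso:
  assumes tw: "is_twisted_form M A G N \<mu> H"
    and \<mu>: "\<mu> \<subseteq> definable_cocycles M A G"
  obtains \<Phi> g where "\<Phi> \<in> \<mu>" "definable_group M A H" "g \<in> iso group_N H" "definable_map M UNIV N g"
    "\<forall>\<sigma>\<in>Aut M A. \<forall>x\<in>N. map \<sigma> (g x) = g (\<Phi> \<sigma> \<otimes> map \<sigma> x \<otimes> inv (\<Phi> \<sigma>))"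
proof -
  let ?K = group_N
  obtain g \<Phi> c where H: "definable_group M A H" and g: "g \<in> definable_isos M ?K H"
    and \<Phi>: "\<Phi> \<in> \<mu>" and c: "c \<in> H1_aut M A ?K" "form_cocycle M A ?K g \<in> c" "conj_cocycle M A G N \<Phi> \<in> c"
    using tw unfolding is_twisted_form_def is_form_def by blast
  obtain \<Lambda> where \<Lambda>: "c = aut_cohomologous M A ?K `` {\<Lambda>}"
    using c(1) unfolding H1_aut_def by (auto elim: quotientE)
  let ?A = "AutoGroup ?K"
  have "(\<Lambda>, form_cocycle M A ?K g) \<in> aut_cohomologous M A ?K"
    "(\<Lambda>, conj_cocycle M A G N \<Phi>) \<in> aut_cohomologous M A ?K"
    using c(2,3) \<Lambda> by blast+
  then obtain \<phi> \<psi> where \<Lambda>_coc: "\<Lambda> \<in> definable_aut_cocycles M A ?K"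
    and \<phi>: "\<phi> \<in> definable_auts M ?K" "\<forall>\<sigma>\<in>Aut M A. form_cocycle M A ?K g \<sigma> =
       inv\<^bsub>?A\<^esub> \<phi> \<otimes>\<^bsub>?A\<^esub> \<Lambda> \<sigma> \<otimes>\<^bsub>?A\<^esub> map_act (carrier ?K) \<sigma> \<phi>"
    and \<psi>: "\<psi> \<in> definable_auts M ?K" "\<forall>\<sigma>\<in>Aut M A. conj_cocycle M A G N \<Phi> \<sigma> =
       inv\<^bsub>?A\<^esub> \<psi> \<otimes>\<^bsub>?A\<^esub> \<Lambda> \<sigma> \<otimes>\<^bsub>?A\<^esub> map_act (carrier ?K) \<sigma> \<psi>"
    unfolding aut_cohomologous_def by blast
  interpret K: group ?K by (rule subgroup_is_group[OF group_axioms])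
  have bij: "bij_betw \<phi> N N" "bij_betw \<psi> N N"
    using auto_Bij[OF \<phi>(1)] auto_Bij[OF \<psi>(1)] by (simp_all add: Bij_def)
  have \<Lambda>_Bij: "\<Lambda> \<sigma> \<in> Bij N" if "\<sigma> \<in> Aut M A" for \<sigma>
    using \<Lambda>_coc that auto_Bij unfolding definable_aut_cocycles_def by blast
  have \<Lambda>_closed: "\<Lambda> \<sigma> y \<in> N" if "\<sigma> \<in> Aut M A" "y \<in> N" for \<sigma> y
    using Bij_imp_funcset[OF \<Lambda>_Bij[OF that(1)]] that(2) by blast
  have eval: "(inv\<^bsub>?A\<^esub> \<chi> \<otimes>\<^bsub>?A\<^esub> \<Lambda> \<sigma> \<otimes>\<^bsub>?A\<^esub> map_act (carrier ?K) \<sigma> \<chi>) (map \<sigma> x) =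
      inv_into N \<chi> (\<Lambda> \<sigma> (map \<sigma> (\<chi> x)))"
    if \<sigma>: "\<sigma> \<in> Aut M A" and x: "x \<in> N" and \<chi>: "\<chi> \<in> definable_auts M ?K" for \<sigma> x \<chi>
  proof -
    have B: "\<chi> \<in> Bij N" by (rule auto_Bij[OF \<chi>])
    have "inv\<^bsub>?A\<^esub> \<chi> = inv\<^bsub>BijGroup N\<^esub> \<chi>"
    proof -
      have "\<chi> \<in> auto ?K" using \<chi> by (simp add: definable_auts_def)
      then show ?thesis
        using group.m_inv_consistent[OF group_BijGroup K.subgroup_auto] by (simp add: AutoGroup_def)
    qed
    then have i: "inv\<^bsub>?A\<^esub> \<chi> = (\<lambda>x\<in>N. inv_into N \<chi> x)" using inv_BijGroup[OF B] by simp
    have iB: "(\<lambda>x\<in>N. inv_into N \<chi> x) \<in> Bij N" by (rule restrict_inv_into_Bij[OF B])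
    have mB: "map_act N \<sigma> \<chi> \<in> Bij N" by (rule map_act_Bij[OF \<sigma> B])
    have "\<chi> x \<in> N" using Bij_imp_funcset[OF B] x by blast
    then have "\<Lambda> \<sigma> (map \<sigma> (\<chi> x)) \<in> N" using \<Lambda>_closed[OF \<sigma>] act_mem_N[OF \<sigma>] by blast
    then show ?thesis
      unfolding i AutoGroup_mult[OF iB \<Lambda>_Bij[OF \<sigma>]]
      using AutoGroup_mult[OF compose_Bij[OF iB \<Lambda>_Bij[OF \<sigma>]] mB] map_act_eq[OF \<sigma> x]
        act_mem_N[OF \<sigma>] x \<open>\<chi> x \<in> N\<close> by (simp add: compose_eq)
  qed
  have g_iso: "g \<in> iso ?K H" and g_map: "definable_map M UNIV N g"
    using g by (simp_all add: definable_isos_def)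
  have g_bij: "bij_betw g N (carrier H)" using g_iso by (simp add: iso_def)
  have H_mem: "map \<sigma> u \<in> carrier H \<longleftrightarrow> u \<in> carrier H" if "\<sigma> \<in> Aut M A" for \<sigma> u
    by (rule definable_group_Aut(1)[OF H that])
  define \<alpha> where "\<alpha> x = inv_into N \<phi> (\<psi> x)" for x
  let ?g = "\<lambda>x. g (\<alpha> x)"
  have \<psi>_closed: "\<psi> x \<in> N" and \<alpha>_closed: "\<alpha> x \<in> N" and \<phi>\<alpha>: "\<phi> (\<alpha> x) = \<psi> x" if "x \<in> N" for x
  proof -
    show *: "\<psi> x \<in> N" using bij(2) that by (rule bij_betwE[THEN bspec])
    show "\<alpha> x \<in> N" "\<phi> (\<alpha> x) = \<psi> x"
      using * bij(1) unfolding \<alpha>_def by (auto simp: bij_betw_def inv_into_into f_inv_into_f)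
  qed
  have g_act: "map \<sigma> (?g x) = ?g (\<Phi> \<sigma> \<otimes> map \<sigma> x \<otimes> inv (\<Phi> \<sigma>))"
    if \<sigma>: "\<sigma> \<in> Aut M A" and x: "x \<in> N" for \<sigma> x
  proof -
    have \<alpha>x: "\<alpha> x \<in> N" by (rule \<alpha>_closed[OF x])
    have "form_cocycle M A ?K g \<sigma> (map \<sigma> (\<alpha> x)) = inv_into N g (map \<sigma> (g (\<alpha> x)))"
      using \<sigma> \<alpha>x act_mem_N[OF \<sigma>] map_act_eq[OF \<sigma> \<alpha>x] by (simp add: form_cocycle_def)
    also have "g \<dots> = map \<sigma> (g (\<alpha> x))"
      using g_bij H_mem[OF \<sigma>] \<alpha>x by (metis bij_betwE bij_betw_inv_into_right)
    finally have 1: "map \<sigma> (g (\<alpha> x)) = g (form_cocycle M A ?K g \<sigma> (map \<sigma> (\<alpha> x)))" by simp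
    have 2: "form_cocycle M A ?K g \<sigma> (map \<sigma> (\<alpha> x)) = inv_into N \<phi> (\<Lambda> \<sigma> (map \<sigma> (\<psi> x)))"
      using \<phi>(2) \<sigma> eval[OF \<sigma> \<alpha>x \<phi>(1)] \<phi>\<alpha>[OF x] by simp
    have "\<Lambda> \<sigma> (map \<sigma> (\<psi> x)) \<in> N" using \<Lambda>_closed[OF \<sigma>] act_mem_N[OF \<sigma>] \<psi>_closed[OF x] by blast
    then have "\<psi> (inv_into N \<psi> (\<Lambda> \<sigma> (map \<sigma> (\<psi> x)))) = \<Lambda> \<sigma> (map \<sigma> (\<psi> x))"
      using bij(2) by (simp add: bij_betw_inv_into_right)
    moreover have "conj_cocycle M A G N \<Phi> \<sigma> (map \<sigma> x) = inv_into N \<psi> (\<Lambda> \<sigma> (map \<sigma> (\<psi> x)))"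
      using \<psi>(2) \<sigma> eval[OF \<sigma> x \<psi>(1)] by simp
    moreover have "conj_cocycle M A G N \<Phi> \<sigma> (map \<sigma> x) = \<Phi> \<sigma> \<otimes> map \<sigma> x \<otimes> inv (\<Phi> \<sigma>)"
      using conj_cocycle_apply[OF \<sigma>] act_mem_N[OF \<sigma>] x by blast
    ultimately have "\<Lambda> \<sigma> (map \<sigma> (\<psi> x)) = \<psi> (\<Phi> \<sigma> \<otimes> map \<sigma> x \<otimes> inv (\<Phi> \<sigma>))" by simp
    then show ?thesis using 1 2 unfolding \<alpha>_def by simp
  qed
  have "?g \<in> iso ?K H"
  proof -
    have \<phi>_iso: "\<phi> \<in> iso ?K ?K" and \<psi>_iso: "\<psi> \<in> iso ?K ?K"
      using \<phi>(1) \<psi>(1) bij by (simp_all add: definable_auts_def auto_def iso_def)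
    have "inv_into (carrier ?K) \<phi> \<in> iso ?K ?K" by (rule K.iso_set_sym[OF \<phi>_iso])
    then have "g \<circ> (inv_into N \<phi> \<circ> \<psi>) \<in> iso ?K H"
      using iso_set_trans[OF iso_set_trans[OF \<psi>_iso] g_iso] by simp
    then show ?thesis by (simp add: \<alpha>_def comp_def)
  qed
  moreover have "definable_map M UNIV N ?g"
  proof -
    have \<phi>_map: "definable_map M UNIV N \<phi>" and \<psi>_map: "definable_map M UNIV N \<psi>"
      using \<phi>(1) \<psi>(1) by (simp_all add: definable_auts_def)
    have "definable_map M UNIV N (inv_into N \<phi>)"
      using definable_map_inv_into[OF \<phi>_map] bij(1) by (simp add: bij_betw_def)
    then show ?thesis
      unfolding \<alpha>_def
      by (intro definable_map_comp[OF g_map] definable_map_comp[OF _ \<psi>_map])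
         (use \<psi>_closed \<alpha>_closed[unfolded \<alpha>_def] in auto)
  qed
  ultimately show thesis using that[OF \<Phi> H, of ?g] g_act by blast
qed

end


section \<open>The fibres of the map to the cohomology of the quotient\<close>

text \<open>
  An isomorphism of \<open>N\<close> with its twisted form, normalised so that its cocycle is conjugation
  by \<open>\<Phi>\<close>.
\<close>

locale twisted_iso = definable_normal_subgroup M A N G
  for M :: "('f, 'r, 'a) fo_structure" and A :: "'a set"
    and N :: "'a list set" and G :: "'a list monoid" (structure) +
  fixes \<Phi> :: "('a \<Rightarrow> 'a) \<Rightarrow> 'a list" and H :: "'a list monoid" and g :: "'a list \<Rightarrow> 'a list"
  assumes \<Phi>_cocycle: "\<Phi> \<in> definable_cocycles M A G"
    and H_definable: "definable_group M A H"
    and g_iso: "g \<in> iso group_N H"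
    and g_definable: "definable_map M UNIV N g"
    and g_act: "\<And>\<sigma> x. \<sigma> \<in> Aut M A \<Longrightarrow> x \<in> N \<Longrightarrow> map \<sigma> (g x) = g (\<Phi> \<sigma> \<otimes> map \<sigma> x \<otimes> inv (\<Phi> \<sigma>))"
begin

text \<open>
  Translation by \<open>\<Phi>\<close>, the substitute for a group structure on the cohomology set: it
  moves the trivial class of \<open>H\<close> to the class of \<open>\<Phi>\<close>.
\<close>

definition untwist :: "(('a \<Rightarrow> 'a) \<Rightarrow> 'a list) \<Rightarrow> ('a \<Rightarrow> 'a) \<Rightarrow> 'a list" where
  "untwist \<Psi> = (\<lambda>\<sigma>\<in>Aut M A. inv_into N g (\<Psi> \<sigma>) \<otimes> \<Phi> \<sigma>)"

lemma g_bij: "bij_betw g N (carrier H)"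
  using g_iso by (simp add: iso_def)

lemma g_mult: "x \<in> N \<Longrightarrow> y \<in> N \<Longrightarrow> g (x \<otimes> y) = g x \<otimes>\<^bsub>H\<^esub> g y"
  using g_iso by (simp add: iso_def hom_def)

lemma g_closed: "x \<in> N \<Longrightarrow> g x \<in> carrier H"
  using g_bij by (auto simp: bij_betw_def)

lemma inv_g_closed: "u \<in> carrier H \<Longrightarrow> inv_into N g u \<in> N"
  using g_bij by (auto simp: bij_betw_def inv_into_into)

lemma g_inv_g: "u \<in> carrier H \<Longrightarrow> g (inv_into N g u) = u"
  using g_bij by (simp add: bij_betw_inv_into_right)

lemma inv_g_g: "x \<in> N \<Longrightarrow> inv_into N g (g x) = x"
  using g_bij by (simp add: bij_betw_inv_into_left)

lemma inv_g_closed_G: "u \<in> carrier H \<Longrightarrow> inv_into N g u \<in> carrier G"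
  by (rule mem_carrier[OF inv_g_closed])

lemma H_group: "group H"
  using H_definable unfolding definable_group_def by blast

lemma \<Phi>_closed: "\<sigma> \<in> Aut M A \<Longrightarrow> \<Phi> \<sigma> \<in> carrier G"
  by (rule cocycle_closed[OF \<Phi>_cocycle])

lemma inv_g_mult:
  assumes "u \<in> carrier H" "v \<in> carrier H"
  shows "inv_into N g (u \<otimes>\<^bsub>H\<^esub> v) = inv_into N g u \<otimes> inv_into N g v"
proof -
  have m: "inv_into N g u \<otimes> inv_into N g v \<in> N"
    using inv_g_closed assms by (intro subgroup.m_closed[OF subgroup_axioms])
  have "g (inv_into N g u \<otimes> inv_into N g v) = u \<otimes>\<^bsub>H\<^esub> v"
    using g_mult[OF inv_g_closed inv_g_closed] g_inv_g assms by simp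
  then show ?thesis using inv_g_g[OF m] by simp
qed

text \<open>
  The assumption \<open>g_act\<close> solved for the inverse of \<open>g\<close>, in the form in which it occurs inside
  products of values of cocycles.
\<close>

lemma inv_g_act:
  assumes \<sigma>: "\<sigma> \<in> Aut M A" and u: "u \<in> carrier H"
  shows "inv_into N g (map \<sigma> u) \<otimes> \<Phi> \<sigma> = \<Phi> \<sigma> \<otimes> map \<sigma> (inv_into N g u)"
proof -
  let ?x = "inv_into N g u"
  have x: "?x \<in> N" by (rule inv_g_closed[OF u])
  then have sx: "map \<sigma> ?x \<in> N" using act_mem_N[OF \<sigma>] by simp
  have "map \<sigma> u = g (\<Phi> \<sigma> \<otimes> map \<sigma> ?x \<otimes> inv (\<Phi> \<sigma>))"
    using g_act[OF \<sigma> x] g_inv_g[OF u] by simp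
  then have "inv_into N g (map \<sigma> u) = \<Phi> \<sigma> \<otimes> map \<sigma> ?x \<otimes> inv (\<Phi> \<sigma>)"
    using inv_g_g inv_op_closed2[OF \<Phi>_closed[OF \<sigma>] sx] by simp
  then show ?thesis using \<Phi>_closed[OF \<sigma>] mem_carrier[OF sx] by (simp add: m_assoc)
qed

lemma untwist_cocycle:
  assumes \<Psi>: "\<Psi> \<in> definable_cocycles M A H"
  shows "untwist \<Psi> \<in> definable_cocycles M A G"
  unfolding definable_cocycles_iff
proof (intro conjI ballI)
  note \<Psi>_closed = cocycle_closed[OF \<Psi>]
  show "untwist \<Psi> \<in> Aut M A \<rightarrow>\<^sub>E carrier G"
    using inv_g_closed_G[OF \<Psi>_closed] \<Phi>_closed by (auto simp: untwist_def)
  show "untwist \<Psi> (\<sigma> \<circ> \<tau>) = untwist \<Psi> \<sigma> \<otimes> map \<sigma> (untwist \<Psi> \<tau>)"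
    if \<sigma>: "\<sigma> \<in> Aut M A" and \<tau>: "\<tau> \<in> Aut M A" for \<sigma> \<tau>
  proof -
    interpret s: group_hom G G "map \<sigma>" by (rule act_hom[OF \<sigma>])
    let ?x = "inv_into N g (\<Psi> \<sigma>)" and ?y = "inv_into N g (\<Psi> \<tau>)"
    let ?z = "inv_into N g (map \<sigma> (\<Psi> \<tau>))"
    have s\<Psi>: "map \<sigma> (\<Psi> \<tau>) \<in> carrier H"
      using definable_group_Aut(1)[OF H_definable \<sigma>] \<Psi>_closed[OF \<tau>] by simp
    have c: "?x \<in> carrier G" "?y \<in> carrier G" "?z \<in> carrier G" "\<Phi> \<sigma> \<in> carrier G" "\<Phi> \<tau> \<in> carrier G"
      using inv_g_closed_G \<Psi>_closed \<sigma> \<tau> s\<Psi> \<Phi>_closed by blast+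
    have "untwist \<Psi> (\<sigma> \<circ> \<tau>) = inv_into N g (\<Psi> \<sigma> \<otimes>\<^bsub>H\<^esub> map \<sigma> (\<Psi> \<tau>)) \<otimes> (\<Phi> \<sigma> \<otimes> map \<sigma> (\<Phi> \<tau>))"
      using comp_in_Aut[OF \<sigma> \<tau>] cocycle_comp[OF \<Psi> \<sigma> \<tau>] cocycle_comp[OF \<Phi>_cocycle \<sigma> \<tau>]
      by (simp add: untwist_def)
    also have "\<dots> = ?x \<otimes> (?z \<otimes> \<Phi> \<sigma>) \<otimes> map \<sigma> (\<Phi> \<tau>)"
      using inv_g_mult[OF \<Psi>_closed[OF \<sigma>] s\<Psi>] c by (simp add: m_assoc)
    also have "\<dots> = (?x \<otimes> \<Phi> \<sigma>) \<otimes> map \<sigma> (?y \<otimes> \<Phi> \<tau>)"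
      unfolding inv_g_act[OF \<sigma> \<Psi>_closed[OF \<tau>]] using c by (simp add: m_assoc)
    finally show ?thesis using \<sigma> \<tau> by (simp add: untwist_def)
  qed
  show "\<exists>a k f. definable_fun M (length a) k f \<and> (\<forall>\<sigma>\<in>Aut M A. untwist \<Psi> \<sigma> = f (map \<sigma> a))"
  proof -
    obtain n mu iv where n: "definable M UNIV n (carrier G)"
      and mu: "definable_fun M (n + n) n mu" "\<forall>x\<in>carrier G. \<forall>y\<in>carrier G. mu (x @ y) = x \<otimes> y"
      by (rule definable_group_funs[OF group_definable_UNIV])
    have "definable_map M UNIV (carrier H) (inv_into N g)"
      using definable_map_inv_into[OF g_definable] g_bij by (simp add: bij_betw_def)
    then obtain m k \<alpha> where \<alpha>: "definable M UNIV m (carrier H)" "definable_fun M m k \<alpha>"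
      "\<forall>u\<in>carrier H. \<alpha> u = inv_into N g u"
      by (rule definable_map_total)
    have one: "\<Psi> id \<in> carrier H" by (rule \<Psi>_closed[OF id_in_Aut])
    have k: "k = n"
      using definable_fun_length[OF \<alpha>(2) definable_length[OF \<alpha>(1) one]] \<alpha>(3) one
        definable_length[OF n inv_g_closed_G[OF one]] by simp
    obtain a f where f: "definable_fun M (length a) m f" "\<forall>\<sigma>\<in>Aut M A. \<Psi> \<sigma> = f (map \<sigma> a)"
      by (rule cocycle_fun[OF \<Psi> \<alpha>(1)])
    obtain b h where h: "definable_fun M (length b) n h" "\<forall>\<sigma>\<in>Aut M A. \<Phi> \<sigma> = h (map \<sigma> b)"
      by (rule cocycle_fun[OF \<Phi>_cocycle n])
    let ?l = "length a"
    let ?F = "\<lambda>z. mu (\<alpha> (f (take ?l z)) @ h (drop ?l z))"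
    have "definable_fun M (?l + length b) n ?F"
      by (intro definable_fun_comp[OF mu(1)] definable_fun_append definable_fun_comp[OF \<alpha>(2)[unfolded k]]
            definable_fun_comp[OF f(1)] definable_fun_comp[OF h(1)]) (rule definable_fun_intros)+
    then have "definable_fun M (length (a @ b)) n ?F" by simp
    moreover have "untwist \<Psi> \<sigma> = ?F (map \<sigma> (a @ b))" if \<sigma>: "\<sigma> \<in> Aut M A" for \<sigma>
    proof -
      have "?F (map \<sigma> (a @ b)) = mu (\<alpha> (f (map \<sigma> a)) @ h (map \<sigma> b))" by simp
      also have "\<dots> = mu (\<alpha> (\<Psi> \<sigma>) @ \<Phi> \<sigma>)" using f(2) h(2) \<sigma> by metis
      also have "\<dots> = inv_into N g (\<Psi> \<sigma>) \<otimes> \<Phi> \<sigma>"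
        using \<alpha>(3) mu(2) \<Psi>_closed[OF \<sigma>] inv_g_closed_G[OF \<Psi>_closed[OF \<sigma>]] \<Phi>_closed[OF \<sigma>] by simp
      finally show ?thesis using \<sigma> by (simp add: untwist_def)
    qed
    ultimately show ?thesis by blast
  qed
qed

lemma untwist_cohomologous:
  assumes "(\<Psi>, \<Psi>') \<in> cohomologous M A H"
  shows "(untwist \<Psi>, untwist \<Psi>') \<in> cohomologous M A G"
proof -
  interpret H: group H by (rule H_group)
  obtain b where \<Psi>: "\<Psi> \<in> definable_cocycles M A H" "\<Psi>' \<in> definable_cocycles M A H"
    and b: "b \<in> carrier H" "\<forall>\<sigma>\<in>Aut M A. \<Psi>' \<sigma> = inv\<^bsub>H\<^esub> b \<otimes>\<^bsub>H\<^esub> \<Psi> \<sigma> \<otimes>\<^bsub>H\<^esub> map \<sigma> b"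
    using assms unfolding cohomologous_def by blast
  let ?c = "inv_into N g b"
  have c: "?c \<in> carrier G" by (rule inv_g_closed_G[OF b(1)])
  have "inv_into N g \<one>\<^bsub>H\<^esub> \<otimes> inv_into N g \<one>\<^bsub>H\<^esub> = inv_into N g \<one>\<^bsub>H\<^esub>"
    using inv_g_mult[OF H.one_closed H.one_closed] by simp
  then have one: "inv_into N g \<one>\<^bsub>H\<^esub> = \<one>"
    using inv_g_closed_G[OF H.one_closed] by (metis r_cancel_one')
  have inv: "inv_into N g (inv\<^bsub>H\<^esub> b) = inv ?c"
  proof -
    have "inv_into N g (inv\<^bsub>H\<^esub> b) \<otimes> ?c = \<one>"
      using inv_g_mult[OF H.inv_closed[OF b(1)] b(1)] b(1) one by simp
    then show ?thesis using inv_equality[OF _ c inv_g_closed_G[OF H.inv_closed[OF b(1)]]] by simp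
  qed
  have "untwist \<Psi>' \<sigma> = inv ?c \<otimes> untwist \<Psi> \<sigma> \<otimes> map \<sigma> ?c" if \<sigma>: "\<sigma> \<in> Aut M A" for \<sigma>
  proof -
    have P: "\<Psi> \<sigma> \<in> carrier H" by (rule cocycle_closed[OF \<Psi>(1) \<sigma>])
    have sb: "map \<sigma> b \<in> carrier H" using definable_group_Aut(1)[OF H_definable \<sigma>] b(1) by simp
    have sc: "map \<sigma> ?c \<in> carrier G" using act_mem[OF \<sigma>] c by simp
    have cl: "inv_into N g (\<Psi> \<sigma>) \<in> carrier G" "inv_into N g (map \<sigma> b) \<in> carrier G" "\<Phi> \<sigma> \<in> carrier G"
      using inv_g_closed_G P sb \<Phi>_closed[OF \<sigma>] by blast+
    have "inv_into N g (\<Psi>' \<sigma>) = inv ?c \<otimes> inv_into N g (\<Psi> \<sigma>) \<otimes> inv_into N g (map \<sigma> b)"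
      using b(2) \<sigma> inv_g_mult P sb b(1) inv by simp
    then have "untwist \<Psi>' \<sigma> =
        inv ?c \<otimes> inv_into N g (\<Psi> \<sigma>) \<otimes> (inv_into N g (map \<sigma> b) \<otimes> \<Phi> \<sigma>)"
      using \<sigma> c cl by (simp add: untwist_def m_assoc)
    then show ?thesis
      unfolding inv_g_act[OF \<sigma> b(1)] using \<sigma> c cl sc by (simp add: untwist_def m_assoc)
  qed
  then show ?thesis
    unfolding cohomologous_def using untwist_cocycle \<Psi> c by blast
qed

text \<open>
  The preimage has to be \<open>g (\<Theta> \<sigma> \<cdot> (\<Phi> \<sigma>)\<inverse>)\<close>.  It is a cocycle because
  \<open>\<Theta> (\<sigma> \<tau>) (\<Phi> (\<sigma> \<tau>))\<inverse>\<close> is the product of \<open>\<Theta> \<sigma> (\<Phi> \<sigma>)\<inverse>\<close> and the \<open>\<Phi> \<sigma>\<close>-conjugate of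
  \<open>\<sigma> (\<Theta> \<tau> (\<Phi> \<tau>)\<inverse>)\<close>, and \<open>g\<close> turns that conjugate into the action of \<open>\<sigma>\<close> on \<open>H\<close>.
\<close>

lemma untwist_surj:
  assumes \<Theta>: "\<Theta> \<in> definable_cocycles M A G"
    and mem: "\<And>\<sigma>. \<sigma> \<in> Aut M A \<Longrightarrow> \<Theta> \<sigma> \<otimes> inv (\<Phi> \<sigma>) \<in> N"
  obtains \<Psi> where "\<Psi> \<in> definable_cocycles M A H" "untwist \<Psi> = \<Theta>"
proof -
  note \<Theta>_closed = cocycle_closed[OF \<Theta>]
  define \<Psi> where "\<Psi> = (\<lambda>\<sigma>\<in>Aut M A. g (\<Theta> \<sigma> \<otimes> inv (\<Phi> \<sigma>)))"
  have "\<Psi> \<in> definable_cocycles M A H"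
    unfolding definable_cocycles_iff
  proof (intro conjI ballI)
    show "\<Psi> \<in> Aut M A \<rightarrow>\<^sub>E carrier H" using g_closed mem by (auto simp: \<Psi>_def)
    show "\<Psi> (\<sigma> \<circ> \<tau>) = \<Psi> \<sigma> \<otimes>\<^bsub>H\<^esub> map \<sigma> (\<Psi> \<tau>)" if \<sigma>: "\<sigma> \<in> Aut M A" and \<tau>: "\<tau> \<in> Aut M A" for \<sigma> \<tau>
    proof -
      interpret s: group_hom G G "map \<sigma>" by (rule act_hom[OF \<sigma>])
      have c: "\<Theta> \<sigma> \<in> carrier G" "\<Theta> \<tau> \<in> carrier G" "\<Phi> \<sigma> \<in> carrier G" "\<Phi> \<tau> \<in> carrier G"
        using \<Theta>_closed \<Phi>_closed \<sigma> \<tau> by blast+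
      let ?x = "\<Theta> \<sigma> \<otimes> inv (\<Phi> \<sigma>)" and ?y = "\<Theta> \<tau> \<otimes> inv (\<Phi> \<tau>)"
      let ?z = "\<Phi> \<sigma> \<otimes> map \<sigma> ?y \<otimes> inv (\<Phi> \<sigma>)"
      have z: "?z \<in> N" using inv_op_closed2[OF c(3)] act_mem_N[OF \<sigma>] mem[OF \<tau>] by blast
      have "\<Theta> (\<sigma> \<circ> \<tau>) \<otimes> inv (\<Phi> (\<sigma> \<circ> \<tau>)) = ?x \<otimes> ?z"
        unfolding cocycle_comp[OF \<Theta> \<sigma> \<tau>] cocycle_comp[OF \<Phi>_cocycle \<sigma> \<tau>]
        using c by (simp add: m_assoc inv_mult_group) (simp add: m_assoc[symmetric])
      then have "\<Psi> (\<sigma> \<circ> \<tau>) = g ?x \<otimes>\<^bsub>H\<^esub> g ?z"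
        using comp_in_Aut[OF \<sigma> \<tau>] g_mult[OF mem[OF \<sigma>] z] by (simp add: \<Psi>_def)
      also have "g ?z = map \<sigma> (g ?y)" using g_act[OF \<sigma> mem[OF \<tau>]] by simp
      finally have "\<Psi> (\<sigma> \<circ> \<tau>) = g ?x \<otimes>\<^bsub>H\<^esub> map \<sigma> (g ?y)" .
      moreover have "\<Psi> \<sigma> = g ?x" "\<Psi> \<tau> = g ?y" using \<sigma> \<tau> by (simp_all add: \<Psi>_def)
      ultimately show ?thesis by (simp only:)
    qed
    show "\<exists>a k f. definable_fun M (length a) k f \<and> (\<forall>\<sigma>\<in>Aut M A. \<Psi> \<sigma> = f (map \<sigma> a))"
    proof -
      obtain n mu iv where n: "definable M UNIV n (carrier G)"
        and mu: "definable_fun M (n + n) n mu" "\<forall>x\<in>carrier G. \<forall>y\<in>carrier G. mu (x @ y) = x \<otimes> y"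
        and iv: "definable_fun M n n iv" "\<forall>x\<in>carrier G. iv x = inv x"
        by (rule definable_group_funs[OF group_definable_UNIV])
      obtain m k \<gamma> where \<gamma>: "definable M UNIV m N" "definable_fun M m k \<gamma>" "\<forall>x\<in>N. \<gamma> x = g x"
        by (rule definable_map_total[OF g_definable])
      have m: "m = n"
        using definable_length[OF \<gamma>(1) subgroup.one_closed[OF subgroup_axioms]]
          definable_length[OF n one_closed] by simp
      obtain a f where f: "definable_fun M (length a) n f" "\<forall>\<sigma>\<in>Aut M A. \<Theta> \<sigma> = f (map \<sigma> a)"
        by (rule cocycle_fun[OF \<Theta> n])
      obtain b h where h: "definable_fun M (length b) n h" "\<forall>\<sigma>\<in>Aut M A. \<Phi> \<sigma> = h (map \<sigma> b)"
        by (rule cocycle_fun[OF \<Phi>_cocycle n])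
      let ?l = "length a"
      let ?F = "\<lambda>z. \<gamma> (mu (f (take ?l z) @ iv (h (drop ?l z))))"
      have "definable_fun M (?l + length b) k ?F"
        by (intro definable_fun_comp[OF \<gamma>(2)[unfolded m]] definable_fun_comp[OF mu(1)]
              definable_fun_append definable_fun_comp[OF iv(1)]
              definable_fun_comp[OF f(1)] definable_fun_comp[OF h(1)]) (rule definable_fun_intros)+
      then have "definable_fun M (length (a @ b)) k ?F" by simp
      moreover have "\<Psi> \<sigma> = ?F (map \<sigma> (a @ b))" if \<sigma>: "\<sigma> \<in> Aut M A" for \<sigma>
      proof -
        have "?F (map \<sigma> (a @ b)) = \<gamma> (mu (f (map \<sigma> a) @ iv (h (map \<sigma> b))))" by simp
        also have "\<dots> = \<gamma> (mu (\<Theta> \<sigma> @ iv (\<Phi> \<sigma>)))" using f(2) h(2) \<sigma> by metis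
        also have "\<dots> = g (\<Theta> \<sigma> \<otimes> inv (\<Phi> \<sigma>))"
          using \<gamma>(3) mu(2) iv(2) \<Theta>_closed[OF \<sigma>] \<Phi>_closed[OF \<sigma>] mem[OF \<sigma>] by simp
        finally show ?thesis using \<sigma> by (simp add: \<Psi>_def)
      qed
      ultimately show ?thesis by blast
    qed
  qed
  moreover have "untwist \<Psi> = \<Theta>"
  proof (rule extensionalityI[of _ "Aut M A"])
    show "untwist \<Psi> \<in> extensional (Aut M A)" by (simp add: untwist_def)
    show "\<Theta> \<in> extensional (Aut M A)" using \<Theta> unfolding definable_cocycles_def by (simp add: PiE_def)
    show "untwist \<Psi> \<sigma> = \<Theta> \<sigma>" if \<sigma>: "\<sigma> \<in> Aut M A" for \<sigma>
      using \<sigma> inv_g_g[OF mem[OF \<sigma>]] \<Theta>_closed[OF \<sigma>] \<Phi>_closed[OF \<sigma>]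
      by (simp add: untwist_def \<Psi>_def m_assoc)
  qed
  ultimately show thesis by (rule that)
qed

end

context definable_normal_subgroup
begin

text \<open>
  If \<open>\<Theta> \<sigma> = f (\<sigma> a)\<close>, then the new cocycle is a definable function of the conjugate of \<open>a @ b\<close>.
\<close>

lemma cohomologous_by_element:
  assumes \<Theta>: "\<Theta> \<in> definable_cocycles M A G" and b: "b \<in> carrier G"
  shows "(\<Theta>, \<lambda>\<sigma>\<in>Aut M A. inv b \<otimes> \<Theta> \<sigma> \<otimes> map \<sigma> b) \<in> cohomologous M A G"
proof -
  note \<Theta>_closed = cocycle_closed[OF \<Theta>]
  let ?\<Theta> = "\<lambda>\<sigma>\<in>Aut M A. inv b \<otimes> \<Theta> \<sigma> \<otimes> map \<sigma> b"
  have sb: "map \<sigma> b \<in> carrier G" if "\<sigma> \<in> Aut M A" for \<sigma> using act_mem[OF that] b by simp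
  have "?\<Theta> \<in> definable_cocycles M A G"
    unfolding definable_cocycles_iff
  proof (intro conjI ballI)
    show "?\<Theta> \<in> Aut M A \<rightarrow>\<^sub>E carrier G" using \<Theta>_closed b sb by auto
    show "?\<Theta> (\<sigma> \<circ> \<tau>) = ?\<Theta> \<sigma> \<otimes> map \<sigma> (?\<Theta> \<tau>)" if \<sigma>: "\<sigma> \<in> Aut M A" and \<tau>: "\<tau> \<in> Aut M A" for \<sigma> \<tau>
    proof -
      interpret s: group_hom G G "map \<sigma>" by (rule act_hom[OF \<sigma>])
      have cl: "\<Theta> \<sigma> \<in> carrier G" "\<Theta> \<tau> \<in> carrier G" "map \<tau> b \<in> carrier G"
        using \<Theta>_closed sb \<sigma> \<tau> by blast+
      have "map \<sigma> (inv b \<otimes> \<Theta> \<tau> \<otimes> map \<tau> b) = inv (map \<sigma> b) \<otimes> map \<sigma> (\<Theta> \<tau>) \<otimes> map \<sigma> (map \<tau> b)"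
        using cl b by (simp del: map_map)
      moreover have "map \<sigma> (map \<tau> b) \<in> carrier G" using cl(3) by (rule s.hom_closed)
      moreover have "map (\<sigma> \<circ> \<tau>) b = map \<sigma> (map \<tau> b)" by simp
      moreover have "inv b \<otimes> (\<Theta> \<sigma> \<otimes> map \<sigma> (\<Theta> \<tau>)) \<otimes> w =
          (inv b \<otimes> \<Theta> \<sigma> \<otimes> map \<sigma> b) \<otimes> (inv (map \<sigma> b) \<otimes> map \<sigma> (\<Theta> \<tau>) \<otimes> w)" if "w \<in> carrier G" for w
        using cl b that by (simp add: m_assoc) (simp add: m_assoc[symmetric])
      ultimately show ?thesis
        using \<sigma> \<tau> comp_in_Aut[OF \<sigma> \<tau>] cocycle_comp[OF \<Theta> \<sigma> \<tau>] by (simp del: map_map)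
    qed
    show "\<exists>a k f. definable_fun M (length a) k f \<and> (\<forall>\<sigma>\<in>Aut M A. ?\<Theta> \<sigma> = f (map \<sigma> a))"
    proof -
      obtain n mu iv where n: "definable M UNIV n (carrier G)"
        and mu: "definable_fun M (n + n) n mu" "\<forall>x\<in>carrier G. \<forall>y\<in>carrier G. mu (x @ y) = x \<otimes> y"
        by (rule definable_group_funs[OF group_definable_UNIV])
      obtain a f where f: "definable_fun M (length a) n f" "\<forall>\<sigma>\<in>Aut M A. \<Theta> \<sigma> = f (map \<sigma> a)"
        by (rule cocycle_fun[OF \<Theta> n])
      have lb: "length b = n" by (rule definable_length[OF n b])
      let ?l = "length a"
      let ?F = "\<lambda>z. mu (mu (inv b @ f (take ?l z)) @ drop ?l z)"
      have const: "definable_fun M (?l + n) n (\<lambda>x. inv b)"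
        using definable_fun_const[of M "?l + n" "inv b"] definable_length[OF n inv_closed[OF b]] by simp
      have "definable_fun M (?l + n) n ?F"
        by (intro definable_fun_comp[OF mu(1)] definable_fun_append const definable_fun_comp[OF f(1)])
           (rule definable_fun_intros)+
      then have "definable_fun M (length (a @ b)) n ?F" using lb by simp
      moreover have "?\<Theta> \<sigma> = ?F (map \<sigma> (a @ b))" if \<sigma>: "\<sigma> \<in> Aut M A" for \<sigma>
      proof -
        have "?F (map \<sigma> (a @ b)) = mu (mu (inv b @ f (map \<sigma> a)) @ map \<sigma> b)" by simp
        also have "\<dots> = mu (mu (inv b @ \<Theta> \<sigma>) @ map \<sigma> b)" using f(2) \<sigma> by metis
        also have "\<dots> = inv b \<otimes> \<Theta> \<sigma> \<otimes> map \<sigma> b" using mu(2) \<Theta>_closed[OF \<sigma>] b sb[OF \<sigma>] by simp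
        finally show ?thesis using \<sigma> by simp
      qed
      ultimately show ?thesis by blast
    qed
  qed
  moreover have "\<forall>\<sigma>\<in>Aut M A. ?\<Theta> \<sigma> = inv b \<otimes> \<Theta> \<sigma> \<otimes> map \<sigma> b" by simp
  ultimately show ?thesis unfolding cohomologous_def using \<Theta> b by blast
qed

end

locale definable_quotient_map = definable_normal_subgroup M A N G
  for M :: "('f, 'r, 'a) fo_structure" and A :: "'a set"
    and N :: "'a list set" and G :: "'a list monoid" (structure) +
  fixes Q :: "'a list monoid" and p :: "'a list \<Rightarrow> 'a list"
  assumes Q_definable: "definable_group M A Q"
    and p_hom: "p \<in> hom G Q" and p_surj: "p ` carrier G = carrier Q"
    and p_kernel: "kernel G Q p = N" and p_definable: "definable_map M A (carrier G) p"
begin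

definition push :: "(('a \<Rightarrow> 'a) \<Rightarrow> 'a list) \<Rightarrow> ('a \<Rightarrow> 'a) \<Rightarrow> 'a list" where
  "push \<Phi> = (\<lambda>\<sigma>\<in>Aut M A. p (\<Phi> \<sigma>))"

lemma p_group_hom: "group_hom G Q p"
  using Q_definable p_hom unfolding definable_group_def
  by (intro group_hom.intro group_hom_axioms.intro group_axioms) auto

lemma p_act: "\<sigma> \<in> Aut M A \<Longrightarrow> x \<in> carrier G \<Longrightarrow> map \<sigma> (p x) = p (map \<sigma> x)"
  using definable_map_Aut(2)[OF p_definable] by simp

lemma push_cocycle:
  assumes \<Phi>: "\<Phi> \<in> definable_cocycles M A G"
  shows "push \<Phi> \<in> definable_cocycles M A Q"
  unfolding definable_cocycles_iff
proof (intro conjI ballI)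
  note \<Phi>_closed = cocycle_closed[OF \<Phi>]
  interpret p: group_hom G Q p by (rule p_group_hom)
  show "push \<Phi> \<in> Aut M A \<rightarrow>\<^sub>E carrier Q" using \<Phi>_closed by (auto simp: push_def)
  show "push \<Phi> (\<sigma> \<circ> \<tau>) = push \<Phi> \<sigma> \<otimes>\<^bsub>Q\<^esub> map \<sigma> (push \<Phi> \<tau>)"
    if \<sigma>: "\<sigma> \<in> Aut M A" and \<tau>: "\<tau> \<in> Aut M A" for \<sigma> \<tau>
  proof -
    have "map \<sigma> (\<Phi> \<tau>) \<in> carrier G" using act_mem[OF \<sigma>] \<Phi>_closed[OF \<tau>] by simp
    then show ?thesis
      using \<sigma> \<tau> comp_in_Aut[OF \<sigma> \<tau>] cocycle_comp[OF \<Phi> \<sigma> \<tau>] \<Phi>_closed p_act[OF \<sigma> \<Phi>_closed[OF \<tau>]]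
      by (simp add: push_def)
  qed
  show "\<exists>a k f. definable_fun M (length a) k f \<and> (\<forall>\<sigma>\<in>Aut M A. push \<Phi> \<sigma> = f (map \<sigma> a))"
  proof -
    obtain m k P where P: "definable M UNIV m (carrier G)" "definable_fun M m k P"
      "\<forall>x\<in>carrier G. P x = p x"
      by (rule definable_map_total[OF definable_map_mono[OF p_definable subset_UNIV]])
    obtain a f where f: "definable_fun M (length a) m f" "\<forall>\<sigma>\<in>Aut M A. \<Phi> \<sigma> = f (map \<sigma> a)"
      by (rule cocycle_fun[OF \<Phi> P(1)])
    have "push \<Phi> \<sigma> = P (f (map \<sigma> a))" if "\<sigma> \<in> Aut M A" for \<sigma>
      using that f(2) P(3) \<Phi>_closed[OF that] by (simp add: push_def)
    then show ?thesis using definable_fun_comp[OF P(2) f(1)] by blast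
  qed
qed

lemma push_cohomologous:
  assumes "(\<Phi>, \<Phi>') \<in> cohomologous M A G"
  shows "(push \<Phi>, push \<Phi>') \<in> cohomologous M A Q"
proof -
  interpret p: group_hom G Q p by (rule p_group_hom)
  obtain b where \<Phi>: "\<Phi> \<in> definable_cocycles M A G" "\<Phi>' \<in> definable_cocycles M A G"
    and b: "b \<in> carrier G" "\<forall>\<sigma>\<in>Aut M A. \<Phi>' \<sigma> = inv b \<otimes> \<Phi> \<sigma> \<otimes> map \<sigma> b"
    using assms unfolding cohomologous_def by blast
  have "push \<Phi>' \<sigma> = inv\<^bsub>Q\<^esub> (p b) \<otimes>\<^bsub>Q\<^esub> push \<Phi> \<sigma> \<otimes>\<^bsub>Q\<^esub> map \<sigma> (p b)" if \<sigma>: "\<sigma> \<in> Aut M A" for \<sigma>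
  proof -
    have "map \<sigma> b \<in> carrier G" using act_mem[OF \<sigma>] b(1) by simp
    then show ?thesis
      using b \<sigma> cocycle_closed[OF \<Phi>(1) \<sigma>] p_act[OF \<sigma> b(1)] by (simp add: push_def)
  qed
  then show ?thesis
    unfolding cohomologous_def using push_cocycle[OF \<Phi>(1)] push_cocycle[OF \<Phi>(2)] p.hom_closed[OF b(1)]
    by blast
qed

text \<open>
  An element of \<open>Q\<close> that witnesses cohomology lifts to some \<open>b\<close> in \<open>G\<close>.  Changing \<open>\<Theta>\<close> by \<open>b\<close> makes
  its image equal to that of \<open>\<Phi>\<close>.
\<close>

lemma push_fibre:
  assumes \<Theta>: "\<Theta> \<in> definable_cocycles M A G" and \<Phi>: "\<Phi> \<in> definable_cocycles M A G"
    and coh: "(push \<Theta>, push \<Phi>) \<in> cohomologous M A Q"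
  obtains \<Theta>' where "(\<Theta>, \<Theta>') \<in> cohomologous M A G"
    "\<And>\<sigma>. \<sigma> \<in> Aut M A \<Longrightarrow> \<Theta>' \<sigma> \<otimes> inv (\<Phi> \<sigma>) \<in> N"
proof -
  interpret p: group_hom G Q p by (rule p_group_hom)
  obtain c where c: "c \<in> carrier Q"
    "\<forall>\<sigma>\<in>Aut M A. push \<Phi> \<sigma> = inv\<^bsub>Q\<^esub> c \<otimes>\<^bsub>Q\<^esub> push \<Theta> \<sigma> \<otimes>\<^bsub>Q\<^esub> map \<sigma> c"
    using coh unfolding cohomologous_def by blast
  obtain b where b: "b \<in> carrier G" "c = p b" using c(1) p_surj by blast
  let ?\<Theta> = "\<lambda>\<sigma>\<in>Aut M A. inv b \<otimes> \<Theta> \<sigma> \<otimes> map \<sigma> b"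
  have "?\<Theta> \<sigma> \<otimes> inv (\<Phi> \<sigma>) \<in> N" if \<sigma>: "\<sigma> \<in> Aut M A" for \<sigma>
  proof -
    have cl: "map \<sigma> b \<in> carrier G" "\<Theta> \<sigma> \<in> carrier G" "\<Phi> \<sigma> \<in> carrier G"
      using act_mem[OF \<sigma>] b(1) cocycle_closed[OF \<Theta> \<sigma>] cocycle_closed[OF \<Phi> \<sigma>] by simp_all
    have "p (\<Phi> \<sigma>) = p (inv b \<otimes> \<Theta> \<sigma> \<otimes> map \<sigma> b)"
      using c(2) \<sigma> b cl p_act[OF \<sigma> b(1)] by (simp add: push_def)
    then have "p (inv b \<otimes> \<Theta> \<sigma> \<otimes> map \<sigma> b \<otimes> inv (\<Phi> \<sigma>)) = p (\<Phi> \<sigma>) \<otimes>\<^bsub>Q\<^esub> inv\<^bsub>Q\<^esub> (p (\<Phi> \<sigma>))"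
      using cl b(1) by simp
    also have "\<dots> = \<one>\<^bsub>Q\<^esub>" using cl(3) by simp
    finally have "inv b \<otimes> \<Theta> \<sigma> \<otimes> map \<sigma> b \<otimes> inv (\<Phi> \<sigma>) \<in> kernel G Q p"
      using cl b(1) by (simp add: kernel_def)
    then show ?thesis using \<sigma> unfolding p_kernel by simp
  qed
  then show thesis using cohomologous_by_element[OF \<Theta> b(1)] by (rule that[rotated])
qed

end

section \<open>Bounding the cohomology of an extension\<close>

text \<open>
  Every class in the fibre contains a cocycle of the form \<open>untwist \<Psi>\<close>, and its class depends only
  on that of \<open>\<Psi>\<close>.  So the fibre is covered by the cohomology of the twisted form at any one of its
  points.
\<close>

lemma (in definable_quotient_map) card_H1_fibre:
  assumes EI: "eliminates_imaginaries M"
    and q: "q \<in> H1 M A Q"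
    and bound: "\<And>\<mu>. \<mu> \<in> H1 M A G \<Longrightarrow> |H1 M A (twisted_form M A G N \<mu>)| \<le>o \<kappa>"
    and \<mu>0: "\<mu>0 \<in> H1 M A G" "\<Phi>0 \<in> \<mu>0" "push \<Phi>0 \<in> q"
  shows "|{\<mu> \<in> H1 M A G. \<exists>\<Theta>\<in>\<mu>. push \<Theta> \<in> q}| \<le>o \<kappa>"
proof -
  note eqG = cohomologous_equiv[OF group_definable]
  note eqQ = cohomologous_equiv[OF Q_definable]
  have sub: "\<mu> \<subseteq> definable_cocycles M A G" if "\<mu> \<in> H1 M A G" for \<mu>
    using in_quotient_imp_subset[OF eqG] that unfolding H1_def by blast
  let ?H = "twisted_form M A G N \<mu>0"
  have "\<exists>H. is_twisted_form M A G N \<mu>0 H"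
    by (rule twisted_form_exists[OF EI subsetD[OF sub[OF \<mu>0(1)] \<mu>0(2)] \<mu>0(2)])
  then have "is_twisted_form M A G N \<mu>0 ?H" unfolding twisted_form_def by (rule someI_ex)
  then obtain \<Phi> g where \<Phi>: "\<Phi> \<in> \<mu>0"
    and g: "definable_group M A ?H" "g \<in> iso group_N ?H" "definable_map M UNIV N g"
      "\<forall>\<sigma>\<in>Aut M A. \<forall>x\<in>N. map \<sigma> (g x) = g (\<Phi> \<sigma> \<otimes> map \<sigma> x \<otimes> inv (\<Phi> \<sigma>))"
    using sub[OF \<mu>0(1)] by (rule twisted_form_iso)
  have \<Phi>_coc: "\<Phi> \<in> definable_cocycles M A G" using sub[OF \<mu>0(1)] \<Phi> by blast
  interpret twisted_iso M A N G \<Phi> ?H g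
    by unfold_locales (use \<Phi>_coc g in auto)
  note eqH = cohomologous_equiv[OF H_definable]
  have "(\<Phi>0, \<Phi>) \<in> cohomologous M A G"
    using quotient_eq_iff[OF eqG] \<mu>0(1,2) \<Phi> unfolding H1_def by blast
  then have "(push \<Phi>0, push \<Phi>) \<in> cohomologous M A Q" by (rule push_cohomologous)
  then have push\<Phi>: "push \<Phi> \<in> q" using in_quotient_imp_closed[OF eqQ] q \<mu>0(3) unfolding H1_def by blast
  let ?R = "\<lambda>\<nu>. cohomologous M A G `` {untwist (SOME \<Psi>. \<Psi> \<in> \<nu>)}"
  have "\<mu> \<in> ?R ` H1 M A ?H" if \<mu>: "\<mu> \<in> H1 M A G" and \<Theta>: "\<Theta> \<in> \<mu>" "push \<Theta> \<in> q" for \<mu> \<Theta>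
  proof -
    have "(push \<Theta>, push \<Phi>) \<in> cohomologous M A Q"
      using quotient_eq_iff[OF eqQ] q \<Theta>(2) push\<Phi> unfolding H1_def by blast
    then obtain \<Theta>' where \<Theta>': "(\<Theta>, \<Theta>') \<in> cohomologous M A G"
      "\<And>\<sigma>. \<sigma> \<in> Aut M A \<Longrightarrow> \<Theta>' \<sigma> \<otimes> inv (\<Phi> \<sigma>) \<in> N"
      using push_fibre[OF subsetD[OF sub[OF \<mu>] \<Theta>(1)] \<Phi>_coc] by blast
    have "\<Theta>' \<in> definable_cocycles M A G" using \<Theta>'(1) unfolding cohomologous_def by blast
    then obtain \<Psi> where \<Psi>: "\<Psi> \<in> definable_cocycles M A ?H" "untwist \<Psi> = \<Theta>'"
      using \<Theta>'(2) by (rule untwist_surj)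
    let ?\<nu> = "cohomologous M A ?H `` {\<Psi>}"
    have \<nu>: "?\<nu> \<in> H1 M A ?H" unfolding H1_def by (rule quotientI[OF \<Psi>(1)])
    have "\<Psi> \<in> ?\<nu>" by (rule equiv_class_self[OF eqH \<Psi>(1)])
    then have "(SOME \<Psi>. \<Psi> \<in> ?\<nu>) \<in> ?\<nu>" by (rule someI[where P = "\<lambda>\<Psi>. \<Psi> \<in> ?\<nu>"])
    then have "(\<Psi>, SOME \<Psi>. \<Psi> \<in> ?\<nu>) \<in> cohomologous M A ?H" by simp
    then have "(untwist \<Psi>, untwist (SOME \<Psi>. \<Psi> \<in> ?\<nu>)) \<in> cohomologous M A G"
      by (rule untwist_cohomologous)
    then have "(\<Theta>, untwist (SOME \<Psi>. \<Psi> \<in> ?\<nu>)) \<in> cohomologous M A G"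
      using \<Theta>'(1) eqG unfolding \<Psi>(2) equiv_def by (meson transD)
    then have "cohomologous M A G `` {\<Theta>} = ?R ?\<nu>" by (rule equiv_class_eq[OF eqG])
    moreover have "\<mu> = cohomologous M A G `` {\<Theta>}"
    proof -
      obtain \<Theta>1 where \<Theta>1: "\<mu> = cohomologous M A G `` {\<Theta>1}"
        using \<mu> unfolding H1_def by (auto elim: quotientE)
      then have "(\<Theta>1, \<Theta>) \<in> cohomologous M A G" using \<Theta>(1) by blast
      then show ?thesis unfolding \<Theta>1 by (rule equiv_class_eq[OF eqG])
    qed
    ultimately show ?thesis using \<nu> by blast
  qed
  then have "{\<mu> \<in> H1 M A G. \<exists>\<Theta>\<in>\<mu>. push \<Theta> \<in> q} \<subseteq> ?R ` H1 M A ?H" by blast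
  then have "|{\<mu> \<in> H1 M A G. \<exists>\<Theta>\<in>\<mu>. push \<Theta> \<in> q}| \<le>o |?R ` H1 M A ?H|" by (rule card_of_mono1)
  also have "|?R ` H1 M A ?H| \<le>o |H1 M A ?H|" by (rule card_of_image)
  also have "|H1 M A ?H| \<le>o \<kappa>" by (rule bound[OF \<mu>0(1)])
  finally show ?thesis .
qed

theorem corollary5p1:
  fixes M :: "('f, 'r, 'a) fo_structure"
    and A :: "'a set"
    and G :: "'a list monoid"
    and N :: "'a list set"
    and \<kappa> :: "'k rel"
  assumes "atomic_over M A"
    and "homogeneous_over M A"
    and "eliminates_imaginaries M"
    and "definable_group M A G"
    and "N \<lhd> G"
    and "\<exists>n. definable M A n N"
    and "Card_order \<kappa>" and "cinfinite \<kappa>"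
    and "|H1 M A (definable_quotient M A G N)| \<le>o \<kappa>"
    and "\<And>\<mu>. \<mu> \<in> H1 M A G \<Longrightarrow> |H1 M A (twisted_form M A G N \<mu>)| \<le>o \<kappa>"
  shows "|H1 M A G| \<le>o \<kappa>"
proof -
  interpret definable_normal_subgroup M A N G
    using assms(1,2,4-6)
    by (intro definable_normal_subgroup.intro atomic_homogeneous.intro
        definable_normal_subgroup_axioms.intro)
  let ?Q = "definable_quotient M A G N"
  have "is_definable_quotient M A G N ?Q"
    unfolding definable_quotient_def by (rule someI_ex[OF definable_quotient_exists[OF assms(3)]])
  then obtain p where p: "definable_group M A ?Q" "p \<in> hom G ?Q" "p ` carrier G = carrier ?Q"
    "kernel G ?Q p = N" "definable_map M A (carrier G) p"
    unfolding is_definable_quotient_def by blast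
  interpret definable_quotient_map M A N G ?Q p
    by unfold_locales (use p in auto)
  note eqG = cohomologous_equiv[OF group_definable]
  let ?fibre = "\<lambda>q. {\<mu> \<in> H1 M A G. \<exists>\<Theta>\<in>\<mu>. push \<Theta> \<in> q}"
  have "|?fibre q| \<le>o \<kappa>" if q: "q \<in> H1 M A ?Q" for q
  proof (cases "?fibre q = {}")
    case True
    show ?thesis
      unfolding True by (rule card_of_empty1[OF disjI2[OF assms(7)]])
  next
    case False
    then obtain \<mu> \<Phi> where \<mu>: "\<mu> \<in> H1 M A G" "\<Phi> \<in> \<mu>" "push \<Phi> \<in> q" by blast
    show ?thesis by (rule card_H1_fibre[OF assms(3) q _ \<mu>]) (rule assms(10))
  qed
  then have "|\<Union>q\<in>H1 M A ?Q. ?fibre q| \<le>o \<kappa>"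
    using assms(7,8,9) by (intro card_of_UNION_ordLeq_infinite_Field) (auto simp: cinfinite_def)
  moreover have "H1 M A G \<subseteq> (\<Union>q\<in>H1 M A ?Q. ?fibre q)"
  proof
    fix \<mu> assume \<mu>: "\<mu> \<in> H1 M A G"
    then obtain \<Phi> where \<Phi>: "\<Phi> \<in> definable_cocycles M A G" "\<mu> = cohomologous M A G `` {\<Phi>}"
      unfolding H1_def by (auto elim: quotientE)
    have "\<Phi> \<in> \<mu>" unfolding \<Phi>(2) by (rule equiv_class_self[OF eqG \<Phi>(1)])
    moreover have "cohomologous M A ?Q `` {push \<Phi>} \<in> H1 M A ?Q"
      unfolding H1_def by (rule quotientI[OF push_cocycle[OF \<Phi>(1)]])
    moreover have "push \<Phi> \<in> cohomologous M A ?Q `` {push \<Phi>}"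
      by (rule equiv_class_self[OF cohomologous_equiv[OF Q_definable] push_cocycle[OF \<Phi>(1)]])
    ultimately show "\<mu> \<in> (\<Union>q\<in>H1 M A ?Q. ?fibre q)" using \<mu> by blast
  qed
  ultimately show ?thesis using ordLeq_transitive[OF card_of_mono1] by blast
qed

end
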